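(* Let $(X,g)$ be a Riemannian manifold. Suppose that $\Sigma_t$, $t\in[0,T)$, is a generalized mean curvature flow in $T^*X$ given as the graph of a closed $1$-form $\chi_t$ on $X$, and that the Lagrangian angle $\theta(\chi_0)$ of $\Sigma_0$ satisfies $\operatorname{osc}(\theta(\chi_0))<2\pi$. Then the $1$-form $\chi_t$ is in the cohomology class $[\chi_0]\in H^1(X,\mathbb R)$, that is, there exists a smooth function $u_t$ on $X$ such that $\chi_t=\chi_0+du_t$. Furthermore, $u_t$ satisfies $$\frac{\partial u_t}{\partial t}=\theta(\chi_t)=\frac{1}{\sqrt{-1}}\log\frac{\det(g_{ij}+\sqrt{-1}(\chi_t)_{j,i})}{\sqrt{\det g_{ij}}\sqrt{\det(\eta_t)_{ij}}},$$ where $(\chi_t)_{j,i}$ is the covariant derivative of $\chi_t$ with respect to $g$ and $(\eta_t)_{ij}=g_{ij}+(\chi_t)_{k,i}g^{kl}(\chi_t)_{l,j}$ is the induced metric on the graph $\Sigma_t$ of $\chi_t$.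
   Context: Geometry of $M=T^*X$. Let $\Gamma_{ij}^k$ be the Christoffel symbols of $g$. In local coordinates $(q^i,p_i)$ on $M$ induced by coordinates $q^i$ on $X$, let $\omega=\sum_i dq^i\wedge dp_i$, $\theta_i=dp_i-\Gamma_{il}^kp_k\,dq^l$, $X_i=\frac{\partial}{\partial q^i}+\Gamma_{il}^kp_k\frac{\partial}{\partial p_l}$ and $X^i=g^{ij}X_j$. The horizontal distribution $\mathcal H$ of $TM$ is spanned by the $X^i$. The metric is $G=g_{ij}dq^i\otimes dq^j+g^{ij}\theta_i\otimes\theta_j$, and the almost complex structure $J$ is given by $JX^i=\frac{\partial}{\partial p_i}$, $J\frac{\partial}{\partial p_i}=-X^i$, so that $\omega(\cdot,\cdot)=G(J\cdot,\cdot)$. The canonical connection $\widehat\nabla$ on $TM$ is given by $\widehat\nabla X^i=-\Gamma^i_{jk}dq^j\otimes X^k$ and $\widehat\nabla\frac{\partial}{\partial p_i}=-\Gamma^i_{jk}dq^j\otimes\frac{\partial}{\partial p_k}$. Generalized mean curvature flow. For a Lagrangian submanifold $\Sigma$ of $M$ with local orthonormal tangent frame $e_1,\dots,e_n$, put $\nu_i=\sum_kG(\widehat\nabla_{e_i}e_k,Je_k)$; the generalized mean curvature vector is $\widehat H=\sum_i\nu_iJe_i$. A smooth family of immersions $F:\Sigma\times[0,T)\to M$ satisfies the generalized mean curvature flow if $\frac{\partial F}{\partial t}(x,t)=\widehat H(x,t)$ and $F(\Sigma,0)=\Sigma_0$, where $\widehat H(x,t)$ is the generalized mean curvature vector of $\Sigma_t=F(\Sigma,t)$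 at $F(x,t)$. Graphs. The graph $\Sigma_\chi=\{(x,\chi(x)):x\in X\}$ of a $1$-form $\chi$ is Lagrangian if and only if $\chi$ is closed. With $\chi_{j,i}$ the covariant derivative of $\chi$ with respect to $g$ and $\eta_{ij}=g_{ij}+\chi_{k,i}g^{kl}\chi_{l,j}$, the Lagrangian angle $\theta(\chi)$ of $\Sigma_\chi$ with respect to $\mathcal H$ is determined by $e^{\sqrt{-1}\theta(\chi)}=\det(g_{ij}+\sqrt{-1}\chi_{j,i})/(\sqrt{\det g_{ij}}\sqrt{\det\eta_{ij}})$; it is defined only up to adding an integer multiple of $2\pi$. $\operatorname{osc}$ denotes the oscillation (supremum minus infimum) over $X$. *)

theory Defs
  imports "HOL-Analysis.Analysis" "HOL-Library.Extended_Real"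
begin

section \<open>Smooth maps on subsets of Euclidean space\<close>

text \<open>
  Derivatives are taken within the set, so that the definition also covers relatively
  open subsets of half-spaces such as \<open>U \<times> [0,T)\<close>, with one-sided derivatives at the boundary.
  On those sets the derivative is unique.
\<close>

primrec Ck_on :: "nat \<Rightarrow> ('a::real_normed_vector \<Rightarrow> 'b::real_normed_vector) \<Rightarrow> 'a set \<Rightarrow> bool" where
  "Ck_on 0 f S \<longleftrightarrow> continuous_on S f"
| "Ck_on (Suc k) f S \<longleftrightarrow>
     (\<exists>D. (\<forall>x\<in>S. (f has_derivative D x) (at x within S)) \<and> (\<forall>v. Ck_on k (\<lambda>x. D x v) S))"

definition Cinf_on :: "('a::real_normed_vector \<Rightarrow> 'b::real_normed_vector) \<Rightarrow> 'a set \<Rightarrow> bool" where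
  "Cinf_on f S \<longleftrightarrow> (\<forall>k. Ck_on k f S)"

abbreviation fderiv :: "('a::real_normed_vector \<Rightarrow> 'b::real_normed_vector) \<Rightarrow> 'a \<Rightarrow> 'a \<Rightarrow> 'b" where
  "fderiv f x \<equiv> frechet_derivative f (at x)"

definition partial :: "'n \<Rightarrow> (real^'n \<Rightarrow> real) \<Rightarrow> real^'n \<Rightarrow> real" where
  "partial i f q = fderiv f q (axis i 1)"

section \<open>Smooth manifolds and tensors in charts\<close>

text \<open>A chart is a pair of its domain and its coordinate map; the values of the coordinate map
  outside the domain are irrelevant.\<close>

type_synonym ('x, 'n) chart = "'x set \<times> ('x \<Rightarrow> real^'n)"

abbreviation dom_chart :: "('x, 'n) chart \<Rightarrow> 'x set" where
  "dom_chart c \<equiv> fst c"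

definition inv_chart :: "('x, 'n) chart \<Rightarrow> real^'n \<Rightarrow> 'x" where
  "inv_chart c = inv_into (fst c) (snd c)"

definition im_chart :: "('x, 'n) chart \<Rightarrow> (real^'n) set" where
  "im_chart c = snd c ` fst c"

definition smooth_manifold ::
  "('x::{t2_space,second_countable_topology}, 'n::finite) chart set \<Rightarrow> bool" where
  "smooth_manifold A \<longleftrightarrow>
     (\<Union>c\<in>A. dom_chart c) = UNIV \<and>
     (\<forall>c\<in>A. open (dom_chart c) \<and> open (im_chart c) \<and>
        homeomorphism (dom_chart c) (im_chart c) (snd c) (inv_chart c)) \<and>
     (\<forall>c\<in>A. \<forall>d\<in>A. Cinf_on (snd d \<circ> inv_chart c) (snd c ` (dom_chart c \<inter> dom_chart d)))"

text \<open>The entry in row \<open>k\<close> and column \<open>i\<close> is the partial derivative of the \<open>k\<close>-th coordinate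
  of \<open>d\<close> with respect to the \<open>i\<close>-th coordinate of \<open>c\<close>.\<close>

definition jacobian :: "('x, 'n::finite) chart \<Rightarrow> ('x, 'n) chart \<Rightarrow> 'x \<Rightarrow> real^'n^'n" where
  "jacobian c d x = matrix (fderiv (snd d \<circ> inv_chart c) (snd c x))"

definition smooth_function :: "('x, 'n::finite) chart set \<Rightarrow> ('x \<Rightarrow> real) \<Rightarrow> bool" where
  "smooth_function A u \<longleftrightarrow> (\<forall>c\<in>A. Cinf_on (u \<circ> inv_chart c) (im_chart c))"

text \<open>
  A covector at \<open>x\<close> is the family of its components in the charts of the atlas around \<open>x\<close>,
  subject to the transformation law. In order to have a unique representative, the family is
  set to zero at all other arguments.
\<close>

type_synonym ('x, 'n) covector = "('x, 'n) chart \<Rightarrow> real^'n"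

definition cotangent_bundle ::
  "('x, 'n::finite) chart set \<Rightarrow> ('x \<times> ('x, 'n) covector) set" where
  "cotangent_bundle A = {(x, p).
     (\<forall>c\<in>A. \<forall>d\<in>A. x \<in> dom_chart c \<inter> dom_chart d \<longrightarrow> p c = transpose (jacobian c d x) *v p d) \<and>
     (\<forall>c. \<not> (c \<in> A \<and> x \<in> dom_chart c) \<longrightarrow> p c = 0)}"

text \<open>The coordinate map \<open>(q, p)\<close> on the cotangent bundle induced by the chart \<open>c\<close>.\<close>

definition cotangent_coord ::
  "('x, 'n) chart \<Rightarrow> 'x \<times> ('x, 'n) covector \<Rightarrow> (real^'n) \<times> (real^'n)" where
  "cotangent_coord c m = (snd c (fst m), snd m c)"

text \<open>The components of a tensor field in the chart \<open>c\<close>, as a function of the coordinates.\<close>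

definition in_chart :: "('x, 'n) chart \<Rightarrow> ('x \<Rightarrow> ('x, 'n) chart \<Rightarrow> 'b) \<Rightarrow> real^'n \<Rightarrow> 'b" where
  "in_chart c \<tau> q = \<tau> (inv_chart c q) c"

definition one_form :: "('x, 'n::finite) chart set \<Rightarrow> ('x \<Rightarrow> ('x, 'n) covector) \<Rightarrow> bool" where
  "one_form A \<alpha> \<longleftrightarrow>
     (\<forall>x. (x, \<alpha> x) \<in> cotangent_bundle A) \<and>
     (\<forall>c\<in>A. Cinf_on (in_chart c \<alpha>) (im_chart c))"

definition closed_one_form :: "('x, 'n::finite) chart set \<Rightarrow> ('x \<Rightarrow> ('x, 'n) covector) \<Rightarrow> bool" where
  "closed_one_form A \<alpha> \<longleftrightarrow> one_form A \<alpha> \<and>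
     (\<forall>c\<in>A. \<forall>q\<in>im_chart c. \<forall>i j.
        partial i (\<lambda>q. in_chart c \<alpha> q $ j) q = partial j (\<lambda>q. in_chart c \<alpha> q $ i) q)"

definition differential :: "('x, 'n::finite) chart set \<Rightarrow> ('x \<Rightarrow> real) \<Rightarrow> 'x \<Rightarrow> ('x, 'n) covector" where
  "differential A u x c =
     (if c \<in> A \<and> x \<in> dom_chart c then \<chi> i. partial i (u \<circ> inv_chart c) (snd c x) else 0)"

definition graph_of :: "('x \<Rightarrow> ('x, 'n) covector) \<Rightarrow> ('x \<times> ('x, 'n) covector) set" where
  "graph_of \<alpha> = {(x, \<alpha> x) | x. True}"

definition riemannian_metric ::
  "('x, 'n::finite) chart set \<Rightarrow> ('x \<Rightarrow> ('x, 'n) chart \<Rightarrow> real^'n^'n) \<Rightarrow> bool" where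
  "riemannian_metric A g \<longleftrightarrow>
     (\<forall>c\<in>A. \<forall>x\<in>dom_chart c. transpose (g x c) = g x c \<and> (\<forall>v. v \<noteq> 0 \<longrightarrow> v \<bullet> (g x c *v v) > 0)) \<and>
     (\<forall>c\<in>A. \<forall>d\<in>A. \<forall>x\<in>dom_chart c \<inter> dom_chart d.
        g x c = transpose (jacobian c d x) ** g x d ** jacobian c d x) \<and>
     (\<forall>c\<in>A. Cinf_on (in_chart c g) (im_chart c))"

section \<open>Geometry of the cotangent bundle in induced coordinates\<close>

text \<open>
  In this section \<open>g\<close> is the matrix of the metric as a function of the coordinates \<open>q\<close> of a
  chart, \<open>m = (q, p)\<close> is a point in the induced coordinates of the cotangent bundle, and
  \<open>v = (a, b)\<close> stands for the tangent vector
  \<open>\<Sum>i. a\<^sub>i \<partial>/\<partial>q\<^sup>i + b\<^sub>i \<partial>/\<partial>p\<^sub>i\<close> at \<open>m\<close>.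
\<close>

type_synonym 'n phase = "(real^'n) \<times> (real^'n)"

definition ginv :: "(real^'n \<Rightarrow> real^'n^'n) \<Rightarrow> real^'n \<Rightarrow> 'n \<Rightarrow> 'n::finite \<Rightarrow> real" where
  "ginv g q i j = matrix_inv (g q) $ i $ j"

definition christoffel ::
  "(real^'n \<Rightarrow> real^'n^'n) \<Rightarrow> real^'n \<Rightarrow> 'n \<Rightarrow> 'n \<Rightarrow> 'n::finite \<Rightarrow> real" where
  "christoffel g q k i j = (1/2) * (\<Sum>l\<in>UNIV. ginv g q k l *
     (partial i (\<lambda>q. g q $ j $ l) q + partial j (\<lambda>q. g q $ i $ l) q - partial l (\<lambda>q. g q $ i $ j) q))"

definition symplectic_form :: "'n phase \<Rightarrow> 'n::finite phase \<Rightarrow> real" where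
  "symplectic_form v w = (\<Sum>i\<in>UNIV. fst v $ i * snd w $ i - fst w $ i * snd v $ i)"

definition theta_form :: "(real^'n \<Rightarrow> real^'n^'n) \<Rightarrow> 'n phase \<Rightarrow> 'n \<Rightarrow> 'n::finite phase \<Rightarrow> real" where
  "theta_form g m i v =
     snd v $ i - (\<Sum>k\<in>UNIV. \<Sum>l\<in>UNIV. christoffel g (fst m) k i l * snd m $ k * fst v $ l)"

definition horiz_lower :: "(real^'n \<Rightarrow> real^'n^'n) \<Rightarrow> 'n phase \<Rightarrow> 'n \<Rightarrow> 'n::finite phase" where
  "horiz_lower g m i = (axis i 1, \<chi> l. \<Sum>k\<in>UNIV. christoffel g (fst m) k i l * snd m $ k)"

definition horiz :: "(real^'n \<Rightarrow> real^'n^'n) \<Rightarrow> 'n phase \<Rightarrow> 'n \<Rightarrow> 'n::finite phase" where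
  "horiz g m i = (\<Sum>j\<in>UNIV. ginv g (fst m) i j *\<^sub>R horiz_lower g m j)"

definition vert :: "'n \<Rightarrow> 'n::finite phase" where
  "vert i = (0, axis i 1)"

definition metricG :: "(real^'n \<Rightarrow> real^'n^'n) \<Rightarrow> 'n phase \<Rightarrow> 'n phase \<Rightarrow> 'n::finite phase \<Rightarrow> real" where
  "metricG g m v w =
     (\<Sum>i\<in>UNIV. \<Sum>j\<in>UNIV. g (fst m) $ i $ j * fst v $ i * fst w $ j) +
     (\<Sum>i\<in>UNIV. \<Sum>j\<in>UNIV. ginv g (fst m) i j * theta_form g m i v * theta_form g m j w)"

text \<open>Every tangent vector is \<open>v = \<Sum>i. A\<^sub>i X\<^sup>i + B\<^sub>i \<partial>/\<partial>p\<^sub>i\<close>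
  with \<open>A\<^sub>i\<close> given by \<open>coef_horiz\<close> and \<open>B\<^sub>i = \<theta>\<^sub>i(v)\<close>
  (lemma \<open>phase_decomp\<close> below).\<close>

definition coef_horiz :: "(real^'n \<Rightarrow> real^'n^'n) \<Rightarrow> 'n phase \<Rightarrow> 'n \<Rightarrow> 'n::finite phase \<Rightarrow> real" where
  "coef_horiz g m i v = (\<Sum>j\<in>UNIV. g (fst m) $ i $ j * fst v $ j)"

definition complexJ :: "(real^'n \<Rightarrow> real^'n^'n) \<Rightarrow> 'n phase \<Rightarrow> 'n phase \<Rightarrow> 'n::finite phase" where
  "complexJ g m v =
     (\<Sum>i\<in>UNIV. coef_horiz g m i v *\<^sub>R vert i) - (\<Sum>i\<in>UNIV. theta_form g m i v *\<^sub>R horiz g m i)"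

text \<open>
  The covariant derivative at \<open>y\<close> in the direction \<open>v\<close>, with respect to the canonical
  connection, of a vector field \<open>W\<close> along a map \<open>f\<close> into the cotangent bundle:
  the Leibniz rule applied to \<open>W = \<Sum>i. A\<^sub>i X\<^sup>i + B\<^sub>i \<partial>/\<partial>p\<^sub>i\<close>.
\<close>

definition conn_along ::
  "(real^'n \<Rightarrow> real^'n^'n) \<Rightarrow> (real^'n \<Rightarrow> 'n phase) \<Rightarrow> (real^'n \<Rightarrow> 'n phase) \<Rightarrow>
   real^'n \<Rightarrow> real^'n \<Rightarrow> 'n::finite phase" where
  "conn_along g f W y v =
     (let A = (\<lambda>i z. coef_horiz g (f z) i (W z));
          B = (\<lambda>i z. theta_form g (f z) i (W z));
          \<Gamma> = christoffel g (fst (f y));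
          dq = (\<lambda>j. fst (fderiv f y v) $ j)
      in (\<Sum>i\<in>UNIV. fderiv (A i) y v *\<^sub>R horiz g (f y) i
            + A i y *\<^sub>R (\<Sum>j\<in>UNIV. \<Sum>k\<in>UNIV. (- \<Gamma> i j k * dq j) *\<^sub>R horiz g (f y) k))
       + (\<Sum>i\<in>UNIV. fderiv (B i) y v *\<^sub>R vert i
            + B i y *\<^sub>R (\<Sum>j\<in>UNIV. \<Sum>k\<in>UNIV. (- \<Gamma> i j k * dq j) *\<^sub>R vert k)))"

text \<open>
  \<open>f\<close> is an immersion in local coordinates of source and target. A local orthonormal tangent
  frame \<open>e\<^sub>1, \<dots>, e\<^sub>n\<close> on \<open>N\<close> is given as the image under the derivative of \<open>f\<close>
  of smooth vector fields \<open>\<epsilon>\<^sub>1, \<dots>, \<epsilon>\<^sub>n\<close> on \<open>N\<close>.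
\<close>

definition push :: "(real^'n \<Rightarrow> 'n phase) \<Rightarrow> (real^'n \<Rightarrow> real^'n) \<Rightarrow> real^'n \<Rightarrow> 'n::finite phase" where
  "push f \<epsilon> z = fderiv f z (\<epsilon> z)"

definition orthonormal_tangent_frame ::
  "(real^'n \<Rightarrow> real^'n^'n) \<Rightarrow> (real^'n \<Rightarrow> 'n phase) \<Rightarrow> (real^'n) set \<Rightarrow>
   ('n::finite \<Rightarrow> real^'n \<Rightarrow> real^'n) \<Rightarrow> bool" where
  "orthonormal_tangent_frame g f N \<epsilon> \<longleftrightarrow>
     (\<forall>k. Cinf_on (\<epsilon> k) N) \<and>
     (\<forall>z\<in>N. \<forall>k l. metricG g (f z) (push f (\<epsilon> k) z) (push f (\<epsilon> l) z) = (if k = l then 1 else 0))"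

definition mean_curv_coef ::
  "(real^'n \<Rightarrow> real^'n^'n) \<Rightarrow> (real^'n \<Rightarrow> 'n phase) \<Rightarrow>
   ('n::finite \<Rightarrow> real^'n \<Rightarrow> real^'n) \<Rightarrow> real^'n \<Rightarrow> 'n \<Rightarrow> real" where
  "mean_curv_coef g f \<epsilon> y i =
     (\<Sum>k\<in>UNIV. metricG g (f y) (conn_along g f (push f (\<epsilon> k)) y (\<epsilon> i y))
                              (complexJ g (f y) (push f (\<epsilon> k) y)))"

text \<open>On Lagrangian immersions the vector does not depend on the frame.\<close>

definition is_gen_mean_curvature ::
  "(real^'n \<Rightarrow> real^'n^'n) \<Rightarrow> (real^'n \<Rightarrow> 'n phase) \<Rightarrow> real^'n \<Rightarrow> 'n::finite phase \<Rightarrow> bool" where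
  "is_gen_mean_curvature g f y H \<longleftrightarrow>
     (\<exists>N \<epsilon>. open N \<and> y \<in> N \<and> orthonormal_tangent_frame g f N \<epsilon> \<and>
        H = (\<Sum>i\<in>UNIV. mean_curv_coef g f \<epsilon> y i *\<^sub>R complexJ g (f y) (push f (\<epsilon> i) y)))"

section \<open>Generalized mean curvature flow\<close>

definition time_interval :: "ereal \<Rightarrow> real set" where
  "time_interval T = {t. 0 \<le> t \<and> ereal t < T}"

text \<open>A map \<open>f\<close> into the cotangent bundle, in the chart \<open>s\<close> of the source and the chart of the
  cotangent bundle induced by \<open>c\<close>.\<close>

definition local_map ::
  "('s, 'n) chart \<Rightarrow> ('x, 'n) chart \<Rightarrow> ('s \<Rightarrow> 'x \<times> ('x, 'n) covector) \<Rightarrow> real^'n \<Rightarrow> 'n phase" where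
  "local_map s c f = cotangent_coord c \<circ> f \<circ> inv_chart s"

text \<open>Continuity of the base point makes the sets on which the coordinate expression is
  required to be smooth relatively open.\<close>

definition smooth_family ::
  "('x::topological_space, 'n::finite) chart set \<Rightarrow> ('s::topological_space, 'n) chart set \<Rightarrow> ereal \<Rightarrow>
   ('s \<Rightarrow> real \<Rightarrow> 'x \<times> ('x, 'n) covector) \<Rightarrow> bool" where
  "smooth_family A S T F \<longleftrightarrow>
     (\<forall>\<sigma>. \<forall>t\<in>time_interval T. F \<sigma> t \<in> cotangent_bundle A) \<and>
     continuous_on (UNIV \<times> time_interval T) (\<lambda>(\<sigma>, t). fst (F \<sigma> t)) \<and>
     (\<forall>s\<in>S. \<forall>c\<in>A. Cinf_on (\<lambda>(y, t). local_map s c (\<lambda>\<sigma>. F \<sigma> t) y)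
        {(y, t). y \<in> im_chart s \<and> t \<in> time_interval T \<and> fst (F (inv_chart s y) t) \<in> dom_chart c})"

definition lagrangian_immersion ::
  "('x, 'n::finite) chart set \<Rightarrow> ('s, 'n) chart set \<Rightarrow> ('s \<Rightarrow> 'x \<times> ('x, 'n) covector) \<Rightarrow> bool" where
  "lagrangian_immersion A S f \<longleftrightarrow>
     (\<forall>s\<in>S. \<forall>c\<in>A. \<forall>\<sigma>\<in>dom_chart s. fst (f \<sigma>) \<in> dom_chart c \<longrightarrow>
        (let D = fderiv (local_map s c f) (snd s \<sigma>)
         in inj D \<and> (\<forall>v w. symplectic_form (D v) (D w) = 0)))"

definition gen_mean_curvature_flow ::
  "('x::topological_space, 'n::finite) chart set \<Rightarrow> ('x \<Rightarrow> ('x, 'n) chart \<Rightarrow> real^'n^'n) \<Rightarrow>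
   ('s::topological_space, 'n) chart set \<Rightarrow> ereal \<Rightarrow>
   ('s \<Rightarrow> real \<Rightarrow> 'x \<times> ('x, 'n) covector) \<Rightarrow> bool" where
  "gen_mean_curvature_flow A g S T F \<longleftrightarrow>
     smooth_family A S T F \<and>
     (\<forall>t\<in>time_interval T. lagrangian_immersion A S (\<lambda>\<sigma>. F \<sigma> t)) \<and>
     (\<forall>t\<in>time_interval T. \<forall>\<sigma>. \<forall>s\<in>S. \<forall>c\<in>A. \<sigma> \<in> dom_chart s \<longrightarrow> fst (F \<sigma> t) \<in> dom_chart c \<longrightarrow>
        (\<exists>H. is_gen_mean_curvature (in_chart c g) (local_map s c (\<lambda>\<sigma>. F \<sigma> t)) (snd s \<sigma>) H \<and>
             ((\<lambda>\<tau>. cotangent_coord c (F \<sigma> \<tau>)) has_vector_derivative H) (at t within time_interval T)))"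

section \<open>Lagrangian angle of a graph\<close>

text \<open>\<open>cov_deriv g a q j i\<close> is \<open>a\<^sub>j\<^sub>,\<^sub>i\<close>: the first index belongs to the form, the second one
  is the direction of differentiation.\<close>

definition cov_deriv ::
  "(real^'n \<Rightarrow> real^'n^'n) \<Rightarrow> (real^'n \<Rightarrow> real^'n) \<Rightarrow> real^'n \<Rightarrow> 'n \<Rightarrow> 'n::finite \<Rightarrow> real" where
  "cov_deriv g a q j i = partial i (\<lambda>q. a q $ j) q - (\<Sum>k\<in>UNIV. christoffel g q k i j * a q $ k)"

definition induced_metric ::
  "(real^'n \<Rightarrow> real^'n^'n) \<Rightarrow> (real^'n \<Rightarrow> real^'n) \<Rightarrow> real^'n \<Rightarrow> real^'n^'n::finite" where
  "induced_metric g a q = (\<chi> i j. g q $ i $ j +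
     (\<Sum>k\<in>UNIV. \<Sum>l\<in>UNIV. cov_deriv g a q k i * ginv g q k l * cov_deriv g a q l j))"

definition angle_phase ::
  "(real^'n \<Rightarrow> real^'n^'n) \<Rightarrow> (real^'n \<Rightarrow> real^'n) \<Rightarrow> real^'n::finite \<Rightarrow> complex" where
  "angle_phase g a q =
     det ((\<chi> i j. complex_of_real (g q $ i $ j) + \<i> * complex_of_real (cov_deriv g a q j i))
            :: complex^'n^'n)
     / complex_of_real (sqrt (det (g q)) * sqrt (det (induced_metric g a q)))"

text \<open>
  The angle is only determined up to integer multiples of \<open>2\<pi>\<close>, so this is a predicate: \<open>\<theta>\<close> is
  one choice of values of the multivalued function \<open>(1/\<i>) log (angle_phase \<dots>)\<close>. No continuity
  is built in.
\<close>

definition is_lagrangian_angle ::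
  "('x, 'n::finite) chart set \<Rightarrow> ('x \<Rightarrow> ('x, 'n) chart \<Rightarrow> real^'n^'n) \<Rightarrow>
   ('x \<Rightarrow> ('x, 'n) covector) \<Rightarrow> ('x \<Rightarrow> real) \<Rightarrow> bool" where
  "is_lagrangian_angle A g \<alpha> \<theta> \<longleftrightarrow>
     (\<forall>c\<in>A. \<forall>x\<in>dom_chart c.
        exp (\<i> * complex_of_real (\<theta> x)) = angle_phase (in_chart c g) (in_chart c \<alpha>) (snd c x))"

definition osc :: "('x \<Rightarrow> real) \<Rightarrow> ereal" where
  "osc f = (SUP x. ereal (f x)) - (INF x. ereal (f x))"

section \<open>Defining properties of the structures on the cotangent bundle\<close>

lemma partial_cong_open:
  assumes "open U" "q \<in> U" "\<And>z. z \<in> U \<Longrightarrow> f z = h z"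
  shows "partial i f q = partial i h q"
proof -
  have "(f has_derivative D) (at q) \<longleftrightarrow> (h has_derivative D) (at q)" for D
    using assms has_derivative_transform_within_open[of f D q UNIV U h]
      has_derivative_transform_within_open[of h D q UNIV U f] by auto
  then show ?thesis by (simp add: partial_def frechet_derivative_def)
qed

lemma matrix_inv_both:
  fixes B :: "real^'n^'n"
  assumes "invertible B"
  shows "B ** matrix_inv B = mat 1" "matrix_inv B ** B = mat 1"
proof -
  have "B ** matrix_inv B = mat 1 \<and> matrix_inv B ** B = mat 1"
    unfolding matrix_inv_def using assms unfolding invertible_def by (rule someI_ex)
  then show "B ** matrix_inv B = mat 1" "matrix_inv B ** B = mat 1" by auto
qed

lemma ginv_right:
  assumes "invertible (g q)"
  shows "(\<Sum>k\<in>UNIV. g q $ i $ k * ginv g q k j) = (if i = j then 1 else 0)"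
proof -
  have "(g q ** matrix_inv (g q)) $ i $ j = mat 1 $ i $ j"
    using assms by (simp add: matrix_inv_both)
  then show ?thesis by (simp add: matrix_matrix_mult_def mat_def ginv_def)
qed

lemma ginv_left:
  assumes "invertible (g q)"
  shows "(\<Sum>k\<in>UNIV. ginv g q i k * g q $ k $ j) = (if i = j then 1 else 0)"
proof -
  have "(matrix_inv (g q) ** g q) $ i $ j = mat 1 $ i $ j"
    using assms by (simp add: matrix_inv_both)
  then show ?thesis by (simp add: matrix_matrix_mult_def mat_def ginv_def)
qed

lemma ginv_sym:
  assumes "invertible (g q)" "transpose (g q) = g q"
  shows "ginv g q i j = ginv g q j i"
proof -
  let ?B = "matrix_inv (g q)"
  have "g q ** transpose ?B = transpose (?B ** g q)"
    by (simp add: matrix_transpose_mul assms(2))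
  also have "\<dots> = mat 1" using assms(1) by (simp add: matrix_inv_both transpose_mat)
  finally have 1: "g q ** transpose ?B = mat 1" .
  have "transpose ?B = (?B ** g q) ** transpose ?B"
    using assms(1) by (simp add: matrix_inv_both)
  also have "\<dots> = ?B ** (g q ** transpose ?B)"
    by (simp add: matrix_mul_assoc)
  also have "\<dots> = ?B" by (simp add: 1)
  finally have "transpose ?B $ i $ j = ?B $ i $ j" by simp
  then show ?thesis by (simp add: transpose_def ginv_def)
qed

locale local_metric =
  fixes g :: "real^'n \<Rightarrow> real^'n^'n::finite" and m :: "'n phase" and U :: "(real^'n) set"
  assumes open_U: "open U" and m_U: "fst m \<in> U"
    and sym: "\<And>q. q \<in> U \<Longrightarrow> transpose (g q) = g q"
    and inv: "invertible (g (fst m))"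
begin

lemma g_sym: "q \<in> U \<Longrightarrow> g q $ i $ j = g q $ j $ i"
  using sym[of q] by (metis transpose_def vec_lambda_beta)

lemma christoffel_sym: "christoffel g (fst m) k i j = christoffel g (fst m) k j i"
proof -
  have "partial l (\<lambda>q. g q $ i $ j) (fst m) = partial l (\<lambda>q. g q $ j $ i) (fst m)" for l
    by (rule partial_cong_open[OF open_U m_U]) (rule g_sym)
  then show ?thesis by (simp add: christoffel_def algebra_simps)
qed

lemma theta_form_sum: "theta_form g m i (\<Sum>j\<in>UNIV. a j *\<^sub>R v j) = (\<Sum>j\<in>UNIV. a j * theta_form g m i (v j))"
proof -
  have "linear (theta_form g m i)"
    by (rule linearI) (simp_all add: theta_form_def algebra_simps sum.distrib sum_distrib_left)
  then show ?thesis by (simp add: linear_sum linear_cmul)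
qed

lemma theta_horiz_lower: "theta_form g m i (horiz_lower g m j) = 0"
  by (simp add: theta_form_def horiz_lower_def axis_def if_distrib christoffel_sym[of _ i j] cong: if_cong)

lemma theta_horiz: "theta_form g m i (horiz g m j) = 0"
  by (simp add: horiz_def theta_form_sum theta_horiz_lower)

lemma theta_vert: "theta_form g m i (vert j) = (if i = j then 1 else 0)"
  by (simp add: theta_form_def vert_def axis_def)

lemma fst_horiz: "fst (horiz g m i) $ k = ginv g (fst m) i k"
  by (simp add: horiz_def fst_sum horiz_lower_def axis_def if_distrib cong: if_cong)

lemma coef_horiz_horiz: "coef_horiz g m j (horiz g m i) = (if i = j then 1 else 0)"
  using ginv_left[where g=g and q="fst m" and i=i and j=j, OF inv]
  by (simp add: coef_horiz_def fst_horiz g_sym[OF m_U, of j] mult.commute)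

lemma coef_horiz_vert: "coef_horiz g m j (vert i) = 0"
  by (simp add: coef_horiz_def vert_def)

lemma complexJ_horiz: "complexJ g m (horiz g m i) = vert i"
  by (simp add: complexJ_def theta_horiz coef_horiz_horiz if_distrib[of "\<lambda>x. x *\<^sub>R _"] cong: if_cong)

lemma complexJ_vert: "complexJ g m (vert i) = - horiz g m i"
  by (simp add: complexJ_def theta_vert coef_horiz_vert if_distrib[of "\<lambda>x. x *\<^sub>R _"] cong: if_cong)

lemma sum_coef_horiz: "(\<Sum>i\<in>UNIV. coef_horiz g m i v *\<^sub>R horiz g m i) = (\<Sum>j\<in>UNIV. fst v $ j *\<^sub>R horiz_lower g m j)"
proof -
  have 1: "(\<Sum>i\<in>UNIV. coef_horiz g m i v * ginv g (fst m) i j) = fst v $ j" for j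
  proof -
    have "(\<Sum>i\<in>UNIV. coef_horiz g m i v * ginv g (fst m) i j)
        = (\<Sum>i\<in>UNIV. \<Sum>k\<in>UNIV. fst v $ k * (g (fst m) $ k $ i * ginv g (fst m) i j))"
      by (simp add: coef_horiz_def sum_distrib_right sum_distrib_left mult_ac)
        (intro sum.cong refl, simp add: g_sym[OF m_U])
    also have "\<dots> = (\<Sum>k\<in>UNIV. fst v $ k * (\<Sum>i\<in>UNIV. g (fst m) $ k $ i * ginv g (fst m) i j))"
      by (subst sum.swap) (simp add: sum_distrib_left)
    also have "\<dots> = fst v $ j"
      by (simp add: ginv_right[where g=g, OF inv] if_distrib cong: if_cong)
    finally show ?thesis .
  qed
  have "(\<Sum>i\<in>UNIV. coef_horiz g m i v *\<^sub>R horiz g m i)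
      = (\<Sum>i\<in>UNIV. \<Sum>j\<in>UNIV. (coef_horiz g m i v * ginv g (fst m) i j) *\<^sub>R horiz_lower g m j)"
    by (simp add: horiz_def scaleR_sum_right)
  also have "\<dots> = (\<Sum>j\<in>UNIV. (\<Sum>i\<in>UNIV. coef_horiz g m i v * ginv g (fst m) i j) *\<^sub>R horiz_lower g m j)"
    by (subst sum.swap) (simp add: scaleR_sum_left)
  finally show ?thesis by (simp add: 1)
qed

lemma phase_decomp:
  "v = (\<Sum>i\<in>UNIV. coef_horiz g m i v *\<^sub>R horiz g m i) + (\<Sum>i\<in>UNIV. theta_form g m i v *\<^sub>R vert i)"
proof -
  have a: "(\<Sum>j\<in>UNIV. x j * (axis j 1 :: real^'n) $ i) = x i" for x i
    by (simp add: axis_def if_distrib cong: if_cong)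
  have b: "(\<Sum>j\<in>UNIV. fst v $ j * (\<Sum>k\<in>UNIV. christoffel g (fst m) k j i * snd m $ k))
      = (\<Sum>k\<in>UNIV. \<Sum>l\<in>UNIV. christoffel g (fst m) k i l * snd m $ k * fst v $ l)" for i
    by (simp add: sum_distrib_left, subst sum.swap) (simp add: christoffel_sym[of _ i] mult_ac)
  show ?thesis
    unfolding sum_coef_horiz
    by (rule prod_eqI) (simp_all add: vec_eq_iff fst_sum snd_sum horiz_lower_def vert_def a b, simp add: theta_form_def)
qed

lemma symplectic_form_eq: "symplectic_form v w = metricG g m (complexJ g m v) w"
proof -
  have lin_c: "linear (coef_horiz g m i)" for i
    by (rule linearI) (simp_all add: coef_horiz_def algebra_simps sum.distrib sum_distrib_left)
  have lin_t: "linear (theta_form g m i)" for i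
    by (rule linearI) (simp_all add: theta_form_def algebra_simps sum.distrib sum_distrib_left)
  have c: "coef_horiz g m i (complexJ g m v) = - theta_form g m i v" for i
    by (simp add: complexJ_def linear_diff[OF lin_c] linear_sum[OF lin_c] linear_cmul[OF lin_c]
        coef_horiz_vert coef_horiz_horiz if_distrib cong: if_cong)
  have d: "theta_form g m i (complexJ g m v) = coef_horiz g m i v" for i
    by (simp add: complexJ_def linear_diff[OF lin_t] linear_sum[OF lin_t] linear_cmul[OF lin_t]
        theta_vert theta_horiz if_distrib cong: if_cong)
  have e: "(\<Sum>i\<in>UNIV. \<Sum>j\<in>UNIV. g (fst m) $ i $ j * fst (complexJ g m v) $ i * fst w $ j)
      = (\<Sum>j\<in>UNIV. - theta_form g m j v * fst w $ j)"
    unfolding c[symmetric] coef_horiz_def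
    by (subst sum.swap) (simp add: sum_distrib_right g_sym[OF m_U])
  have "(\<Sum>i\<in>UNIV. coef_horiz g m i v * ginv g (fst m) i j) = fst v $ j" for j
  proof -
    have "(\<Sum>i\<in>UNIV. coef_horiz g m i v * ginv g (fst m) i j)
        = fst (\<Sum>i\<in>UNIV. coef_horiz g m i v *\<^sub>R horiz g m i) $ j"
      by (simp add: fst_sum fst_horiz)
    also have "\<dots> = fst v $ j"
      by (simp add: sum_coef_horiz fst_sum horiz_lower_def axis_def if_distrib cong: if_cong)
    finally show ?thesis .
  qed
  then have f: "(\<Sum>i\<in>UNIV. \<Sum>j\<in>UNIV. ginv g (fst m) i j * coef_horiz g m i v * theta_form g m j w)
      = (\<Sum>j\<in>UNIV. fst v $ j * theta_form g m j w)"
    by (subst sum.swap) (simp add: sum_distrib_right[symmetric] mult.commute[of "ginv _ _ _ _"])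
  have h: "(\<Sum>j\<in>UNIV. fst w $ j * (\<Sum>k\<in>UNIV. \<Sum>l\<in>UNIV. christoffel g (fst m) k j l * snd m $ k * fst v $ l))
      = (\<Sum>j\<in>UNIV. fst v $ j * (\<Sum>k\<in>UNIV. \<Sum>l\<in>UNIV. christoffel g (fst m) k j l * snd m $ k * fst w $ l))"
  proof -
    have "(\<Sum>j\<in>UNIV. fst w $ j * (\<Sum>k\<in>UNIV. \<Sum>l\<in>UNIV. christoffel g (fst m) k j l * snd m $ k * fst v $ l))
       = (\<Sum>j\<in>UNIV. \<Sum>l\<in>UNIV. \<Sum>k\<in>UNIV. fst w $ j * (christoffel g (fst m) k j l * snd m $ k * fst v $ l))"
      by (simp add: sum_distrib_left) (rule sum.cong[OF refl], rule sum.swap)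
    also have "\<dots> = (\<Sum>l\<in>UNIV. \<Sum>j\<in>UNIV. \<Sum>k\<in>UNIV. fst v $ l * (christoffel g (fst m) k l j * snd m $ k * fst w $ j))"
      by (subst sum.swap, intro sum.cong refl) (simp add: christoffel_sym mult_ac)
    also have "\<dots> = (\<Sum>l\<in>UNIV. fst v $ l * (\<Sum>k\<in>UNIV. \<Sum>j\<in>UNIV. christoffel g (fst m) k l j * snd m $ k * fst w $ j))"
      by (simp add: sum_distrib_left) (rule sum.cong[OF refl], rule sum.swap)
    finally show ?thesis .
  qed
  have "metricG g m (complexJ g m v) w
      = (\<Sum>j\<in>UNIV. - theta_form g m j v * fst w $ j) + (\<Sum>j\<in>UNIV. fst v $ j * theta_form g m j w)"
    by (simp add: metricG_def e d f)
  also have "\<dots> = symplectic_form v w"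
    using h by (simp add: symplectic_form_def theta_form_def algebra_simps sum.distrib sum_subtractf sum_negf)
  finally show ?thesis by simp
qed

end

end

(*
  In the complex coordinates A_i + i B_i of a tangent vector of T^*X the almost complex structure is
  multiplication by i and the canonical connection acts by real matrices. A tangent frame of the
  graph of a closed form chi is Z = (g + i hess) W with W real, where hess is the covariant
  derivative of chi. If the frame is orthonormal then Z^* g^-1 is the inverse of Z, and the
  coefficients nu_j of the generalized mean curvature are
  Im tr (Z^-1 D_j Z) = Im D_j log det Z = Im D_j log det (g + i hess), the derivative of the
  Lagrangian angle. Pairing the velocity of the flow with the frame by omega turns the flow into
  d chi_t / dt = d theta_t.

  The phase det (g + i hess) / |det (g + i hess)| is continuous on X x [0,T). As
  osc theta_0 < 2 pi, the given angle theta_0 is continuous, so it extends to a continuous lift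
  theta_t of the phase, and u_t is the integral of theta over [0,t]. The graph form is only known
  through the immersions F; its regularity in (x,t) comes from an open mapping argument for
  (sigma,t) |-> (the base point of F(sigma,t), t).
*)

theory Submission
  imports Defs
begin

section \<open>Smooth maps\<close>

text \<open>Each \<chi>_t is given as smooth on X, but no regularity of \<chi> in (x,t) is assumed:
  F is smooth in (sigma,t), yet it moves the base points, and sigma |-> base point need not be
  injective. An inverse function theorem in (sigma,t) would also meet the boundary t = 0. The proof
  gets by with continuity in (x,t) of \<chi>_t, of its first space derivatives and of d\<theta>_t.
  The first two become continuous functions of (sigma,t) after composition with the base point map,
  and openness of that map carries continuity down to X. The third contains second derivatives of
  \<chi>_t; it is obtained from the flow equation instead, being equal to d\<chi>_t/dt. Then du_t is
  the integral of d\<theta> over [0,t], that is \<chi>_t - \<chi>_0, and u_t is smooth because the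
  forms are. The condition on the oscillation is used at one point only: an angle is a bare choice
  of values, and values within less than a full turn cannot jump by multiples of 2 pi. That the
  phase is one function on X rests on the chart invariance of g + i hess, whose proof avoids
  transforming Christoffel symbols.\<close>

lemma Ck_on_cong:
  assumes "\<And>x. x \<in> S \<Longrightarrow> f x = h x"
  shows "Ck_on k f S \<longleftrightarrow> Ck_on k h S"
proof (cases k)
  case 0
  then show ?thesis using assms by (simp cong: continuous_on_cong)
next
  case (Suc m)
  have "(f has_derivative D) (at x within S) \<longleftrightarrow> (h has_derivative D) (at x within S)" if "x \<in> S" for x D
    using assms that has_derivative_transform[of x S f h D] has_derivative_transform[of x S h f D] by auto
  then show ?thesis by (simp add: Suc)
qed

lemma Ck_on_subset:
  assumes "Ck_on k f S" "R \<subseteq> S"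
  shows "Ck_on k f R"
  using assms(1)
proof (induction k arbitrary: f)
  case 0
  then show ?case using assms(2) by (auto intro: continuous_on_subset)
next
  case (Suc k)
  then show ?case using assms(2) by (simp) (meson has_derivative_subset subsetD)
qed

lemma Cinf_on_subset: "Cinf_on f S \<Longrightarrow> R \<subseteq> S \<Longrightarrow> Cinf_on f R"
  unfolding Cinf_on_def using Ck_on_subset by blast

lemma Ck_on_linear_compose:
  assumes "Ck_on k f S" "bounded_linear L"
  shows "Ck_on k (\<lambda>x. L (f x)) S"
  using assms(1)
proof (induction k arbitrary: f)
  case 0
  then show ?case using assms(2) by (simp add: bounded_linear.continuous_on)
next
  case (Suc k)
  then obtain D where D: "\<And>x. x \<in> S \<Longrightarrow> (f has_derivative D x) (at x within S)"
    and Dk: "\<And>v. Ck_on k (\<lambda>x. D x v) S" by auto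
  have "((\<lambda>x. L (f x)) has_derivative (\<lambda>v. L (D x v))) (at x within S)" if "x \<in> S" for x
    using bounded_linear.has_derivative[OF assms(2) D[OF that]] .
  moreover have "Ck_on k (\<lambda>x. L (D x v)) S" for v by (rule Suc.IH[OF Dk])
  ultimately show ?case by (auto intro!: exI[of _ "\<lambda>x v. L (D x v)"])
qed

lemma Ck_on_diff:
  assumes "Ck_on k f S" "Ck_on k h S"
  shows "Ck_on k (\<lambda>x. f x - h x) S"
  using assms
proof (induction k arbitrary: f h)
  case 0
  then show ?case by (simp add: continuous_on_diff)
next
  case (Suc k)
  from Suc.prems(1) obtain D where D: "\<And>x. x \<in> S \<Longrightarrow> (f has_derivative D x) (at x within S)"
    and Dk: "\<And>v. Ck_on k (\<lambda>x. D x v) S" by auto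
  from Suc.prems(2) obtain E where E: "\<And>x. x \<in> S \<Longrightarrow> (h has_derivative E x) (at x within S)"
    and Ek: "\<And>v. Ck_on k (\<lambda>x. E x v) S" by auto
  have "((\<lambda>x. f x - h x) has_derivative (\<lambda>v. D x v - E x v)) (at x within S)" if "x \<in> S" for x
    using has_derivative_diff[OF D[OF that] E[OF that]] .
  moreover have "Ck_on k (\<lambda>x. D x v - E x v) S" for v by (rule Suc.IH[OF Dk Ek])
  ultimately show ?case by (auto intro!: exI[of _ "\<lambda>x v. D x v - E x v"])
qed

text \<open>The directions \<open>(v, 0)\<close> of a derivative within \<open>W\<close> are enough.
  This also works at the end of a time interval, where \<open>W\<close> is only relatively
  open.\<close>

lemma Ck_on_slice:
  assumes "Ck_on k f W"
  shows "Ck_on k (\<lambda>y. f (y, t)) {y. (y, t) \<in> W}"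
  using assms
proof (induction k arbitrary: f)
  case 0
  then have "continuous_on W f" by simp
  then have "continuous_on {y. (y, t) \<in> W} (\<lambda>y. f (y, t))"
    by (rule continuous_on_compose2) (auto intro!: continuous_intros)
  then show ?case by simp
next
  case (Suc k)
  then obtain D where D: "\<And>x. x \<in> W \<Longrightarrow> (f has_derivative D x) (at x within W)"
    and Dk: "\<And>v. Ck_on k (\<lambda>x. D x v) W" by auto
  have "((\<lambda>y. f (y, t)) has_derivative (\<lambda>v. D (y, t) (v, 0))) (at y within {y. (y, t) \<in> W})"
    if "(y, t) \<in> W" for y
  proof -
    have "((\<lambda>y. (y, t)) has_derivative (\<lambda>v. (v, 0))) (at y within {y. (y, t) \<in> W})"
      by (auto intro!: derivative_eq_intros)
    from has_derivative_in_compose[OF this, of f "D (y, t)"] show ?thesis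
      using has_derivative_subset[OF D[OF that]] by (simp add: image_Collect_subsetI)
  qed
  moreover have "Ck_on k (\<lambda>y. D (y, t) (v, 0)) {y. (y, t) \<in> W}" for v
    using Suc.IH[OF Dk] .
  ultimately show ?case by (auto intro!: exI[of _ "\<lambda>y v. D (y, t) (v, 0)"])
qed

lemma Cinf_on_slice:
  "Cinf_on f W \<Longrightarrow> Cinf_on (\<lambda>y. f (y, t)) {y. (y, t) \<in> W}"
  by (simp add: Cinf_on_def Ck_on_slice)

lemma Cinf_on_linear_compose:
  "Cinf_on f S \<Longrightarrow> bounded_linear L \<Longrightarrow> Cinf_on (\<lambda>x. L (f x)) S"
  by (simp add: Cinf_on_def Ck_on_linear_compose)

lemma Cinf_on_imp_continuous_on: "Cinf_on f S \<Longrightarrow> continuous_on S f"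
  using Ck_on.simps(1) unfolding Cinf_on_def by blast

lemma Cinf_on_vec_nth: "Cinf_on f S \<Longrightarrow> Cinf_on (\<lambda>x. f x $ i) S"
  by (rule Cinf_on_linear_compose[OF _ bounded_linear_vec_nth])

lemma Cinf_on_fst: "Cinf_on f S \<Longrightarrow> Cinf_on (\<lambda>x. fst (f x)) S"
  by (rule Cinf_on_linear_compose[OF _ bounded_linear_fst])

text \<open>On an open set the derivative is unique, so the unspecified family \<open>D\<close> in
  the definition of \<open>Ck_on\<close> agrees with \<open>fderiv\<close> there.\<close>

lemma Ck_on_fderiv:
  assumes "open S" "Ck_on (Suc k) f S"
  shows "x \<in> S \<Longrightarrow> (f has_derivative fderiv f x) (at x)" "Ck_on k (\<lambda>x. fderiv f x v) S"
proof -
  obtain D where D: "\<And>x. x \<in> S \<Longrightarrow> (f has_derivative D x) (at x within S)"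
    and Dk: "Ck_on k (\<lambda>x. D x v) S" using assms(2) by auto
  have D': "(f has_derivative D x) (at x)" if "x \<in> S" for x
    using D[OF that] at_within_open[OF that assms(1)] by simp
  have eq: "D x = fderiv f x" if "x \<in> S" for x
    by (rule frechet_derivative_at[OF D'[OF that]])
  show "x \<in> S \<Longrightarrow> (f has_derivative fderiv f x) (at x)"
    using D' eq by simp
  show "Ck_on k (\<lambda>x. fderiv f x v) S"
    using Dk eq Ck_on_cong[of S "\<lambda>x. D x v" "\<lambda>x. fderiv f x v"] by simp
qed

lemma Cinf_on_has_derivative:
  "open S \<Longrightarrow> Cinf_on f S \<Longrightarrow> x \<in> S \<Longrightarrow> (f has_derivative fderiv f x) (at x)"
  using Ck_on_fderiv(1) unfolding Cinf_on_def by blast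

lemma Cinf_on_fderiv: "open S \<Longrightarrow> Cinf_on f S \<Longrightarrow> Cinf_on (\<lambda>x. fderiv f x v) S"
  using Ck_on_fderiv(2) unfolding Cinf_on_def by blast

lemma Cinf_on_partial: "open S \<Longrightarrow> Cinf_on f S \<Longrightarrow> Cinf_on (partial i f) S"
  unfolding partial_def using Cinf_on_fderiv[of S f "axis i 1"] by (simp add: partial_def[abs_def])

lemma Cinf_on_differentiable: "open S \<Longrightarrow> Cinf_on f S \<Longrightarrow> x \<in> S \<Longrightarrow> f differentiable (at x)"
  using Cinf_on_has_derivative differentiable_def by blast

lemma fderiv_eq: "(f has_derivative D) (at x) \<Longrightarrow> fderiv f x = D"
  using frechet_derivative_at by metis

lemma linear_axis_expansion:
  fixes L :: "real^'n \<Rightarrow> 'b::real_vector"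
  assumes "linear L"
  shows "L v = (\<Sum>i\<in>UNIV. v $ i *\<^sub>R L (axis i 1))"
proof -
  have "L v = L (\<Sum>i\<in>UNIV. v $ i *\<^sub>R axis i 1)"
    by (simp add: basis_expansion flip: scalar_mult_eq_scaleR)
  then show ?thesis by (simp add: linear_sum[OF assms] linear_cmul[OF assms])
qed

lemma fderiv_partial:
  assumes "f differentiable (at x)"
  shows "fderiv f x v = (\<Sum>i\<in>UNIV. v $ i * partial i f x)"
  using linear_axis_expansion[of "fderiv f x" v] assms
  by (simp add: partial_def linear_frechet_derivative)

lemma fderiv_vec_nth:
  fixes f :: "'a::real_normed_vector \<Rightarrow> 'b::real_normed_vector^'n"
  assumes "f differentiable (at x)"
  shows "fderiv (\<lambda>x. f x $ i) x v = fderiv f x v $ i"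
proof -
  have "(f has_derivative fderiv f x) (at x)" using assms by (simp add: frechet_derivative_works)
  then have "((\<lambda>x. f x $ i) has_derivative (\<lambda>v. fderiv f x v $ i)) (at x)"
    by (rule bounded_linear.has_derivative[OF bounded_linear_vec_nth])
  then show ?thesis by (simp add: fderiv_eq)
qed

section \<open>Symmetry of second derivatives\<close>

text \<open>Both orders of differentiation are limits of the same second difference quotient.\<close>

lemma second_difference_mvt:
  fixes f :: "'a::real_normed_vector \<Rightarrow> real"
  assumes S: "open S" and f: "Cinf_on f S" and h: "0 < h"
    and seg: "\<And>s t. 0 \<le> s \<Longrightarrow> s \<le> h \<Longrightarrow> 0 \<le> t \<Longrightarrow> t \<le> h \<Longrightarrow> x + s *\<^sub>R u + t *\<^sub>R v \<in> S"
  obtains s t where "0 < s" "s < h" "0 < t" "t < h"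
    "f (x + h *\<^sub>R u + h *\<^sub>R v) - f (x + h *\<^sub>R u) - f (x + h *\<^sub>R v) + f x
       = h * h * fderiv (\<lambda>z. fderiv f z u) (x + s *\<^sub>R u + t *\<^sub>R v) v"
proof -
  have der: "((\<lambda>r. k (z + r *\<^sub>R w)) has_real_derivative fderiv k (z + s *\<^sub>R w) w) (at s)"
    if "Cinf_on k S" "z + s *\<^sub>R w \<in> S" for k :: "'a \<Rightarrow> real" and z w s
  proof -
    have 1: "((\<lambda>r. z + r *\<^sub>R w) has_derivative (\<lambda>r. r *\<^sub>R w)) (at s)"
      by (auto intro!: derivative_eq_intros)
    have k: "(k has_derivative fderiv k (z + s *\<^sub>R w)) (at (z + s *\<^sub>R w))"
      using Cinf_on_has_derivative[OF S that] .
    have "((\<lambda>r. k (z + r *\<^sub>R w)) has_derivative (\<lambda>r. fderiv k (z + s *\<^sub>R w) (r *\<^sub>R w))) (at s)"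
      using has_derivative_compose[OF 1 k] .
    moreover have "fderiv k (z + s *\<^sub>R w) (r *\<^sub>R w) = r * fderiv k (z + s *\<^sub>R w) w" for r
      using linear_cmul[OF has_derivative_linear[OF k]] by simp
    ultimately show ?thesis by (simp add: has_field_derivative_def mult_commute_abs)
  qed
  \<comment> \<open>The mean value theorem in the direction \<open>u\<close>, for the difference of
    \<open>f\<close> along two parallel segments; a second application below works in the direction
    \<open>v\<close>.\<close>
  have "\<exists>s>0. s < h \<and> (f ((x + h *\<^sub>R v) + h *\<^sub>R u) - f (x + h *\<^sub>R u)) - (f ((x + h *\<^sub>R v) + 0 *\<^sub>R u) - f (x + 0 *\<^sub>R u))
     = (h - 0) * (fderiv f ((x + h *\<^sub>R v) + s *\<^sub>R u) u - fderiv f (x + s *\<^sub>R u) u)"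
  proof (rule MVT2[OF h])
    fix s assume s: "0 \<le> s" "s \<le> h"
    show "((\<lambda>s. f ((x + h *\<^sub>R v) + s *\<^sub>R u) - f (x + s *\<^sub>R u)) has_real_derivative
       fderiv f ((x + h *\<^sub>R v) + s *\<^sub>R u) u - fderiv f (x + s *\<^sub>R u) u) (at s)"
      using seg[OF s, of h] seg[OF s, of 0] h
      by (intro DERIV_diff der[OF f]) (simp_all add: ac_simps)
  qed
  then obtain s where s: "0 < s" "s < h"
    and 1: "f (x + h *\<^sub>R u + h *\<^sub>R v) - f (x + h *\<^sub>R u) - f (x + h *\<^sub>R v) + f x
     = h * (fderiv f (x + s *\<^sub>R u + h *\<^sub>R v) u - fderiv f (x + s *\<^sub>R u + 0 *\<^sub>R v) u)"
    by (auto simp: algebra_simps)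
  have "\<exists>t>0. t < h \<and> fderiv f (x + s *\<^sub>R u + h *\<^sub>R v) u - fderiv f (x + s *\<^sub>R u + 0 *\<^sub>R v) u
     = (h - 0) * fderiv (\<lambda>z. fderiv f z u) (x + s *\<^sub>R u + t *\<^sub>R v) v"
    using seg s by (intro MVT2[OF h] der[OF Cinf_on_fderiv[OF S f]]) auto
  then show ?thesis using that s 1 by (auto simp: algebra_simps)
qed

lemma fderiv_symmetric:
  fixes f :: "'a::real_normed_vector \<Rightarrow> real"
  assumes S: "open S" and f: "Cinf_on f S" and x: "x \<in> S"
  shows "fderiv (\<lambda>z. fderiv f z u) x v = fderiv (\<lambda>z. fderiv f z v) x u"
proof (rule ccontr)
  let ?P = "\<lambda>z. fderiv (\<lambda>z. fderiv f z u) z v" and ?Q = "\<lambda>z. fderiv (\<lambda>z. fderiv f z v) z u"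
  assume ne: "?P x \<noteq> ?Q x"
  \<comment> \<open>Half the gap: values closer than this to two numbers that far apart cannot
    coincide.\<close>
  define d where "d = \<bar>?P x - ?Q x\<bar> / 2"
  have d: "0 < d" using ne by (simp add: d_def)
  have "continuous_on S ?P" "continuous_on S ?Q"
    by (intro Cinf_on_imp_continuous_on Cinf_on_fderiv S f)+
  then have "\<forall>\<^sub>F z in at x. dist (?P z) (?P x) < d" "\<forall>\<^sub>F z in at x. dist (?Q z) (?Q x) < d"
    using d x by (auto simp: continuous_on_eq_continuous_at[OF S] isCont_def tendsto_iff)
  moreover have "\<forall>\<^sub>F z in at x. z \<in> S" using S x by (simp add: eventually_at_in_open')
  ultimately have "\<forall>\<^sub>F z in at x. dist (?P z) (?P x) < d \<and> dist (?Q z) (?Q x) < d \<and> z \<in> S"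
    by eventually_elim simp
  then obtain r where r: "0 < r"
    "\<And>z. z \<noteq> x \<Longrightarrow> dist z x < r \<Longrightarrow> dist (?P z) (?P x) < d \<and> dist (?Q z) (?Q x) < d \<and> z \<in> S"
    unfolding eventually_at by auto
  have near: "dist (?P z) (?P x) < d \<and> dist (?Q z) (?Q x) < d \<and> z \<in> S" if "dist z x < r" for z
    using r(2)[of z] that d x by (cases "z = x") auto
  \<comment> \<open>Makes the whole parallelogram with sides \<open>h *\<^sub>R u\<close> and
    \<open>h *\<^sub>R v\<close> fit into the ball of radius \<open>r\<close>; the 1 avoids a
    division by zero.\<close>
  define h where "h = r / (2 * (norm u + norm v + 1))"
  have h: "0 < h" using r(1) by (simp add: h_def add_nonneg_pos)
  have small: "dist (x + s *\<^sub>R u + t *\<^sub>R v) x < r" if "0 \<le> s" "s \<le> h" "0 \<le> t" "t \<le> h" for s t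
  proof -
    have "norm (s *\<^sub>R u + t *\<^sub>R v) \<le> s * norm u + t * norm v"
      using norm_triangle_ineq[of "s *\<^sub>R u" "t *\<^sub>R v"] that by simp
    also have "\<dots> \<le> h * norm u + h * norm v"
      using that by (intro add_mono mult_right_mono) auto
    also have "\<dots> < h * (2 * (norm u + norm v + 1))"
      using h by (simp add: algebra_simps add_strict_increasing2 add_pos_nonneg)
    also have "\<dots> = r"
    proof -
      have "0 < norm u + norm v + 1" by (simp add: add_nonneg_pos)
      then show ?thesis unfolding h_def by (simp add: field_simps)
    qed
    finally show ?thesis by (simp add: dist_norm add.assoc)
  qed
  obtain s t where st: "0 < s" "s < h" "0 < t" "t < h"
    "f (x + h *\<^sub>R u + h *\<^sub>R v) - f (x + h *\<^sub>R u) - f (x + h *\<^sub>R v) + f x = h * h * ?P (x + s *\<^sub>R u + t *\<^sub>R v)"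
    by (rule second_difference_mvt[OF S f h, of x u v]) (use near small in auto)
  have small': "dist (x + s *\<^sub>R v + t *\<^sub>R u) x < r" if "0 \<le> s" "s \<le> h" "0 \<le> t" "t \<le> h" for s t
    using small[of t s] that by (simp add: ac_simps)
  obtain s' t' where st': "0 < s'" "s' < h" "0 < t'" "t' < h"
    "f (x + h *\<^sub>R v + h *\<^sub>R u) - f (x + h *\<^sub>R v) - f (x + h *\<^sub>R u) + f x = h * h * ?Q (x + s' *\<^sub>R v + t' *\<^sub>R u)"
    by (rule second_difference_mvt[OF S f h, of x v u]) (use near small' in auto)
  \<comment> \<open>The second difference is symmetric in \<open>u\<close> and
    \<open>v\<close>.\<close>
  have sw: "x + h *\<^sub>R v + h *\<^sub>R u = x + h *\<^sub>R u + h *\<^sub>R v" by (simp add: ac_simps)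
  have "h * h * ?P (x + s *\<^sub>R u + t *\<^sub>R v) = h * h * ?Q (x + s' *\<^sub>R v + t' *\<^sub>R u)"
    using st(5) st'(5)[unfolded sw] by linarith
  then have "?P (x + s *\<^sub>R u + t *\<^sub>R v) = ?Q (x + s' *\<^sub>R v + t' *\<^sub>R u)"
    using h by simp
  moreover have "dist (?P (x + s *\<^sub>R u + t *\<^sub>R v)) (?P x) < d"
    using near small[of s t] st by simp
  moreover have "dist (?Q (x + s' *\<^sub>R v + t' *\<^sub>R u)) (?Q x) < d"
    using near small'[of s' t'] st' by simp
  ultimately show False by (auto simp: d_def dist_real_def abs_if split: if_splits)
qed

section \<open>Determinants\<close>

lemma matrix_add_rdistrib: "(A + B) ** C = A ** C + B ** C"
  by (simp add: matrix_matrix_mult_def vec_eq_iff distrib_right sum.distrib)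

lemma matrix_mul_lneg: "(- A) ** C = - (A ** C)" for A :: "'a::ring_1^'n^'m"
  by (simp add: matrix_matrix_mult_def vec_eq_iff sum_negf)

lemma matrix_inv_field:
  fixes A :: "'a::field^'n^'n"
  assumes "det A \<noteq> 0"
  shows "A ** matrix_inv A = mat 1" "matrix_inv A ** A = mat 1"
proof -
  have "\<exists>B. A ** B = mat 1 \<and> B ** A = mat 1"
    using assms by (simp add: invertible_det_nz[symmetric] invertible_def)
  then have "A ** matrix_inv A = mat 1 \<and> matrix_inv A ** A = mat 1"
    unfolding matrix_inv_def by (rule someI_ex)
  then show "A ** matrix_inv A = mat 1" "matrix_inv A ** A = mat 1" by auto
qed

text \<open>Presents the entries of the inverse as quotients of determinants, which is how
  continuity and differentiability pass to the inverse below.\<close>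

lemma matrix_inv_cramer:
  fixes A :: "'a::field^'n^'n"
  assumes "det A \<noteq> 0"
  shows "matrix_inv A $ i $ j =
    det (\<chi> r c. if c = i then (if r = j then 1 else 0) else A $ r $ c) / det A"
proof -
  have "A *v column j (matrix_inv A) = column j (A ** matrix_inv A)"
    by (simp add: vec_eq_iff matrix_vector_mult_def matrix_matrix_mult_def column_def)
  also have "\<dots> = axis j 1"
    by (simp add: matrix_inv_field[OF assms] vec_eq_iff column_def mat_def axis_def)
  finally have "column j (matrix_inv A) =
      (\<chi> k. det (\<chi> r c. if c = k then axis j 1 $ r else A $ r $ c) / det A)"
    using cramer[OF assms] by blast
  then have "column j (matrix_inv A) $ i = det (\<chi> r c. if c = i then axis j 1 $ r else A $ r $ c) / det A"
    by simp
  then show ?thesis by (simp add: column_def axis_def cong: if_cong)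
qed

lemma continuous_on_det:
  fixes A :: "'a::topological_space \<Rightarrow> 'b::real_normed_field^'n^'n"
  assumes "\<And>i j. continuous_on S (\<lambda>x. A x $ i $ j)"
  shows "continuous_on S (\<lambda>x. det (A x))"
  unfolding det_def by (intro continuous_intros assms)

lemma continuous_on_matrix_inv:
  fixes A :: "'a::topological_space \<Rightarrow> 'b::real_normed_field^'n^'n"
  assumes "\<And>i j. continuous_on S (\<lambda>x. A x $ i $ j)" "\<And>x. x \<in> S \<Longrightarrow> det (A x) \<noteq> 0"
  shows "continuous_on S (\<lambda>x. matrix_inv (A x) $ i $ j)"
proof -
  have "continuous_on S (\<lambda>x. (\<chi> r c. if c = i then (if r = j then 1 else 0) else A x $ r $ c) $ k $ l)" for k l
    using assms(1) by (cases "l = i") auto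
  then have "continuous_on S (\<lambda>x. det (\<chi> r c. if c = i then (if r = j then 1 else 0) else A x $ r $ c) / det (A x))"
    using assms by (intro continuous_on_divide continuous_on_det) auto
  then show ?thesis
    by (rule continuous_on_eq) (simp add: matrix_inv_cramer assms(2))
qed

section \<open>Derivatives of determinants and inverses\<close>

lemma differentiable_prod':
  fixes f :: "'i \<Rightarrow> 'a::real_normed_vector \<Rightarrow> 'b::real_normed_field"
  assumes "\<And>i. i \<in> I \<Longrightarrow> f i differentiable (at x within S)"
  shows "(\<lambda>x. \<Prod>i\<in>I. f i x) differentiable (at x within S)"
  using assms by (induction I rule: infinite_finite_induct) (auto intro: differentiable_mult)

lemma differentiable_det:
  fixes A :: "'a::real_normed_vector \<Rightarrow> 'b::real_normed_field^'n^'n"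
  assumes "\<And>i j. (\<lambda>x. A x $ i $ j) differentiable (at x within S)"
  shows "(\<lambda>x. det (A x)) differentiable (at x within S)"
  unfolding det_def
  by (intro differentiable_sum ballI differentiable_mult differentiable_const differentiable_prod' assms)
    (simp add: finite_permutations)

lemma differentiable_matrix_inv:
  fixes A :: "'a::real_normed_vector \<Rightarrow> 'b::real_normed_field^'n^'n"
  assumes "\<And>i j. (\<lambda>x. A x $ i $ j) differentiable (at x)"
    and "open S" "x \<in> S" "\<And>x. x \<in> S \<Longrightarrow> det (A x) \<noteq> 0"
  shows "(\<lambda>x. matrix_inv (A x) $ i $ j) differentiable (at x)"
proof -
  have "(\<lambda>x. det (\<chi> r c. if c = i then (if r = j then 1 else 0) else A x $ r $ c) / det (A x)) differentiable (at x)"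
    (is "?f differentiable _")
  proof (intro differentiable_divide differentiable_det assms(1))
    show "(\<lambda>x. (\<chi> r c. if c = i then (if r = j then 1 else 0) else A x $ r $ c) $ k $ l) differentiable (at x)" for k l
      using assms(1) by (cases "l = i") auto
  qed (use assms in auto)
  then obtain D where "(?f has_derivative D) (at x)" by (auto simp: differentiable_def)
  then have "((\<lambda>x. matrix_inv (A x) $ i $ j) has_derivative D) (at x)"
    by (rule has_derivative_transform_within_open[OF _ assms(2,3)])
      (simp add: matrix_inv_cramer assms(4))
  then show ?thesis by (auto simp: differentiable_def)
qed

text \<open>At the identity matrix only the identity permutation survives in the Leibniz formula:
  any other permutation moves at least two indices, so after differentiating one factor an
  off-diagonal zero remains.\<close>

lemma det_has_derivative_one:
  fixes A :: "'a::real_normed_vector \<Rightarrow> 'b::real_normed_field^'n^'n"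
  assumes der: "\<And>i j. ((\<lambda>x. A x $ i $ j) has_derivative (\<lambda>h. A' h $ i $ j)) (at x within S)"
    and one: "A x = mat 1"
  shows "((\<lambda>x. det (A x)) has_derivative (\<lambda>h. trace (A' h))) (at x within S)"
proof -
  let ?P = "{p. p permutes (UNIV :: 'n set)}"
  have "((\<lambda>x. det (A x)) has_derivative
      (\<lambda>h. \<Sum>p\<in>?P. of_int (sign p) * (\<Sum>i\<in>UNIV. A' h $ i $ p i * (\<Prod>j\<in>UNIV - {i}. A x $ j $ p j)))) (at x within S)"
    unfolding det_def
    by (intro has_derivative_sum has_derivative_mult_right has_derivative_prod der)
  moreover have "(\<Sum>i\<in>UNIV. A' h $ i $ p i * (\<Prod>j\<in>UNIV - {i}. A x $ j $ p j)) = 0"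
    if p: "p \<in> ?P" "p \<noteq> id" for p h
  proof (intro sum.neutral ballI)
    fix i
    obtain j where j: "p j \<noteq> j" using p(2) by fastforce
    have "\<exists>j. j \<noteq> i \<and> p j \<noteq> j"
    proof (cases "j = i")
      case True
      \<comment> \<open>If the moved index is \<open>i\<close> itself, its image under
        \<open>p\<close> is a second moved index.\<close>
      then have "p (p i) \<noteq> p i" using p(1) j by (metis mem_Collect_eq permutes_inj injD)
      then show ?thesis using j True by auto
    qed (use j in auto)
    then obtain j where "j \<noteq> i" "p j \<noteq> j" by auto
    then have "(\<Prod>j\<in>UNIV - {i}. A x $ j $ p j) = 0"
      by (auto simp: one mat_def intro!: prod_zero bexI[of _ j])
    then show "A' h $ i $ p i * (\<Prod>j\<in>UNIV - {i}. A x $ j $ p j) = 0" by simp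
  qed
  then have "(\<Sum>p\<in>?P. of_int (sign p) * (\<Sum>i\<in>UNIV. A' h $ i $ p i * (\<Prod>j\<in>UNIV - {i}. A x $ j $ p j)))
      = (\<Sum>p\<in>{id}. of_int (sign p) * (\<Sum>i\<in>UNIV. A' h $ i $ p i * (\<Prod>j\<in>UNIV - {i}. A x $ j $ p j)))" for h
    by (intro sum.mono_neutral_right) (auto simp: finite_permutations permutes_id)
  moreover have "\<dots> h = trace (A' h)" for h
    by (simp add: trace_def one mat_def sign_id)
  ultimately show ?thesis by simp
qed

text \<open>Jacobi's formula, reduced to the identity matrix by
  \<open>det (A z) = det (A x) * det (B ** A z)\<close>.\<close>

lemma det_has_derivative:
  fixes A :: "'a::real_normed_vector \<Rightarrow> 'b::real_normed_field^'n^'n"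
  assumes der: "\<And>i j. ((\<lambda>x. A x $ i $ j) has_derivative (\<lambda>h. A' h $ i $ j)) (at x within S)"
    and inv: "B ** A x = mat 1"
  shows "((\<lambda>x. det (A x)) has_derivative (\<lambda>h. det (A x) * trace (B ** A' h))) (at x within S)"
proof -
  have "((\<lambda>z. (B ** A z) $ i $ j) has_derivative (\<lambda>h. (B ** A' h) $ i $ j)) (at x within S)" for i j
    unfolding matrix_matrix_mult_def
    by (simp, intro has_derivative_sum has_derivative_mult_right der)
  from det_has_derivative_one[OF this inv]
  have "((\<lambda>z. det (A x) * det (B ** A z)) has_derivative (\<lambda>h. det (A x) * trace (B ** A' h))) (at x within S)"
    by (rule has_derivative_mult_right)
  moreover have "det (A x) * det (B ** A z) = det (A z)" for z
    using arg_cong[OF inv, of det] by (simp add: det_mul mult.commute mult.left_commute)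
  ultimately show ?thesis by simp
qed

text \<open>Along the segment from the identity to \<open>G\<close> every matrix is positive
  definite, hence nonsingular, so by the intermediate value theorem the determinant keeps the sign
  it has at the identity.\<close>

lemma det_pos_definite:
  fixes G :: "real^'n^'n"
  assumes pos: "\<And>v. v \<noteq> 0 \<Longrightarrow> v \<bullet> (G *v v) > 0"
  shows "det G > 0"
proof (rule ccontr)
  assume "\<not> det G > 0"
  let ?H = "\<lambda>s::real. (1 - s) *\<^sub>R mat 1 + s *\<^sub>R G"
  have mv: "?H s *v v = (1 - s) *\<^sub>R v + s *\<^sub>R (G *v v)" for s v
    by (simp add: matrix_vector_mult_add_rdistrib scaleR_matrix_vector_assoc[symmetric])
  have ne: "det (?H s) \<noteq> 0" if s: "0 \<le> s" "s \<le> 1" for s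
  proof -
    have "v = 0" if v: "?H s *v v = 0" for v
    proof (rule ccontr)
      assume "v \<noteq> 0"
      have "0 = v \<bullet> (?H s *v v)" using v by simp
      also have "\<dots> = (1 - s) * (v \<bullet> v) + s * (v \<bullet> (G *v v))"
        by (simp only: mv inner_add_right inner_scaleR_right)
      finally have "(1 - s) * (v \<bullet> v) + s * (v \<bullet> (G *v v)) = 0" by simp
      moreover have "0 < v \<bullet> v" "0 < v \<bullet> (G *v v)" using \<open>v \<noteq> 0\<close> pos by auto
      ultimately show False using s
        by (cases "s = 0") (auto simp: add_nonneg_pos order.strict_iff_order add_nonneg_eq_0_iff)
    qed
    then have "\<exists>B. B ** ?H s = mat 1" using matrix_left_invertible_ker by blast
    then show ?thesis by (metis invertible_left_inverse invertible_det_nz)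
  qed
  have "continuous_on {0..1} (\<lambda>s. det (?H s))"
    by (intro continuous_on_det) (auto intro!: continuous_intros)
  moreover have "det (?H 1) \<le> 0" "0 \<le> det (?H 0)" using \<open>\<not> det G > 0\<close> by auto
  ultimately obtain s where "0 \<le> s" "s \<le> 1" "det (?H s) = 0"
    using IVT2'[of "\<lambda>s. det (?H s)" 1 0 0] by auto
  then show False using ne by blast
qed

section \<open>The phase of a symmetric perturbation of a metric\<close>

definition cmatrix :: "real^'n^'n \<Rightarrow> real^'n^'n \<Rightarrow> complex^'n^'n" where
  "cmatrix G S = (\<chi> i j. complex_of_real (G $ i $ j) + \<i> * complex_of_real (S $ i $ j))"

lemma det_cmatrix_0: "det (cmatrix G 0) = of_real (det G)"
  by (simp add: cmatrix_def det_def)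

lemma det_cmatrix_uminus: "det (cmatrix G (- S)) = cnj (det (cmatrix G S))"
  by (simp add: cmatrix_def det_def)

lemma cmatrix_mult: "cmatrix G S ** cmatrix G' S' = cmatrix (G ** G' - S ** S') (G ** S' + S ** G')"
  by (simp add: cmatrix_def matrix_matrix_mult_def vec_eq_iff sum.distrib sum_subtractf
      sum_distrib_left complex_eq_iff)

locale metric_and_form =
  fixes G S :: "real^'n^'n"
  assumes sym_G: "transpose G = G" and sym_S: "transpose S = S"
    and pos: "\<And>v. v \<noteq> 0 \<Longrightarrow> v \<bullet> (G *v v) > 0"
begin

lemma det_G_pos: "det G > 0" by (rule det_pos_definite) (rule pos)

text \<open>For a kernel vector x + i y the real and imaginary parts read G x = S y and G y = - S x.
  Symmetry of \<open>S\<close> then makes x . G x + y . G y vanish, and positivity kills both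
  terms.\<close>

lemma det_nz: "det (cmatrix G S) \<noteq> 0"
proof -
  have "v = 0" if v: "cmatrix G S *v v = 0" for v
  proof -
    define x y :: "real^'n" where "x = (\<chi> i. Re (v $ i))" and "y = (\<chi> i. Im (v $ i))"
    have "(G *v x) $ i = (S *v y) $ i" "(G *v y) $ i = - (S *v x) $ i" for i
      using arg_cong[OF v, of "\<lambda>w. Re (w $ i)"] arg_cong[OF v, of "\<lambda>w. Im (w $ i)"]
      by (simp_all add: matrix_vector_mult_def cmatrix_def x_def y_def sum.distrib sum_subtractf sum_negf algebra_simps add_eq_0_iff)
    then have eqs: "G *v x = S *v y" "G *v y = - (S *v x)" by (auto simp: vec_eq_iff)
    have "x \<bullet> (S *v y) = y \<bullet> (S *v x)"
      by (metis sym_S dot_lmul_matrix inner_commute vector_transpose_matrix)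
    then have 0: "x \<bullet> (G *v x) + y \<bullet> (G *v y) = 0" by (simp add: eqs)
    have nn: "z \<bullet> (G *v z) \<ge> 0" for z using pos[of z] by (cases "z = 0") auto
    have "x \<bullet> (G *v x) = 0" "y \<bullet> (G *v y) = 0" using 0 nn[of x] nn[of y] by linarith+
    then have "x = 0" "y = 0" using pos[of x] pos[of y] by (metis less_irrefl)+
    then show "v = 0" by (auto simp: x_def y_def vec_eq_iff complex_eq_iff)
  qed
  then have "\<exists>B. B ** cmatrix G S = mat 1" using matrix_left_invertible_ker by blast
  then show ?thesis by (metis invertible_left_inverse invertible_det_nz)
qed

text \<open>(G - i S) G^-1 (G + i S) = G + S G^-1 S, since the mixed terms cancel, and the two outer
  factors have complex conjugate determinants.\<close>

lemma det_induced: "det (G + S ** matrix_inv G ** S) = (cmod (det (cmatrix G S)))\<^sup>2 / det G"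
proof -
  have G: "G ** matrix_inv G = mat 1" "matrix_inv G ** G = mat 1"
    using det_G_pos by (simp_all add: matrix_inv_field)
  have "cmatrix G (- S) ** cmatrix (matrix_inv G) 0 ** cmatrix G S = cmatrix (G + S ** matrix_inv G ** S) 0"
    using G
    by (simp add: cmatrix_mult matrix_add_ldistrib matrix_add_rdistrib matrix_mul_assoc[symmetric] matrix_mul_lneg)
  then have "of_real (det (G + S ** matrix_inv G ** S)) = cnj (det (cmatrix G S)) * of_real (det (matrix_inv G)) * det (cmatrix G S)"
    by (metis det_cmatrix_0 det_cmatrix_uminus det_mul)
  also have "det (matrix_inv G) = 1 / det G"
    using arg_cong[OF G(1), of det] det_G_pos by (simp add: det_mul field_simps)
  also have "cnj (det (cmatrix G S)) * of_real (1 / det G) * det (cmatrix G S) = of_real ((cmod (det (cmatrix G S)))\<^sup>2 / det G)"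
    using complex_norm_square[of "det (cmatrix G S)"] by (simp add: mult.commute)
  finally show ?thesis by (simp only: of_real_eq_iff)
qed

text \<open>So the denominator in \<open>angle_phase\<close> is the modulus of the
  numerator.\<close>

lemma phase_eq_sgn:
  "det (cmatrix G S) / of_real (sqrt (det G) * sqrt (det (G + S ** matrix_inv G ** S))) = sgn (det (cmatrix G S))"
proof -
  have "sqrt (det G) * sqrt (det (G + S ** matrix_inv G ** S)) = cmod (det (cmatrix G S))"
    using det_G_pos by (simp add: det_induced real_sqrt_mult[symmetric])
  then show ?thesis by (simp add: sgn_eq)
qed

end

text \<open>Continuity keeps \<open>f z - f x\<close> below pi in absolute value near
  \<open>x\<close>, which identifies it with the principal argument of \<open>D z / D x\<close>. So
  \<open>f\<close> is locally \<open>f x + Im (Ln (D z / D x))\<close> and inherits the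
  differentiability of \<open>D\<close>.\<close>

lemma angle_has_derivative:
  fixes f :: "'a::real_normed_vector \<Rightarrow> real" and D :: "'a \<Rightarrow> complex"
  assumes D: "(D has_derivative D') (at x)" and nz: "D x \<noteq> 0"
    and f: "isCont f x" and U: "open U" "x \<in> U"
    and eq: "\<And>z. z \<in> U \<Longrightarrow> exp (\<i> * of_real (f z)) = sgn (D z)"
  shows "(f has_derivative (\<lambda>h. Im (D' h / D x))) (at x)"
proof -
  have E: "((\<lambda>z. D z / D x) has_derivative (\<lambda>h. D' h / D x)) (at x)"
    using bounded_linear.has_derivative[OF bounded_linear_divide D] .
  have "(Ln has_derivative (*) 1) (at (D x / D x))"
    using has_field_derivative_Ln[of 1] nz by (simp add: has_field_derivative_def)
  from has_derivative_compose[OF E this]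
  have "((\<lambda>z. Im (Ln (D z / D x))) has_derivative (\<lambda>h. Im (D' h / D x))) (at x)"
    using bounded_linear.has_derivative[OF bounded_linear_Im] by fastforce
  from has_derivative_add[OF has_derivative_const[of "f x"] this]
  have L: "((\<lambda>z. f x + Im (Ln (D z / D x))) has_derivative (\<lambda>h. Im (D' h / D x))) (at x)"
    by simp
  have "\<forall>\<^sub>F z in at x. z \<in> U" using U by (simp add: eventually_at_in_open')
  moreover have "\<forall>\<^sub>F z in at x. dist (f z) (f x) < pi"
    using f by (auto simp: isCont_def tendsto_iff)
  moreover have "\<forall>\<^sub>F z in at x. D z \<noteq> 0"
    using has_derivative_continuous[OF D] nz by (auto simp: continuous_within intro: tendsto_imp_eventually_ne)
  ultimately have "\<forall>\<^sub>F z in at x. f x + Im (Ln (D z / D x)) = f z"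
  proof eventually_elim
    case (elim z)
    have pol: "D y = of_real (cmod (D y)) * exp (\<i> * of_real (f y))" if "y \<in> U" "D y \<noteq> 0" for y
      using that by (simp add: eq sgn_eq)
    have "D z / D x = of_real (cmod (D z)) * exp (\<i> * of_real (f z)) / (of_real (cmod (D x)) * exp (\<i> * of_real (f x)))"
      using pol[of z] pol[of x] elim U nz by simp
    also have "\<dots> = of_real (cmod (D z) / cmod (D x)) * exp (\<i> * of_real (f z - f x))"
      by (simp add: right_diff_distrib exp_diff)
    finally have "Arg (D z / D x) = f z - f x"
      using elim nz by (intro Arg_unique[of "cmod (D z) / cmod (D x)"]) (auto simp: dist_real_def)
    then show ?case using elim nz by (simp add: Arg_eq_Im_Ln)
  qed
  then show ?thesis
    using has_derivative_transform_eventually[OF L] nz by (simp)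
qed

section \<open>The mean curvature of the graph of a closed form\<close>

context local_metric
begin

lemma linear_coef_horiz: "linear (coef_horiz g m i)"
  by (rule linearI) (simp_all add: coef_horiz_def algebra_simps sum.distrib sum_distrib_left)

lemma linear_theta_form: "linear (theta_form g m i)"
  by (rule linearI) (simp_all add: theta_form_def algebra_simps sum.distrib sum_distrib_left)

lemma coef_horiz_combination:
  "coef_horiz g m i ((\<Sum>k\<in>UNIV. c k *\<^sub>R horiz g m k) + (\<Sum>k\<in>UNIV. d k *\<^sub>R vert k)) = c i"
  by (simp add: linear_add[OF linear_coef_horiz] linear_sum[OF linear_coef_horiz]
      linear_cmul[OF linear_coef_horiz] coef_horiz_horiz coef_horiz_vert if_distrib cong: if_cong)

lemma theta_form_combination:
  "theta_form g m i ((\<Sum>k\<in>UNIV. c k *\<^sub>R horiz g m k) + (\<Sum>k\<in>UNIV. d k *\<^sub>R vert k)) = d i"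
  by (simp add: linear_add[OF linear_theta_form] linear_sum[OF linear_theta_form]
      linear_cmul[OF linear_theta_form] theta_horiz theta_vert if_distrib cong: if_cong)

lemma complexJ_combination:
  "complexJ g m v = (\<Sum>i\<in>UNIV. (- theta_form g m i v) *\<^sub>R horiz g m i) + (\<Sum>i\<in>UNIV. coef_horiz g m i v *\<^sub>R vert i)"
  by (simp add: complexJ_def sum_negf)

lemma coef_horiz_complexJ: "coef_horiz g m i (complexJ g m v) = - theta_form g m i v"
  unfolding complexJ_combination coef_horiz_combination ..

lemma theta_form_complexJ: "theta_form g m i (complexJ g m v) = coef_horiz g m i v"
  unfolding complexJ_combination theta_form_combination ..

lemma complexJ_complexJ: "complexJ g m (complexJ g m v) = - v"
proof -
  have "complexJ g m (complexJ g m v) =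
      - ((\<Sum>i\<in>UNIV. coef_horiz g m i v *\<^sub>R horiz g m i) + (\<Sum>i\<in>UNIV. theta_form g m i v *\<^sub>R vert i))"
    unfolding complexJ_combination[of "complexJ g m v"] coef_horiz_complexJ theta_form_complexJ
    by (simp add: sum_negf)
  then show ?thesis using phase_decomp[of v] by simp
qed

lemma ginv_symmetric: "ginv g (fst m) i j = ginv g (fst m) j i"
  by (rule ginv_sym[where g=g and q="fst m", OF inv sym[OF m_U]])

text \<open>Both halves of the metric are expressed by the inverse metric, because
  \<open>coef_horiz\<close> is the base part with its index lowered by \<open>g\<close>. This is
  what permits a single Hermitian form in complex coordinates.\<close>

lemma metricG_coef:
  "metricG g m v w = (\<Sum>i\<in>UNIV. \<Sum>j\<in>UNIV. ginv g (fst m) i j *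
     (coef_horiz g m i v * coef_horiz g m j w + theta_form g m i v * theta_form g m j w))"
proof -
  have 1: "(\<Sum>j\<in>UNIV. ginv g (fst m) i j * coef_horiz g m j w) = fst w $ i" for i
  proof -
    have "(\<Sum>j\<in>UNIV. ginv g (fst m) i j * coef_horiz g m j w) = (\<Sum>j\<in>UNIV. coef_horiz g m j w * ginv g (fst m) j i)"
      by (simp add: ginv_symmetric[of i] mult.commute)
    also have "\<dots> = fst (\<Sum>j\<in>UNIV. coef_horiz g m j w *\<^sub>R horiz g m j) $ i"
      by (simp add: fst_sum fst_horiz)
    also have "\<dots> = fst w $ i"
      by (simp add: sum_coef_horiz fst_sum horiz_lower_def axis_def if_distrib cong: if_cong)
    finally show ?thesis .
  qed
  have "(\<Sum>i\<in>UNIV. \<Sum>j\<in>UNIV. ginv g (fst m) i j * (coef_horiz g m i v * coef_horiz g m j w))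
      = (\<Sum>i\<in>UNIV. coef_horiz g m i v * (\<Sum>j\<in>UNIV. ginv g (fst m) i j * coef_horiz g m j w))"
    by (simp add: sum_distrib_left mult_ac)
  also have "\<dots> = (\<Sum>i\<in>UNIV. \<Sum>j\<in>UNIV. g (fst m) $ i $ j * fst v $ j * fst w $ i)"
    unfolding 1 by (simp add: coef_horiz_def sum_distrib_right)
  also have "\<dots> = (\<Sum>i\<in>UNIV. \<Sum>j\<in>UNIV. g (fst m) $ i $ j * fst v $ i * fst w $ j)"
    by (subst sum.swap) (simp add: g_sym[OF m_U])
  finally show ?thesis
    by (simp add: metricG_def distrib_left sum.distrib mult.assoc)
qed

end

text \<open>The complex coordinates \<open>A\<^sub>i + \<i> B\<^sub>i\<close> of \<open>\<Sum>i. A\<^sub>i X\<^sup>i + B\<^sub>i \<partial>/\<partial>p\<^sub>i\<close>,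
  in which \<open>J\<close> is multiplication by \<open>\<i>\<close>.\<close>

definition zcoord :: "(real^'n \<Rightarrow> real^'n^'n) \<Rightarrow> 'n phase \<Rightarrow> 'n::finite phase \<Rightarrow> complex^'n" where
  "zcoord g m v = (\<chi> i. Complex (coef_horiz g m i v) (theta_form g m i v))"

context local_metric
begin

text \<open>Since \<omega>(v, w) = G(J v, w) and J is multiplication by i, metric and symplectic
  form are the real and imaginary parts of one Hermitian form with matrix g^-1. A Lagrangian
  orthonormal frame is therefore unitary for it.\<close>

lemma hermitian_zcoord:
  "(\<Sum>i\<in>UNIV. \<Sum>j\<in>UNIV. of_real (ginv g (fst m) i j) * (cnj (zcoord g m v $ i) * zcoord g m w $ j))
     = Complex (metricG g m v w) (symplectic_form v w)"
  unfolding symplectic_form_eq metricG_coef coef_horiz_complexJ theta_form_complexJ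
  by (simp add: zcoord_def complex_eq_iff Re_sum Im_sum algebra_simps)

lemma metricG_sym: "metricG g m v w = metricG g m w v"
  unfolding metricG_coef by (subst sum.swap) (simp add: ginv_symmetric mult.commute)

lemma metricG_complexJ:
  "metricG g m v (complexJ g m w) =
    Im (\<Sum>i\<in>UNIV. \<Sum>j\<in>UNIV. of_real (ginv g (fst m) i j) * (cnj (zcoord g m w $ i) * zcoord g m v $ j))"
  unfolding hermitian_zcoord by (simp add: symplectic_form_eq metricG_sym[of v])

lemma zcoord_combination:
  "zcoord g m ((\<Sum>k\<in>UNIV. c k *\<^sub>R horiz g m k) + (\<Sum>k\<in>UNIV. d k *\<^sub>R vert k)) $ i = Complex (c i) (d i)"
  by (simp only: zcoord_def vec_lambda_beta coef_horiz_combination theta_form_combination)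

end

section \<open>The graph of a closed form in one chart\<close>

locale closed_form_chart =
  fixes g :: "real^'n \<Rightarrow> real^'n^'n::finite" and a :: "real^'n \<Rightarrow> real^'n" and U :: "(real^'n) set"
  assumes open_U: "open U"
    and smooth_g: "Cinf_on g U" and sym_g: "\<And>q. q \<in> U \<Longrightarrow> transpose (g q) = g q"
    and pos_g: "\<And>q v. q \<in> U \<Longrightarrow> v \<noteq> 0 \<Longrightarrow> v \<bullet> (g q *v v) > 0"
    and smooth_a: "Cinf_on a U"
    and closed_a: "\<And>q i j. q \<in> U \<Longrightarrow> partial i (\<lambda>q. a q $ j) q = partial j (\<lambda>q. a q $ i) q"
begin

text \<open>Where \<open>a\<close> is the differential of a function this is its covariant Hessian;
  closedness of \<open>a\<close> makes it symmetric.\<close>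

definition hess :: "real^'n \<Rightarrow> real^'n^'n" where
  "hess q = (\<chi> i j. cov_deriv g a q j i)"

text \<open>The phase before normalisation. Unlike the Lagrangian angle it is single-valued, so it
  can be differentiated before any lift is chosen.\<close>

definition angle_det :: "real^'n \<Rightarrow> complex" where
  "angle_det q = det (cmatrix (g q) (hess q))"

lemma det_g: "q \<in> U \<Longrightarrow> det (g q) > 0"
  by (rule det_pos_definite) (rule pos_g)

lemma local_metric: "q \<in> U \<Longrightarrow> local_metric g (q, p) U"
  using det_g[of q] by unfold_locales (auto simp: open_U sym_g invertible_det_nz)

lemma diff_a: "q \<in> U \<Longrightarrow> a differentiable (at q)"
  by (rule Cinf_on_differentiable[OF open_U smooth_a])

lemma diff_a_nth: "q \<in> U \<Longrightarrow> (\<lambda>q. a q $ i) differentiable (at q)"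
  by (rule Cinf_on_differentiable[OF open_U Cinf_on_vec_nth[OF smooth_a]])

lemma fderiv_a: "q \<in> U \<Longrightarrow> fderiv a q v $ i = (\<Sum>l\<in>UNIV. v $ l * partial l (\<lambda>q. a q $ i) q)"
  by (simp add: fderiv_vec_nth[OF diff_a, symmetric] fderiv_partial[OF diff_a_nth])

lemma fderiv_a_sym: "q \<in> U \<Longrightarrow> v \<bullet> fderiv a q w = w \<bullet> fderiv a q v"
  by (simp add: inner_vec_def fderiv_a sum_distrib_left, subst sum.swap)
    (simp add: closed_a mult_ac)

lemma christoffel_sym: "q \<in> U \<Longrightarrow> christoffel g q k i j = christoffel g q k j i"
  using local_metric.christoffel_sym[OF local_metric, of q] by simp

lemma cov_deriv_sym: "q \<in> U \<Longrightarrow> cov_deriv g a q i j = cov_deriv g a q j i"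
  by (simp add: cov_deriv_def closed_a[of q i j] christoffel_sym[of q _ i j])

lemma metric_and_form: "q \<in> U \<Longrightarrow> metric_and_form (g q) (hess q)"
  by (rule metric_and_form.intro) (simp_all add: sym_g pos_g, simp add: hess_def transpose_def cov_deriv_sym)

lemma angle_det_nz: "q \<in> U \<Longrightarrow> angle_det q \<noteq> 0"
  unfolding angle_det_def by (rule metric_and_form.det_nz[OF metric_and_form])

lemma angle_phase: 
  assumes q: "q \<in> U"
  shows "angle_phase g a q = sgn (angle_det q)"
proof -
  have "induced_metric g a q = g q + hess q ** matrix_inv (g q) ** hess q"
  proof -
    have "(\<Sum>k\<in>UNIV. \<Sum>l\<in>UNIV. cov_deriv g a q k i * ginv g q k l * cov_deriv g a q l j) =
        (\<Sum>l\<in>UNIV. \<Sum>k\<in>UNIV. cov_deriv g a q k i * ginv g q k l * cov_deriv g a q j l)" for i j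
      by (subst sum.swap) (simp add: cov_deriv_sym[OF q, of j])
    then show ?thesis
      by (simp add: induced_metric_def vec_eq_iff matrix_matrix_mult_def hess_def ginv_def sum_distrib_right)
  qed
  moreover have "(\<chi> i j. complex_of_real (g q $ i $ j) + \<i> * complex_of_real (cov_deriv g a q j i)) = cmatrix (g q) (hess q)"
    by (simp add: cmatrix_def hess_def)
  ultimately show ?thesis
    using metric_and_form.phase_eq_sgn[OF metric_and_form[OF q]] by (simp add: angle_phase_def angle_det_def)
qed

lemma diff_g: "q \<in> U \<Longrightarrow> (\<lambda>q. g q $ i $ j) differentiable (at q)"
  by (rule Cinf_on_differentiable[OF open_U]) (intro Cinf_on_vec_nth smooth_g)

lemma diff_partial_g: "q \<in> U \<Longrightarrow> partial l (\<lambda>q. g q $ i $ j) differentiable (at q)"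
  by (rule Cinf_on_differentiable[OF open_U]) (intro Cinf_on_vec_nth smooth_g Cinf_on_partial open_U)

lemma diff_partial_a: "q \<in> U \<Longrightarrow> partial l (\<lambda>q. a q $ i) differentiable (at q)"
  by (rule Cinf_on_differentiable[OF open_U]) (intro Cinf_on_vec_nth smooth_a Cinf_on_partial open_U)

lemma diff_ginv: "q \<in> U \<Longrightarrow> (\<lambda>q. ginv g q i j) differentiable (at q)"
  unfolding ginv_def using det_g by (intro differentiable_matrix_inv[OF _ open_U] diff_g) force+

lemma diff_christoffel: "q \<in> U \<Longrightarrow> (\<lambda>q. christoffel g q k i j) differentiable (at q)"
  unfolding christoffel_def
  by (intro differentiable_mult differentiable_sum differentiable_diff differentiable_add
      differentiable_const diff_ginv diff_partial_g ballI finite)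

lemma diff_cov_deriv: "q \<in> U \<Longrightarrow> (\<lambda>q. cov_deriv g a q i j) differentiable (at q)"
  unfolding cov_deriv_def
  by (intro differentiable_mult differentiable_sum differentiable_diff
      diff_christoffel diff_partial_a diff_a_nth ballI finite)

lemma diff_cmatrix: "q \<in> U \<Longrightarrow> (\<lambda>q. cmatrix (g q) (hess q) $ i $ j) differentiable (at q)"
proof -
  assume q: "q \<in> U"
  have "(\<lambda>q. complex_of_real (r q)) differentiable (at q)" if "r differentiable (at q)" for r :: "real^'n \<Rightarrow> real"
    using that bounded_linear.has_derivative[OF bounded_linear_of_real] unfolding differentiable_def by blast
  then have "(\<lambda>q. complex_of_real (g q $ i $ j) + \<i> * complex_of_real (cov_deriv g a q j i)) differentiable (at q)"
    by (intro differentiable_add differentiable_mult differentiable_const) (auto intro: diff_g diff_cov_deriv q)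
  then show ?thesis by (simp add: cmatrix_def hess_def)
qed

lemma diff_angle_det: "q \<in> U \<Longrightarrow> angle_det differentiable (at q)"
  unfolding angle_det_def by (intro differentiable_det diff_cmatrix)

text \<open>The Christoffel term in \<theta>_i is exactly the correction from the partial to the
  covariant derivative of \<open>a\<close>, so the vertical part of a tangent vector of the graph is
  the Hessian applied to its base part.\<close>

lemma theta_form_graph:
  assumes q: "q \<in> U"
  shows "theta_form g (q, a q) i (w, fderiv a q w) = (\<Sum>l\<in>UNIV. hess q $ i $ l * w $ l)"
proof -
  have "(\<Sum>k\<in>UNIV. \<Sum>l\<in>UNIV. christoffel g q k i l * a q $ k * w $ l)
      = (\<Sum>l\<in>UNIV. \<Sum>k\<in>UNIV. christoffel g q k l i * a q $ k * w $ l)"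
    by (subst sum.swap) (simp add: christoffel_sym[OF q, of _ i])
  then show ?thesis
    by (simp add: theta_form_def fderiv_a[OF q] hess_def cov_deriv_sym[OF q, of _ i])
      (simp add: cov_deriv_def algebra_simps sum_distrib_left sum_distrib_right sum_subtractf)
qed

lemma zcoord_graph:
  assumes q: "q \<in> U"
  shows "zcoord g (q, a q) (w, fderiv a q w) $ i = (\<Sum>l\<in>UNIV. cmatrix (g q) (hess q) $ i $ l * of_real (w $ l))"
  by (simp add: zcoord_def theta_form_graph[OF q] coef_horiz_def cmatrix_def complex_eq_iff)

lemma symplectic_form_graph:
  assumes q: "q \<in> U"
  shows "symplectic_form (w, fderiv a q w) (w', fderiv a q w') = 0"
  using fderiv_a_sym[OF q, of w w'] by (simp add: symplectic_form_def inner_vec_def sum_subtractf)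

text \<open>The horizontal and the vertical frame carry the same coefficients \<open>d\<close> in
  \<open>conn_along\<close>. Collecting them turns the connection into one real matrix acting on the
  complex coordinates.\<close>

lemma connection_coefficients:
  fixes h :: "'k::finite \<Rightarrow> 'b::real_vector"
  shows "(\<Sum>i\<in>UNIV. x i *\<^sub>R h i + c i *\<^sub>R (\<Sum>j\<in>(UNIV::'k set). \<Sum>k\<in>UNIV. d i j k *\<^sub>R h k))
    = (\<Sum>k\<in>UNIV. (x k + (\<Sum>i\<in>UNIV. (\<Sum>j\<in>UNIV. d i j k) * c i)) *\<^sub>R h k)"
proof -
  have "(\<Sum>i\<in>UNIV. c i *\<^sub>R (\<Sum>j\<in>(UNIV::'k set). \<Sum>k\<in>UNIV. d i j k *\<^sub>R h k))
      = (\<Sum>i\<in>UNIV. \<Sum>k\<in>UNIV. ((\<Sum>j\<in>UNIV. d i j k) * c i) *\<^sub>R h k)"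
    by (intro sum.cong refl, subst sum.swap)
      (simp add: scaleR_sum_left[symmetric] scaleR_sum_right mult.commute)
  also have "\<dots> = (\<Sum>k\<in>UNIV. (\<Sum>i\<in>UNIV. (\<Sum>j\<in>UNIV. d i j k) * c i) *\<^sub>R h k)"
    by (subst sum.swap) (simp add: scaleR_sum_left)
  finally show ?thesis by (simp add: sum.distrib scaleR_add_left)
qed

lemma mean_curv_coef_graph:
  assumes N: "open N" "y \<in> N" and phi: "Cinf_on \<phi> N" "\<And>z. z \<in> N \<Longrightarrow> \<phi> z \<in> U"
    and f: "\<And>z. z \<in> N \<Longrightarrow> f z = (\<phi> z, a (\<phi> z))"
    and frame: "orthonormal_tangent_frame g f N \<epsilon>"
  shows "\<And>k. push f (\<epsilon> k) y = (fderiv \<phi> y (\<epsilon> k y), fderiv a (\<phi> y) (fderiv \<phi> y (\<epsilon> k y)))"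
    and "\<And>j. mean_curv_coef g f \<epsilon> y j =
       Im (fderiv angle_det (\<phi> y) (fderiv \<phi> y (\<epsilon> j y)) / angle_det (\<phi> y))"
    and "\<And>v. v \<in> span (range (\<lambda>k. fderiv \<phi> y (\<epsilon> k y)))"
proof -
  define w where "w k z = fderiv \<phi> z (\<epsilon> k z)" for k z
  have dphi: "(\<phi> has_derivative fderiv \<phi> z) (at z)" if "z \<in> N" for z
    using Cinf_on_has_derivative[OF N(1) phi(1) that] .
  have push: "push f (\<epsilon> k) z = (w k z, fderiv a (\<phi> z) (w k z))" if z: "z \<in> N" for k z
  proof -
    have "((\<lambda>z. a (\<phi> z)) has_derivative (\<lambda>v. fderiv a (\<phi> z) (fderiv \<phi> z v))) (at z)"
      using has_derivative_compose[OF dphi[OF z], of a] diff_a[OF phi(2)[OF z]]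
      by (simp add: frechet_derivative_works)
    then have "((\<lambda>z. (\<phi> z, a (\<phi> z))) has_derivative (\<lambda>v. (fderiv \<phi> z v, fderiv a (\<phi> z) (fderiv \<phi> z v)))) (at z)"
      by (intro has_derivative_Pair dphi z)
    then have "(f has_derivative (\<lambda>v. (fderiv \<phi> z v, fderiv a (\<phi> z) (fderiv \<phi> z v)))) (at z)"
      by (rule has_derivative_transform_within_open[OF _ N(1) z]) (simp add: f)
    then show ?thesis by (simp add: push_def fderiv_eq w_def)
  qed
  then show "push f (\<epsilon> k) y = (fderiv \<phi> y (\<epsilon> k y), fderiv a (\<phi> y) (fderiv \<phi> y (\<epsilon> k y)))" for k
    using N(2) by (simp add: w_def)
  define Z :: "real^'n \<Rightarrow> complex^'n^'n" where "Z z = (\<chi> i k. zcoord g (f z) (push f (\<epsilon> k) z) $ i)" for z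
  define W :: "real^'n \<Rightarrow> real^'n^'n" where "W z = (\<chi> l k. w k z $ l)" for z
  have Z: "Z z = cmatrix (g (\<phi> z)) (hess (\<phi> z)) ** cmatrix (W z) 0" if z: "z \<in> N" for z
    using z by (simp add: Z_def push f zcoord_graph[OF phi(2)] vec_eq_iff matrix_matrix_mult_def W_def cmatrix_def)
  have detZ: "det (Z z) = angle_det (\<phi> z) * of_real (det (W z))" if "z \<in> N" for z
    by (simp add: Z that det_mul det_cmatrix_0 angle_det_def)
  have uy: "\<phi> y \<in> U" using phi(2) N(2) .
  interpret local_metric g "(\<phi> y, a (\<phi> y))" U using local_metric[OF uy] .
  have fy: "f y = (\<phi> y, a (\<phi> y))" using f N(2) .
  have diff_w: "(\<lambda>z. w k z $ l) differentiable (at y)" for k l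
  proof -
    have nth: "(\<lambda>z. \<phi> z $ l) differentiable (at z)" if "z \<in> N" for z
      by (rule Cinf_on_differentiable[OF N(1) Cinf_on_vec_nth[OF phi(1)] that])
    \<comment> \<open>The direction \<open>\<epsilon> k z\<close> varies with \<open>z\<close>, so
      the derivative is spelled out in partial derivatives before it is differentiated
      again.\<close>
    have "w k z $ l = (\<Sum>i\<in>UNIV. \<epsilon> k z $ i * partial i (\<lambda>z. \<phi> z $ l) z)" if z: "z \<in> N" for z
      unfolding w_def using fderiv_vec_nth[of \<phi> z l] dphi[OF z] fderiv_partial[OF nth[OF z]]
      by (simp add: differentiableI)
    moreover have "(\<lambda>z. \<Sum>i\<in>UNIV. \<epsilon> k z $ i * partial i (\<lambda>z. \<phi> z $ l) z) differentiable (at y)"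
      using frame unfolding orthonormal_tangent_frame_def
      by (intro differentiable_sum differentiable_mult ballI finite Cinf_on_differentiable[OF N(1) _ N(2)]
          Cinf_on_partial Cinf_on_vec_nth phi N) auto
    ultimately show ?thesis
      using N has_derivative_transform_within_open[of _ _ y UNIV N "\<lambda>z. w k z $ l"]
      unfolding differentiable_def by (metis (no_types, lifting))
  qed
  have diff_of_real: "(\<lambda>z. complex_of_real (r z)) differentiable (at y)" if "r differentiable (at y)" for r :: "real^'n \<Rightarrow> real"
    using that bounded_linear.has_derivative[OF bounded_linear_of_real] unfolding differentiable_def by blast
  have diff_Z: "(\<lambda>z. Z z $ i $ k) differentiable (at y)" for i k
  proof -
    have M: "(\<lambda>z. cmatrix (g (\<phi> z)) (hess (\<phi> z)) $ i $ l) differentiable (at y)" for l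
      using differentiable_compose[of "\<lambda>q. cmatrix (g q) (hess q) $ i $ l" \<phi> y UNIV] diff_cmatrix[OF uy] dphi[OF N(2)]
      by (auto simp: differentiable_def)
    have "(\<lambda>z. \<Sum>l\<in>UNIV. cmatrix (g (\<phi> z)) (hess (\<phi> z)) $ i $ l * of_real (w k z $ l)) differentiable (at y)"
      by (intro differentiable_sum differentiable_mult ballI finite M diff_of_real diff_w)
    moreover have "Z z $ i $ k = (\<Sum>l\<in>UNIV. cmatrix (g (\<phi> z)) (hess (\<phi> z)) $ i $ l * of_real (w k z $ l))" if "z \<in> N" for z
      by (simp add: Z[OF that] matrix_matrix_mult_def W_def cmatrix_def)
    ultimately show ?thesis
      using N has_derivative_transform_within_open[of _ _ y UNIV N "\<lambda>z. Z z $ i $ k"]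
      unfolding differentiable_def by (metis (no_types, lifting))
  qed
  define Z' :: "real^'n \<Rightarrow> complex^'n^'n" where "Z' v = (\<chi> i k. fderiv (\<lambda>z. Z z $ i $ k) y v)" for v
  have Z': "((\<lambda>z. Z z $ i $ k) has_derivative (\<lambda>v. Z' v $ i $ k)) (at y)" for i k
    using diff_Z by (simp add: Z'_def frechet_derivative_works)
  \<comment> \<open>The candidate for the inverse of \<open>Z y\<close>: its adjoint times
    g^-1.\<close>
  define B :: "complex^'n^'n" where "B = (\<chi> k j. \<Sum>i\<in>UNIV. of_real (ginv g (\<phi> y) i j) * cnj (Z y $ i $ k))"
  have Bmult: "(B ** C) $ k $ l = (\<Sum>i\<in>UNIV. \<Sum>j\<in>UNIV. of_real (ginv g (\<phi> y) i j) * (cnj (Z y $ i $ k) * C $ j $ l))" for C k l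
    unfolding B_def by (simp add: matrix_matrix_mult_def sum_distrib_right mult.assoc, subst sum.swap) simp
  have BZ: "B ** Z y = mat 1"
  proof -
    have "(B ** Z y) $ k $ l = mat 1 $ k $ l" for k l
    proof -
      \<comment> \<open>The entry is the Hermitian product of two frame vectors: orthonormality
        settles the real part, the Lagrangian property the imaginary part.\<close>
      have "(B ** Z y) $ k $ l = Complex (metricG g (f y) (push f (\<epsilon> k) y) (push f (\<epsilon> l) y))
          (symplectic_form (push f (\<epsilon> k) y) (push f (\<epsilon> l) y))"
        unfolding Bmult hermitian_zcoord[symmetric] fy by (simp add: Z_def fy)
      also have "\<dots> = mat 1 $ k $ l"
        using frame N(2) symplectic_form_graph[OF uy, of "w k y" "w l y"]
        by (simp add: orthonormal_tangent_frame_def push mat_def complex_eq_iff)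
      finally show ?thesis .
    qed
    then show ?thesis by (simp add: vec_eq_iff)
  qed
  have det_nz: "det (Z y) \<noteq> 0"
    using arg_cong[OF BZ, of det] by (auto simp: det_mul)
  then have dW: "det (W y) \<noteq> 0" using detZ N(2) by auto
  \<comment> \<open>Because \<open>W y\<close> is nonsingular the base parts of the frame span; this
    later carries identities from the frame to all vectors.\<close>
  have "v \<in> span (range (\<lambda>k. w k y))" for v
  proof -
    have "invertible (W y)" using dW by (simp add: invertible_det_nz)
    then obtain c where "W y *v c = v"
      by (metis invertible_def matrix_vector_mul_assoc matrix_vector_mul_lid)
    then have "v = (\<Sum>k\<in>UNIV. c $ k *\<^sub>R w k y)"
      by (simp add: W_def vec_eq_iff matrix_vector_mult_def mult.commute)
    then show ?thesis by (simp add: span_sum span_scale span_base)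
  qed
  then show "v \<in> span (range (\<lambda>k. fderiv \<phi> y (\<epsilon> k y)))" for v by (simp add: w_def)
  show "mean_curv_coef g f \<epsilon> y j = Im (fderiv angle_det (\<phi> y) (fderiv \<phi> y (\<epsilon> j y)) / angle_det (\<phi> y))" for j
  proof -
    define v where "v = \<epsilon> j y"
    \<comment> \<open>The connection matrix, with real entries. As \<open>B\<close> inverts
      \<open>Z y\<close>, it contributes its own trace to the sum, which has no imaginary
      part.\<close>
    define \<Gamma> :: "complex^'n^'n" where
      "\<Gamma> = (\<chi> i l. of_real (\<Sum>j\<in>UNIV. - christoffel g (\<phi> y) l j i * fst (fderiv f y v) $ j))"
    have conn: "zcoord g (f y) (conn_along g f (push f (\<epsilon> k)) y v) $ i = (Z' v + \<Gamma> ** Z y) $ i $ k" for i k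
    proof -
      have re: "fderiv (\<lambda>z. coef_horiz g (f z) i (push f (\<epsilon> k) z)) y v = Re (Z' v $ i $ k)" for i
        using fderiv_eq[OF bounded_linear.has_derivative[OF bounded_linear_Re Z'[of i k]]]
        by (simp add: Z_def zcoord_def fun_eq_iff)
      have im: "fderiv (\<lambda>z. theta_form g (f z) i (push f (\<epsilon> k) z)) y v = Im (Z' v $ i $ k)" for i
        using fderiv_eq[OF bounded_linear.has_derivative[OF bounded_linear_Im Z'[of i k]]]
        by (simp add: Z_def zcoord_def fun_eq_iff)
      show ?thesis
        unfolding conn_along_def Let_def connection_coefficients fy zcoord_combination re im
        by (simp add: complex_eq_iff matrix_matrix_mult_def \<Gamma>_def Z_def zcoord_def fy)
    qed
    have "mean_curv_coef g f \<epsilon> y j = (\<Sum>k\<in>UNIV. Im ((B ** (Z' v + \<Gamma> ** Z y)) $ k $ k))"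
      unfolding mean_curv_coef_def Bmult v_def[symmetric] conn[symmetric]
      by (simp add: fy metricG_complexJ Z_def)
    also have "\<dots> = Im (trace (B ** Z' v)) + Im (trace (B ** (\<Gamma> ** Z y)))"
      by (simp add: matrix_add_ldistrib trace_def sum.distrib)
    also have "trace (B ** (\<Gamma> ** Z y)) = trace \<Gamma>"
      using BZ matrix_left_right_inverse[of B "Z y"]
      by (subst trace_mul_sym) (simp add: matrix_mul_assoc[symmetric])
    also have "Im (trace \<Gamma>) = 0" by (simp add: trace_def \<Gamma>_def)
    finally have nu: "mean_curv_coef g f \<epsilon> y j = Im (trace (B ** Z' v))" by simp
    \<comment> \<open>\<open>det (W z)\<close> is real, so its logarithmic derivative disappears in
      the imaginary part and only that of \<open>angle_det\<close> is left.\<close>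
    have "(\<lambda>z. det (W z)) differentiable (at y)"
      by (intro differentiable_det) (simp add: W_def diff_w)
    then obtain d where d: "((\<lambda>z. det (W z)) has_derivative d) (at y)" by (auto simp: differentiable_def)
    have "((\<lambda>z. angle_det (\<phi> z) * of_real (det (W z))) has_derivative
        (\<lambda>h. angle_det (\<phi> y) * of_real (d h) + fderiv angle_det (\<phi> y) (fderiv \<phi> y h) * of_real (det (W y)))) (at y)"
      using has_derivative_mult[OF has_derivative_compose[OF dphi[OF N(2)], of angle_det]
          bounded_linear.has_derivative[OF bounded_linear_of_real d]] diff_angle_det[OF uy]
      by (simp add: frechet_derivative_works)
    then have "((\<lambda>z. det (Z z)) has_derivative
        (\<lambda>h. angle_det (\<phi> y) * of_real (d h) + fderiv angle_det (\<phi> y) (fderiv \<phi> y h) * of_real (det (W y)))) (at y)"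
      by (rule has_derivative_transform_within_open[OF _ N]) (simp add: detZ)
    from fun_cong[OF has_derivative_unique[OF this det_has_derivative[OF Z' BZ]], of v]
    have "angle_det (\<phi> y) * of_real (d v) + fderiv angle_det (\<phi> y) (fderiv \<phi> y v) * of_real (det (W y))
       = angle_det (\<phi> y) * of_real (det (W y)) * trace (B ** Z' v)"
      by (simp add: detZ N)
    then have "trace (B ** Z' v) = of_real (d v / det (W y)) + fderiv angle_det (\<phi> y) (fderiv \<phi> y v) / angle_det (\<phi> y)"
      using dW angle_det_nz[OF uy] by (simp add: field_simps)
    then show ?thesis by (simp add: nu v_def)
  qed
qed

text \<open>The left-hand side is the time derivative of \<open>a\<close> at the fixed base point \<open>\<phi> y\<close>
  if \<open>H\<close> is the velocity of the graph; the pairing of \<open>H\<close> with the tangent vectors by \<open>\<omega>\<close>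
  picks it out.\<close>

lemma gen_mean_curvature_graph:
  assumes N: "open N" "y \<in> N" and phi: "Cinf_on \<phi> N" "\<And>z. z \<in> N \<Longrightarrow> \<phi> z \<in> U"
    and f: "\<And>z. z \<in> N \<Longrightarrow> f z = (\<phi> z, a (\<phi> z))"
    and H: "is_gen_mean_curvature g f y H"
  shows "(snd H - fderiv a (\<phi> y) (fst H)) \<bullet> v = Im (fderiv angle_det (\<phi> y) v / angle_det (\<phi> y))"
proof -
  obtain N' \<epsilon> where N': "open N'" "y \<in> N'" and frame': "orthonormal_tangent_frame g f N' \<epsilon>"
    and H: "H = (\<Sum>i\<in>UNIV. mean_curv_coef g f \<epsilon> y i *\<^sub>R complexJ g (f y) (push f (\<epsilon> i) y))"
    using H unfolding is_gen_mean_curvature_def by blast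
  \<comment> \<open>The frame lives on \<open>N'\<close>, the description as a graph on
    \<open>N\<close>.\<close>
  have op: "open (N \<inter> N')" "y \<in> N \<inter> N'" using N N' by auto
  have frame: "orthonormal_tangent_frame g f (N \<inter> N') \<epsilon>"
    using frame' Cinf_on_subset[of _ N' "N \<inter> N'"] unfolding orthonormal_tangent_frame_def by blast
  note graph = mean_curv_coef_graph[OF op Cinf_on_subset[OF phi(1) Int_lower1] _ _ frame, unfolded Int_iff, OF phi(2) f]
  have uy: "\<phi> y \<in> U" using phi(2) N(2) .
  interpret local_metric g "(\<phi> y, a (\<phi> y))" U using local_metric[OF uy] .
  have fy: "f y = (\<phi> y, a (\<phi> y))" using f N(2) .
  define w where "w k = fderiv \<phi> y (\<epsilon> k y)" for k
  have push: "push f (\<epsilon> k) y = (w k, fderiv a (\<phi> y) (w k))" for k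
    using graph(1) by (simp add: w_def)
  let ?L = "\<lambda>v. (snd H - fderiv a (\<phi> y) (fst H)) \<bullet> v"
  let ?R = "\<lambda>v. Im (fderiv angle_det (\<phi> y) v / angle_det (\<phi> y))"
  \<comment> \<open>Both sides are linear in \<open>v\<close> and the base parts \<open>w k\<close>
    span, so it suffices to test on them.\<close>
  have lin: "linear (\<lambda>v. ?L v - ?R v)"
  proof -
    have "linear (fderiv angle_det (\<phi> y))" using linear_frechet_derivative[OF diff_angle_det[OF uy]] .
    then show ?thesis
      by (intro linearI) (simp_all add: linear_add linear_cmul inner_add_right divide_inverse algebra_simps)
  qed
  have "?L (w j) - ?R (w j) = 0" for j
  proof -
    have lin_s: "linear (\<lambda>v. symplectic_form v u)" for u :: "'n phase"
      by (rule linearI) (simp_all add: symplectic_form_def algebra_simps sum.distrib sum_subtractf sum_distrib_left)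
    \<comment> \<open>J J = -1 and \<omega> = G(J ., .) reduce this pairing to
      orthonormality.\<close>
    have pair: "symplectic_form (complexJ g (f y) (push f (\<epsilon> i) y)) (push f (\<epsilon> j) y) = (if i = j then - 1 else 0)" for i
    proof -
      have "symplectic_form (complexJ g (f y) (push f (\<epsilon> i) y)) (push f (\<epsilon> j) y)
          = metricG g (f y) (- push f (\<epsilon> i) y) (push f (\<epsilon> j) y)"
        by (simp add: fy symplectic_form_eq complexJ_complexJ)
      also have "\<dots> = - metricG g (f y) (push f (\<epsilon> i) y) (push f (\<epsilon> j) y)"
        by (simp add: fy metricG_coef linear_neg[OF linear_coef_horiz] linear_neg[OF linear_theta_form]
            algebra_simps flip: sum_negf)
      finally show ?thesis using frame op by (simp add: orthonormal_tangent_frame_def)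
    qed
    have "symplectic_form H (push f (\<epsilon> j) y) = - mean_curv_coef g f \<epsilon> y j"
      by (simp add: H linear_sum[OF lin_s] linear_cmul[OF lin_s] pair if_distrib cong: if_cong)
    moreover have "symplectic_form H (push f (\<epsilon> j) y) = fst H \<bullet> fderiv a (\<phi> y) (w j) - w j \<bullet> snd H"
      by (simp add: push symplectic_form_def inner_vec_def sum_subtractf)
    \<comment> \<open>Closedness of the form allows exchanging \<open>fst H\<close> and
      \<open>w j\<close> in the derivative term.\<close>
    ultimately have "?L (w j) = mean_curv_coef g f \<epsilon> y j"
      using fderiv_a_sym[OF uy, of "fst H" "w j"] by (simp add: inner_diff_left inner_diff_right inner_commute)
    then show ?thesis using graph(2) by (simp add: w_def)
  qed
  then have "?L v - ?R v = 0"
    using linear_eq_0_on_span[OF lin, of "range w" v] graph(3)[of v] by (auto simp: w_def[abs_def])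
  then show ?thesis by simp
qed

end

section \<open>Change of charts\<close>

lemma bounded_bilinear_matrix_vector_mult:
  "bounded_bilinear ((*v) :: real^'n^'m \<Rightarrow> real^'n \<Rightarrow> real^'m)"
  unfolding bilinear_conv_bounded_bilinear[symmetric] bilinear_def
  by (auto intro!: linearI simp: matrix_vector_mult_add_rdistrib matrix_vector_right_distrib
      scaleR_matrix_vector_assoc matrix_vector_mult_scaleR)

lemma bilinear_eq_on_axis:
  fixes F G :: "real^'n \<Rightarrow> real^'n \<Rightarrow> real"
  assumes "\<And>u. linear (F u)" "\<And>v. linear (\<lambda>u. F u v)" "\<And>u. linear (G u)" "\<And>v. linear (\<lambda>u. G u v)"
    and "\<And>i j. F (axis i 1) (axis j 1) = G (axis i 1) (axis j 1)"
  shows "F u v = G u v"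
proof -
  have "F (axis i 1) v = G (axis i 1) v" for i
    using linear_axis_expansion[OF assms(1), of "axis i 1" v] linear_axis_expansion[OF assms(3), of "axis i 1" v] assms(5)
    by simp
  then show ?thesis
    using linear_axis_expansion[OF assms(2), of u v] linear_axis_expansion[OF assms(4), of u v] by simp
qed

context closed_form_chart
begin

lemma has_derivative_g: "q \<in> U \<Longrightarrow> (g has_derivative fderiv g q) (at q)"
  by (rule Cinf_on_has_derivative[OF open_U smooth_g])

lemma has_derivative_a: "q \<in> U \<Longrightarrow> (a has_derivative fderiv a q) (at q)"
  by (rule Cinf_on_has_derivative[OF open_U smooth_a])

lemma partial_g: "q \<in> U \<Longrightarrow> partial i (\<lambda>q. g q $ j $ l) q = fderiv g q (axis i 1) $ j $ l"
  using has_derivative_g fderiv_vec_nth[of g q j] fderiv_vec_nth[of "\<lambda>q. g q $ j" q l]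
    Cinf_on_differentiable[OF open_U Cinf_on_vec_nth[OF smooth_g]] Cinf_on_differentiable[OF open_U smooth_g]
  by (simp add: partial_def)

text \<open>With \<open>\<xi>\<close> the vector dual to \<open>a\<close>, the Christoffel symbols
  contracted with \<open>a\<close> become derivatives of \<open>g\<close> evaluated on vectors. In
  this form a change of coordinates is just the product rule.\<close>

lemma hess_form:
  assumes q: "q \<in> U" and \<xi>: "g q *v \<xi> = a q"
  shows "u \<bullet> (hess q *v v) = fderiv a q u \<bullet> v
     - (v \<bullet> (fderiv g q u *v \<xi>) + u \<bullet> (fderiv g q v *v \<xi>) - u \<bullet> (fderiv g q \<xi> *v v)) / 2"
    (is "?F u v = ?G u v")
proof (rule bilinear_eq_on_axis[of ?F ?G])
  have lin: "linear (fderiv g q)" "linear (fderiv a q)"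
    using has_derivative_g[OF q] has_derivative_a[OF q] by (auto dest: has_derivative_linear)
  note simps = linear_add[OF lin(1)] linear_add[OF lin(2)] linear_cmul[OF lin(1)] linear_cmul[OF lin(2)]
    matrix_vector_mult_add_rdistrib matrix_vector_right_distrib scaleR_matrix_vector_assoc[symmetric]
    matrix_vector_mult_scaleR inner_add_left inner_add_right inner_scaleR_left inner_scaleR_right real_scaleR_def
  show "linear (?F u)" "linear (\<lambda>u. ?F u v)" "linear (?G u)" "linear (\<lambda>u. ?G u v)" for u v
    by (rule linearI; simp only: simps; simp add: field_simps)+
  fix i j :: 'n
  have ax: "axis i 1 \<bullet> w = w $ i" for i and w :: "real^'n" by (simp add: inner_axis')
  have mx: "(M *v axis j 1) $ i = M $ i $ j" for M :: "real^'n^'n" and i j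
    by (simp add: matrix_vector_mult_basis column_def)
  interpret local_metric g "(q, a q)" U by (rule local_metric[OF q])
  have ga: "(\<Sum>k\<in>UNIV. ginv g q k l * a q $ k) = \<xi> $ l" for l
  proof -
    have "matrix_inv (g q) *v a q = \<xi>"
      using det_g[OF q] by (simp flip: \<xi> add: matrix_vector_mul_assoc matrix_inv_field)
    then show ?thesis
      using ginv_symmetric by (auto simp: matrix_vector_mult_def ginv_def)
  qed
  have "(\<Sum>k\<in>UNIV. christoffel g q k i j * a q $ k) =
      (\<Sum>k\<in>UNIV. \<Sum>l\<in>UNIV. (ginv g q k l * a q $ k) * ((fderiv g q (axis i 1) $ j $ l + fderiv g q (axis j 1) $ i $ l
         - fderiv g q (axis l 1) $ i $ j) / 2))"
    by (simp add: christoffel_def partial_g[OF q] sum_distrib_right sum_distrib_left sum_divide_distrib mult_ac)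
  also have "\<dots> = (\<Sum>l\<in>UNIV. \<xi> $ l * ((fderiv g q (axis i 1) $ j $ l + fderiv g q (axis j 1) $ i $ l
         - fderiv g q (axis l 1) $ i $ j) / 2))"
    by (subst sum.swap) (simp add: ga[symmetric] sum_distrib_right sum_divide_distrib)
  also have "\<dots> = ((fderiv g q (axis i 1) *v \<xi>) $ j + (fderiv g q (axis j 1) *v \<xi>) $ i - (fderiv g q \<xi>) $ i $ j) / 2"
    unfolding linear_axis_expansion[OF lin(1), of \<xi>]
    by (simp add: matrix_vector_mult_def algebra_simps sum.distrib sum_subtractf flip: sum_divide_distrib)
  finally show "?F (axis i 1) (axis j 1) = ?G (axis i 1) (axis j 1)"
    by (simp add: ax mx hess_def cov_deriv_def partial_def fderiv_vec_nth[OF diff_a[OF q]] inner_axis)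
qed

end

text \<open>Differentiating the pullback formulas for \<open>g\<close> and \<open>a\<close> produces
  second derivatives \<open>H\<close> of the coordinate change. Inserted into
  \<open>hess_form\<close> they cancel, since \<open>H\<close> is symmetric in its directions and
  \<open>g' (\<psi> q)\<close> in its arguments.\<close>

lemma hess_transform:
  fixes \<psi> :: "real^'n \<Rightarrow> real^'n::finite"
  assumes cf: "closed_form_chart g a U" and cf': "closed_form_chart g' a' U'"
    and V: "open V" "V \<subseteq> U" and psi: "Cinf_on \<psi> V" "\<psi> ` V \<subseteq> U'"
    and g: "\<And>q. q \<in> V \<Longrightarrow> g q = transpose (matrix (fderiv \<psi> q)) ** g' (\<psi> q) ** matrix (fderiv \<psi> q)"
    and a: "\<And>q. q \<in> V \<Longrightarrow> a q = transpose (matrix (fderiv \<psi> q)) *v a' (\<psi> q)"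
    and q: "q \<in> V"
  shows "closed_form_chart.hess g a q =
    transpose (matrix (fderiv \<psi> q)) ** closed_form_chart.hess g' a' (\<psi> q) ** matrix (fderiv \<psi> q)"
    and "det (matrix (fderiv \<psi> q)) \<noteq> 0"
proof -
  interpret c: closed_form_chart g a U by fact
  interpret d: closed_form_chart g' a' U' by fact
  have dpsi: "(\<psi> has_derivative fderiv \<psi> z) (at z)" if "z \<in> V" for z
    by (rule Cinf_on_has_derivative[OF V(1) psi(1) that])
  have lin: "linear (fderiv \<psi> z)" if "z \<in> V" for z
    using dpsi[OF that] by (rule has_derivative_linear)
  have mat: "matrix (fderiv \<psi> z) *v v = fderiv \<psi> z v" if "z \<in> V" for z v
    using matrix_works[of "fderiv \<psi> z" v] lin[OF that] by (simp add: linear_matrix_vector_mul_eq)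
  have tr: "u \<bullet> (v v* J) = (J *v u) \<bullet> v" for u v and J :: "real^'n^'n"
    by (metis dot_lmul_matrix inner_commute)
  let ?J = "fderiv \<psi> q"
  have qU: "q \<in> U" "\<psi> q \<in> U'" using q V psi by auto
  show dJ: "det (matrix ?J) \<noteq> 0"
    using c.det_g[OF qU(1)] g[OF q] by (auto simp: det_mul)
  define \<xi> where "\<xi> = matrix_inv (g q) *v a q"
  have \<xi>: "g q *v \<xi> = a q"
    using c.det_g[OF qU(1)] by (simp add: \<xi>_def matrix_vector_mul_assoc matrix_inv_field)
  \<comment> \<open>The dual vector is transported by the Jacobian, so \<open>hess_form\<close> is
    available on both sides at corresponding vectors.\<close>
  have \<xi>': "g' (\<psi> q) *v ?J \<xi> = a' (\<psi> q)"
  proof -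
    have "transpose (matrix ?J) *v (g' (\<psi> q) *v ?J \<xi>) = transpose (matrix ?J) *v a' (\<psi> q)"
      using \<xi> unfolding g[OF q] a[OF q] by (simp add: matrix_vector_mul_assoc[symmetric] mat[OF q])
    moreover have "det (transpose (matrix ?J)) \<noteq> 0" using dJ by simp
    ultimately show ?thesis
      by (metis matrix_inv_field(2) matrix_vector_mul_assoc matrix_vector_mul_lid)
  qed
  define H where "H u v = fderiv (\<lambda>z. fderiv \<psi> z v) q u" for u v
  have H: "((\<lambda>z. fderiv \<psi> z v) has_derivative (\<lambda>u. H u v)) (at q)" for v
    unfolding H_def by (rule Cinf_on_has_derivative[OF V(1) Cinf_on_fderiv[OF V(1) psi(1)] q])
  have H_sym: "H u v = H v u" for u v
  proof -
    have "H u v $ i = fderiv (\<lambda>z. fderiv (\<lambda>z. \<psi> z $ i) z v) q u" for i u v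
    proof -
      have "((\<lambda>z. fderiv \<psi> z v $ i) has_derivative (\<lambda>u. H u v $ i)) (at q)"
        using bounded_linear.has_derivative[OF bounded_linear_vec_nth H] .
      then have "((\<lambda>z. fderiv (\<lambda>z. \<psi> z $ i) z v) has_derivative (\<lambda>u. H u v $ i)) (at q)"
        by (rule has_derivative_transform_within_open[OF _ V(1) q])
          (simp add: fderiv_vec_nth Cinf_on_differentiable[OF V(1) psi(1)])
      then show ?thesis by (simp add: fderiv_eq)
    qed
    then show ?thesis
      using fderiv_symmetric[OF V(1) Cinf_on_vec_nth[OF psi(1)] q] by (simp add: vec_eq_iff)
  qed
  have Da: "fderiv a q u \<bullet> v = fderiv a' (\<psi> q) (?J u) \<bullet> ?J v + a' (\<psi> q) \<bullet> H u v" for u v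
  proof -
    have "((\<lambda>z. a' (\<psi> z) \<bullet> fderiv \<psi> z v) has_derivative
        (\<lambda>h. a' (\<psi> q) \<bullet> H h v + fderiv a' (\<psi> q) (?J h) \<bullet> ?J v)) (at q)"
      by (intro has_derivative_inner has_derivative_compose[OF dpsi[OF q]] d.has_derivative_a qU H)
    then have "((\<lambda>z. a z \<bullet> v) has_derivative
        (\<lambda>h. a' (\<psi> q) \<bullet> H h v + fderiv a' (\<psi> q) (?J h) \<bullet> ?J v)) (at q)"
      by (rule has_derivative_transform_within_open[OF _ V(1) q])
        (simp add: a inner_commute[of _ v] tr mat, simp add: inner_commute)
    moreover have "((\<lambda>z. a z \<bullet> v) has_derivative (\<lambda>h. fderiv a q h \<bullet> v)) (at q)"
      by (intro has_derivative_inner_left c.has_derivative_a qU)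
    ultimately show ?thesis using has_derivative_unique by (metis (no_types, lifting) add.commute)
  qed
  have Dg: "v \<bullet> (fderiv g q u *v w) = ?J v \<bullet> (fderiv g' (\<psi> q) (?J u) *v ?J w)
      + H u v \<bullet> (g' (\<psi> q) *v ?J w) + ?J v \<bullet> (g' (\<psi> q) *v H u w)" for u v w
  proof -
    have "((\<lambda>z. fderiv \<psi> z v \<bullet> (g' (\<psi> z) *v fderiv \<psi> z w)) has_derivative
        (\<lambda>h. ?J v \<bullet> (g' (\<psi> q) *v H h w + fderiv g' (\<psi> q) (?J h) *v ?J w) + H h v \<bullet> (g' (\<psi> q) *v ?J w))) (at q)"
      by (intro has_derivative_inner bounded_bilinear.FDERIV[OF bounded_bilinear_matrix_vector_mult]
          has_derivative_compose[OF dpsi[OF q]] d.has_derivative_g qU H)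
    then have "((\<lambda>z. v \<bullet> (g z *v w)) has_derivative
        (\<lambda>h. ?J v \<bullet> (g' (\<psi> q) *v H h w + fderiv g' (\<psi> q) (?J h) *v ?J w) + H h v \<bullet> (g' (\<psi> q) *v ?J w))) (at q)"
      by (rule has_derivative_transform_within_open[OF _ V(1) q])
        (simp add: g matrix_vector_mul_assoc[symmetric] mat tr)
    moreover have "((\<lambda>z. v \<bullet> (g z *v w)) has_derivative (\<lambda>h. v \<bullet> (fderiv g q h *v w))) (at q)"
      by (intro has_derivative_inner_right bounded_linear.has_derivative[OF
          bounded_bilinear.bounded_linear_left[OF bounded_bilinear_matrix_vector_mult]] c.has_derivative_g qU)
    ultimately have "(\<lambda>h. v \<bullet> (fderiv g q h *v w)) =
        (\<lambda>h. ?J v \<bullet> (g' (\<psi> q) *v H h w + fderiv g' (\<psi> q) (?J h) *v ?J w) + H h v \<bullet> (g' (\<psi> q) *v ?J w))"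
      by (rule has_derivative_unique[rotated])
    from fun_cong[OF this, of u] show ?thesis by (simp add: inner_add_right)
  qed
  have g'_sym: "v \<bullet> (g' (\<psi> q) *v w) = w \<bullet> (g' (\<psi> q) *v v)" for v w
    by (metis d.sym_g[OF qU(2)] inner_commute tr transpose_matrix_vector)
  \<comment> \<open>The three metric terms leave twice \<open>a' (\<psi> q) \<bullet> H u v\<close>;
    halved, it cancels the second-derivative term of \<open>Da\<close>.\<close>
  have form: "u \<bullet> (c.hess q *v v) = ?J u \<bullet> (d.hess (\<psi> q) *v ?J v)" for u v
    using H_sym[of u v] H_sym[of u \<xi>] H_sym[of v \<xi>] g'_sym[of "?J u" "H \<xi> v"] g'_sym[of "?J v" "H \<xi> u"]
    unfolding c.hess_form[OF qU(1) \<xi>] d.hess_form[OF qU(2) \<xi>'] Da Dg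
    by (simp add: \<xi>' inner_commute[of "a' (\<psi> q)"] g'_sym[of "?J u"] g'_sym[of "?J v"] field_simps)
  have "c.hess q *v v = (transpose (matrix ?J) ** d.hess (\<psi> q) ** matrix ?J) *v v" for v
  proof -
    have "u \<bullet> (c.hess q *v v) = u \<bullet> ((transpose (matrix ?J) ** d.hess (\<psi> q) ** matrix ?J) *v v)" for u
      by (simp add: form matrix_vector_mul_assoc[symmetric] mat[OF q] tr)
    then show ?thesis by (metis vector_eq_rdot inner_commute)
  qed
  then show "c.hess q = transpose (matrix ?J) ** d.hess (\<psi> q) ** matrix ?J"
    by (simp add: matrix_eq)
qed

text \<open>Metric and Hessian both transform as bilinear forms, so the determinant only picks up
  the square of the Jacobian determinant, a positive real number.\<close>

lemma angle_phase_transform: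
  fixes \<psi> :: "real^'n \<Rightarrow> real^'n::finite"
  assumes cf: "closed_form_chart g a U" and cf': "closed_form_chart g' a' U'"
    and V: "open V" "V \<subseteq> U" and psi: "Cinf_on \<psi> V" "\<psi> ` V \<subseteq> U'"
    and g: "\<And>q. q \<in> V \<Longrightarrow> g q = transpose (matrix (fderiv \<psi> q)) ** g' (\<psi> q) ** matrix (fderiv \<psi> q)"
    and a: "\<And>q. q \<in> V \<Longrightarrow> a q = transpose (matrix (fderiv \<psi> q)) *v a' (\<psi> q)"
    and q: "q \<in> V"
  shows "angle_phase g a q = angle_phase g' a' (\<psi> q)"
proof -
  interpret c: closed_form_chart g a U by fact
  interpret d: closed_form_chart g' a' U' by fact
  note tr = hess_transform[OF assms]
  let ?J = "matrix (fderiv \<psi> q)"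
  have "cmatrix (g q) (c.hess q) = cmatrix (transpose ?J) 0 ** cmatrix (g' (\<psi> q)) (d.hess (\<psi> q)) ** cmatrix ?J 0"
    by (simp add: cmatrix_mult g[OF q] tr(1))
  then have "c.angle_det q = of_real ((det ?J)\<^sup>2) * d.angle_det (\<psi> q)"
    by (simp add: c.angle_det_def d.angle_det_def det_mul det_cmatrix_0 power2_eq_square)
  moreover have "sgn (complex_of_real r) = 1" if "r > 0" for r
    using that by (simp add: sgn_of_real)
  ultimately have "sgn (c.angle_det q) = sgn (d.angle_det (\<psi> q))"
    using tr(2) by (simp add: sgn_mult del: of_real_power)
  moreover have "q \<in> U" "\<psi> q \<in> U'" using q V psi by auto
  ultimately show ?thesis by (simp add: c.angle_phase d.angle_phase)
qed

section \<open>Families of maps with invertible derivative in the space variable\<close>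

text \<open>\<open>K\<close> inverts the derivative at the one point, so \<phi> followed by
  \<open>K\<close> is close to a translation on a small ball, by compactness for all nearby
  \<open>t\<close> at once, and Brouwer's theorem gives surjectivity. Time is only a parameter, so
  an end of \<open>I\<close> is as good as an interior point.\<close>

lemma parametric_open_mapping:
  fixes \<phi> :: "'a::euclidean_space \<times> real \<Rightarrow> 'a"
  assumes D: "openin (top_of_set (UNIV \<times> I)) D" and cont: "continuous_on D \<phi>"
    and y0: "(y0, t0) \<in> D" and L: "((\<lambda>y. \<phi> (y, t0)) has_derivative L) (at y0)" "inj L" and e: "e > 0"
  obtains \<delta> where "\<delta> > 0"
    "\<And>q t. t \<in> I \<Longrightarrow> dist q (\<phi> (y0, t0)) < \<delta> \<Longrightarrow> dist t t0 < \<delta> \<Longrightarrow> \<exists>y. dist y y0 < e \<and> (y, t) \<in> D \<and> \<phi> (y, t) = q"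
proof -
  obtain K where K: "linear K" "\<And>x. K (L x) = x" "\<And>x. L (K x) = x"
    using linear_injective_isomorphism[OF has_derivative_linear[OF L(1)] L(2)] by blast
  have bK: "bounded_linear K" using K(1) by (simp add: linear_conv_bounded_linear)
  define \<psi> where "\<psi> y t = K (\<phi> (y, t))" for y t
  have "((\<lambda>y. \<psi> y t0) has_derivative (\<lambda>v. v)) (at y0)"
    using bounded_linear.has_derivative[OF bK L(1)] by (simp add: \<psi>_def K(2))
  then obtain d where d: "d > 0" "\<And>y. norm (y - y0) < d \<Longrightarrow> norm (\<psi> y t0 - \<psi> y0 t0 - (y - y0)) \<le> (1/4) * norm (y - y0)"
    unfolding has_derivative_at_alt by (metis zero_less_divide_1_iff zero_less_numeral)
  have t0: "t0 \<in> I" using y0 D openin_imp_subset by blast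
  obtain r where r: "r > 0" "\<And>y t. t \<in> I \<Longrightarrow> dist (y, t) (y0, t0) < r \<Longrightarrow> (y, t) \<in> D"
    using D y0 unfolding openin_euclidean_subtopology_iff by auto
  define \<rho> where "\<rho> = min d (min e r) / 2"
  have \<rho>: "0 < \<rho>" "\<rho> < d" "\<rho> < e" "\<rho> \<le> r / 2"
    using d(1) e r(1) by (auto simp: \<rho>_def min_def)
  have inD: "(y, t) \<in> D" if "t \<in> I" "y \<in> cball y0 \<rho>" "dist t t0 < r / 2" for y t
  proof (rule r(2)[OF that(1)])
    have "dist (y, t) (y0, t0) \<le> dist y y0 + dist t t0"
      unfolding dist_prod_def by (simp add: sqrt_sum_squares_le_sum)
    then show "dist (y, t) (y0, t0) < r" using that \<rho> by (simp add: dist_commute)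
  qed
  have "continuous_on ((I \<inter> ball t0 (r / 2)) \<times> cball y0 \<rho>) (\<lambda>(t, y). \<psi> y t)"
    unfolding \<psi>_def split_beta
    by (intro bounded_linear.continuous_on[OF bK] continuous_on_compose2[OF cont] continuous_intros)
      (auto intro!: inD simp: dist_commute)
  then obtain X where X: "t0 \<in> X" "open X"
    "\<forall>t\<in>X \<inter> (I \<inter> ball t0 (r / 2)). \<forall>y\<in>cball y0 \<rho>. dist (\<psi> y t) (\<psi> y t0) \<le> \<rho> / 4"
    by (rule continuous_on_prod_compactE[where ?x0.0=t0 and e="\<rho> / 4"])
      (use \<rho>(1) r(1) t0 in auto)
  obtain s where s: "s > 0" "ball t0 s \<subseteq> X" using X(1,2) openE by blast
  obtain b where b: "b > 0" "\<And>x. norm (K x) \<le> norm x * b" using bounded_linear.pos_bounded[OF bK] by blast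
  \<comment> \<open>Of the radius \<open>\<rho>\<close> a quarter each is spent on moving the
    target, with \<open>b\<close> bounding \<open>K\<close>, on the linearisation error and on the
    change of time.\<close>
  define \<delta> where "\<delta> = min (min s (r / 2)) (\<rho> / (4 * b))"
  have "\<delta> > 0" using s(1) r(1) \<rho>(1) b(1) by (simp add: \<delta>_def)
  moreover have "\<exists>y. dist y y0 < e \<and> (y, t) \<in> D \<and> \<phi> (y, t) = q"
    if t: "t \<in> I" "dist t t0 < \<delta>" and q: "dist q (\<phi> (y0, t0)) < \<delta>" for q t
  proof -
    have tI: "t \<in> X \<inter> (I \<inter> ball t0 (r / 2))" using t s(2) by (auto simp: \<delta>_def dist_commute)
    have "norm (K (q - \<phi> (y0, t0))) \<le> norm (q - \<phi> (y0, t0)) * b" by (rule b(2))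
    also have "\<dots> \<le> \<rho> / (4 * b) * b"
      using q b(1) by (intro mult_right_mono) (auto simp: \<delta>_def dist_norm)
    finally have Kq: "norm (K q - \<psi> y0 t0) \<le> \<rho> / 4"
      using b(1) by (simp add: \<psi>_def linear_diff[OF K(1)])
    have "\<exists>y\<in>cball y0 \<rho>. \<psi> y t = K q"
    \<comment> \<open>A solution is a fixed point of
      \<open>y \<mapsto> K q + (y - \<psi> y t)\<close>, which maps the ball into itself.\<close>
    proof (rule brouwer_surjective_cball[where S="{K q}"])
      show "continuous_on (cball y0 \<rho>) (\<lambda>y. \<psi> y t)"
        unfolding \<psi>_def using t tI
        by (intro bounded_linear.continuous_on[OF bK] continuous_on_compose2[OF cont] continuous_intros)
          (auto intro!: inD simp: \<delta>_def)
      fix x y assume x: "x \<in> {K q}" and y: "y \<in> cball y0 \<rho>"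
      have "norm (\<psi> y t0 - \<psi> y0 t0 - (y - y0)) \<le> (1/4) * norm (y - y0)"
        using y \<rho> by (intro d(2)) (simp add: dist_norm norm_minus_commute)
      also have "\<dots> \<le> \<rho> / 4" using y by (simp add: dist_norm norm_minus_commute)
      finally have 1: "norm (\<psi> y t0 - \<psi> y0 t0 - (y - y0)) \<le> \<rho> / 4" .
      have 2: "norm (\<psi> y t - \<psi> y t0) \<le> \<rho> / 4" using X(3) tI y by (simp add: dist_norm)
      have "x + (y - \<psi> y t) - y0 = (K q - \<psi> y0 t0) - (\<psi> y t0 - \<psi> y0 t0 - (y - y0)) - (\<psi> y t - \<psi> y t0)"
        using x by simp
      also have "norm \<dots> \<le> \<rho> / 4 + \<rho> / 4 + \<rho> / 4"
        using Kq 1 2 by (meson add_mono norm_triangle_ineq4 order_trans)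
      also have "\<dots> \<le> \<rho>" using \<rho>(1) by simp
      finally show "x + (y - \<psi> y t) \<in> cball y0 \<rho>" by (simp add: dist_norm norm_minus_commute)
    qed (use \<rho>(1) in auto)
    then obtain y where y: "y \<in> cball y0 \<rho>" "K (\<phi> (y, t)) = K q" by (auto simp: \<psi>_def)
    then have "\<phi> (y, t) = q" by (metis K(3))
    then show ?thesis using y(1) \<rho>(3) inD[OF t(1) y(1)] tI by (auto simp: dist_commute intro!: exI[of _ y])
  qed
  ultimately show ?thesis using that by blast
qed

text \<open>By openness, points near the image have preimages near \<open>(y0, t0)\<close>, where
  the composed function is already controlled. This transfers continuity along a parametrisation to
  the base.\<close>

lemma continuous_within_parametric:
  fixes \<phi> :: "'a::euclidean_space \<times> real \<Rightarrow> 'a" and h :: "'a \<Rightarrow> real \<Rightarrow> 'b::metric_space"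
  assumes "openin (top_of_set (UNIV \<times> I)) D" "continuous_on D \<phi>"
    and "(y0, t0) \<in> D" "((\<lambda>y. \<phi> (y, t0)) has_derivative L) (at y0)" "inj L"
    and h: "continuous (at (y0, t0) within D) (\<lambda>(y, t). h (\<phi> (y, t)) t)"
  shows "continuous (at (\<phi> (y0, t0), t0) within UNIV \<times> I) (\<lambda>(q, t). h q t)"
  unfolding continuous_within_eps_delta
proof (intro allI impI)
  fix e :: real assume "e > 0"
  then obtain d where d: "d > 0"
    "\<And>y t. (y, t) \<in> D \<Longrightarrow> dist (y, t) (y0, t0) < d \<Longrightarrow> dist (h (\<phi> (y, t)) t) (h (\<phi> (y0, t0)) t0) < e"
    using h unfolding continuous_within_eps_delta by fastforce
  obtain \<delta> where \<delta>: "\<delta> > 0"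
    "\<And>q t. t \<in> I \<Longrightarrow> dist q (\<phi> (y0, t0)) < \<delta> \<Longrightarrow> dist t t0 < \<delta> \<Longrightarrow> \<exists>y. dist y y0 < d / 2 \<and> (y, t) \<in> D \<and> \<phi> (y, t) = q"
    using parametric_open_mapping[OF assms(1-5), of "d / 2"] d(1) by (metis half_gt_zero)
  have "dist (h q t) (h (\<phi> (y0, t0)) t0) < e"
    if t: "t \<in> I" and near: "dist (q, t) (\<phi> (y0, t0), t0) < min \<delta> (d / 2)" for q t
  proof -
    have "dist q (\<phi> (y0, t0)) < min \<delta> (d / 2)" "dist t t0 < min \<delta> (d / 2)"
      using near dist_fst_le[of "(q, t)" "(\<phi> (y0, t0), t0)"] dist_snd_le[of "(q, t)" "(\<phi> (y0, t0), t0)"] by auto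
    then obtain y where y: "dist y y0 < d / 2" "(y, t) \<in> D" "\<phi> (y, t) = q" "dist t t0 < d / 2"
      using \<delta>(2)[OF t, of q] by auto
    have "dist (y, t) (y0, t0) \<le> dist y y0 + dist t t0"
      unfolding dist_prod_def by (simp add: sqrt_sum_squares_le_sum)
    then show ?thesis using d(2)[OF y(2)] y by simp
  qed
  then show "\<exists>d>0. \<forall>x'\<in>UNIV \<times> I. dist x' (\<phi> (y0, t0), t0) < d \<longrightarrow>
      dist (case x' of (q, t) \<Rightarrow> h q t) (case (\<phi> (y0, t0), t0) of (q, t) \<Rightarrow> h q t) < e"
    using \<delta>(1) d(1) by (intro exI[of _ "min \<delta> (d / 2)"]) auto
qed

lemma Cinf_on_derivativeE:
  assumes "Cinf_on f S"
  obtains E where "\<And>x. x \<in> S \<Longrightarrow> (f has_derivative E x) (at x within S)" "\<And>v. continuous_on S (\<lambda>x. E x v)"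
proof -
  have "Ck_on (Suc 0) f S" using assms unfolding Cinf_on_def by blast
  then show ?thesis using that by auto
qed

lemma at_within_Int_nhd: "x \<in> N \<Longrightarrow> open N \<Longrightarrow> at x within (S \<inter> N) = at x within S"
  by (rule at_within_nhd[of x N]) auto

lemma continuous_within_swap:
  fixes h :: "'a::metric_space \<Rightarrow> 'b::metric_space \<Rightarrow> 'c::metric_space"
  assumes "continuous (at (q, t) within Q \<times> I) (\<lambda>(q, t). h q t)"
  shows "continuous (at (t, q) within I \<times> Q) (\<lambda>(t, q). h q t)"
  unfolding continuous_within_eps_delta
proof (intro allI impI)
  fix e :: real assume "e > 0"
  then obtain d where d: "d > 0"
    "\<forall>x'\<in>Q \<times> I. dist x' (q, t) < d \<longrightarrow> dist (case x' of (q, t) \<Rightarrow> h q t) (h q t) < e"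
    using assms unfolding continuous_within_eps_delta by fastforce
  have "dist (h q' t') (h q t) < e" if "q' \<in> Q" "t' \<in> I" "dist (t', q') (t, q) < d" for q' t'
    using d(2)[rule_format, of "(q', t')"] that by (simp add: dist_Pair_Pair add.commute)
  then show "\<exists>d>0. \<forall>x'\<in>I \<times> Q. dist x' (t, q) < d \<longrightarrow>
      dist (case x' of (t, q) \<Rightarrow> h q t) (case (t, q) of (t, q) \<Rightarrow> h q t) < e"
    using d(1) by auto
qed

section \<open>The time interval\<close>

lemma time_interval_convex: "convex (time_interval T)"
  unfolding time_interval_def is_interval_convex_1[symmetric] is_interval_1
  by (auto intro: le_less_trans[of "ereal _" "ereal _"])

lemma time_interval_Icc: "t \<in> time_interval T \<Longrightarrow> {0..t} \<subseteq> time_interval T"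
  unfolding time_interval_def by (auto intro: le_less_trans[of "ereal _" "ereal _"])

lemma time_interval_later: "t \<in> time_interval T \<Longrightarrow> \<exists>b\<in>time_interval T. t < b"
  unfolding time_interval_def using ereal_dense2[of "ereal t" T] by fastforce

lemma time_interval_not_bot: "t \<in> time_interval T \<Longrightarrow> at t within time_interval T \<noteq> bot"
proof -
  assume t: "t \<in> time_interval T"
  then obtain b where b: "b \<in> time_interval T" "t < b" using time_interval_later by blast
  have "at t within {t..b} \<noteq> bot" using b(2) by (simp add: trivial_limit_within islimpt_Icc)
  moreover have "{t..b} \<subseteq> {0..b}" using t by (auto simp: time_interval_def)
  then have "{t..b} \<subseteq> time_interval T" using time_interval_Icc[OF b(1)] by (rule order_trans)
  ultimately show ?thesis by (metis at_le bot.extremum_uniqueI)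
qed

text \<open>A family of graphs of maps \<open>a t\<close>, parametrised in local coordinates by \<open>Fl (\<cdot>, t)\<close>.\<close>

locale graph_family =
  fixes T :: ereal and D :: "((real^'n::finite) \<times> real) set" and Fl :: "(real^'n) \<times> real \<Rightarrow> 'n phase"
    and U :: "(real^'n) set" and a :: "real \<Rightarrow> real^'n \<Rightarrow> real^'n"
  assumes open_D: "openin (top_of_set (UNIV \<times> time_interval T)) D" and smooth_Fl: "Cinf_on Fl D"
    and open_U: "open U" and smooth_a: "\<And>t. t \<in> time_interval T \<Longrightarrow> Cinf_on (a t) U"
    and in_U: "\<And>y t. (y, t) \<in> D \<Longrightarrow> fst (Fl (y, t)) \<in> U"
    and graph: "\<And>y t. (y, t) \<in> D \<Longrightarrow> snd (Fl (y, t)) = a t (fst (Fl (y, t)))"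
    and inj: "\<And>y t. (y, t) \<in> D \<Longrightarrow> inj (fderiv (\<lambda>y. Fl (y, t)) y)"
begin

abbreviation "I \<equiv> time_interval T"

abbreviation "\<phi> z \<equiv> fst (Fl z)"

lemma D_time: "(y, t) \<in> D \<Longrightarrow> t \<in> I"
  using open_D openin_imp_subset by blast

lemma cont_Fl: "continuous_on D Fl" by (rule Cinf_on_imp_continuous_on[OF smooth_Fl])

lemma open_slice: "open {y. (y, t) \<in> D}"
proof (cases "t \<in> I")
  case True
  obtain O' where O': "open O'" "D = (UNIV \<times> I) \<inter> O'" using open_D openin_open by metis
  have "{y. (y, t) \<in> D} = (\<lambda>y. (y, t)) -` O'" using O' True by auto
  then show ?thesis using O'(1) by (simp add: open_vimage continuous_on_Pair)
next
  case False
  then have "{y. (y, t) \<in> D} = {}" using D_time by blast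
  then show ?thesis by (metis open_empty)
qed

lemma slice_derivative:
  assumes "(y, t) \<in> D"
  shows "((\<lambda>y. Fl (y, t)) has_derivative fderiv (\<lambda>y. Fl (y, t)) y) (at y)"
  using Cinf_on_has_derivative[OF open_slice Cinf_on_slice[OF smooth_Fl]] assms by blast

lemma has_derivative_a: "t \<in> I \<Longrightarrow> q \<in> U \<Longrightarrow> (a t has_derivative fderiv (a t) q) (at q)"
  by (rule Cinf_on_has_derivative[OF open_U smooth_a])

section \<open>Derivatives of a family of graphs\<close>

lemma snd_slice:
  assumes D: "(y, t) \<in> D"
  shows "snd (fderiv (\<lambda>y. Fl (y, t)) y v) = fderiv (a t) (\<phi> (y, t)) (fst (fderiv (\<lambda>y. Fl (y, t)) y v))"
proof -
  let ?E = "fderiv (\<lambda>y. Fl (y, t)) y"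
  have 1: "((\<lambda>y. \<phi> (y, t)) has_derivative (\<lambda>v. fst (?E v))) (at y)"
    "((\<lambda>y. snd (Fl (y, t))) has_derivative (\<lambda>v. snd (?E v))) (at y)"
    using slice_derivative[OF D] by (auto intro: has_derivative_fst has_derivative_snd)
  have "((\<lambda>y. a t (\<phi> (y, t))) has_derivative (\<lambda>v. fderiv (a t) (\<phi> (y, t)) (fst (?E v)))) (at y)"
    by (rule has_derivative_compose[OF 1(1) has_derivative_a[OF D_time[OF D] in_U[OF D]]])
  then have "((\<lambda>y. snd (Fl (y, t))) has_derivative (\<lambda>v. fderiv (a t) (\<phi> (y, t)) (fst (?E v)))) (at y)"
    by (rule has_derivative_transform_within_open[OF _ open_slice[of t]]) (use D graph in auto)
  from fun_cong[OF has_derivative_unique[OF 1(2) this]] show ?thesis .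
qed

text \<open>A tangent vector of a graph is determined by its base part, so the immersion property
  passes to the base point map.\<close>

lemma inj_slice: "(y, t) \<in> D \<Longrightarrow> inj (\<lambda>v. fst (fderiv (\<lambda>y. Fl (y, t)) y v))"
proof (rule injI)
  assume D: "(y, t) \<in> D"
  fix u v assume eq: "fst (fderiv (\<lambda>y. Fl (y, t)) y u) = fst (fderiv (\<lambda>y. Fl (y, t)) y v)"
  then have "fderiv (\<lambda>y. Fl (y, t)) y u = fderiv (\<lambda>y. Fl (y, t)) y v"
    by (intro prod_eqI) (simp_all add: snd_slice[OF D])
  then show "u = v" by (rule injD[OF inj[OF D]])
qed

lemma continuous_base:
  fixes h :: "real^'n \<Rightarrow> real \<Rightarrow> 'b::metric_space"
  assumes "(y, t) \<in> D" and "continuous_on D (\<lambda>(y, t). h (\<phi> (y, t)) t)"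
  shows "continuous (at (\<phi> (y, t), t) within UNIV \<times> I) (\<lambda>(q, t). h q t)"
proof (rule continuous_within_parametric[OF open_D continuous_on_fst[OF cont_Fl] assms(1)
      has_derivative_fst[OF slice_derivative[OF assms(1)]] inj_slice[OF assms(1)]])
  show "continuous (at (y, t) within D) (\<lambda>(y, t). h (\<phi> (y, t)) t)"
    using assms by (simp add: continuous_on_eq_continuous_within)
qed

lemma continuous_a:
  assumes "(y, t) \<in> D"
  shows "continuous (at (\<phi> (y, t), t) within UNIV \<times> I) (\<lambda>(q, t). a t q)"
proof (rule continuous_base[OF assms])
  have "continuous_on D (\<lambda>z. snd (Fl z))" using cont_Fl by (rule continuous_on_snd)
  then show "continuous_on D (\<lambda>(y, t). a t (\<phi> (y, t)))"
    by (rule continuous_on_eq) (auto simp: graph)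
qed

lemma slice_derivative_continuous: "continuous_on D (\<lambda>(y, t). fderiv (\<lambda>y. Fl (y, t)) y v)"
proof -
  obtain E where E: "\<And>x. x \<in> D \<Longrightarrow> (Fl has_derivative E x) (at x within D)" "\<And>v. continuous_on D (\<lambda>x. E x v)"
    using smooth_Fl by (rule Cinf_on_derivativeE) (rule that)
  have "fderiv (\<lambda>y. Fl (y, t)) y v = E (y, t) (v, 0)" if D: "(y, t) \<in> D" for y t
  proof -
    have "((\<lambda>y. (y, t)) has_derivative (\<lambda>v. (v, 0))) (at y within {y. (y, t) \<in> D})"
      by (auto intro!: derivative_eq_intros)
    from has_derivative_in_compose[OF this, of Fl "E (y, t)"]
    have "((\<lambda>y. Fl (y, t)) has_derivative (\<lambda>v. E (y, t) (v, 0))) (at y within {y. (y, t) \<in> D})"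
      using has_derivative_subset[OF E(1)[OF D]] by (simp add: image_Collect_subsetI)
    then have "((\<lambda>y. Fl (y, t)) has_derivative (\<lambda>v. E (y, t) (v, 0))) (at y)"
      using at_within_open[OF _ open_slice, of y t] D by simp
    then show ?thesis by (simp add: fderiv_eq)
  qed
  then show ?thesis
    by (intro continuous_on_eq[OF E(2)[of "(v, 0)"]]) auto
qed

text \<open>The chain rule \<open>snd_slice\<close> is a linear system for the derivative of
  \<open>a t\<close>, with the matrix \<open>M\<close> of the base point map as coefficients. As
  \<open>M\<close> is invertible, its solution is continuous in (y, t).\<close>

lemma fderiv_a_continuous_on: "continuous_on D (\<lambda>(y, t). fderiv (a t) (\<phi> (y, t)) v)"
proof -
  define E where "E z i = fderiv (\<lambda>y. Fl (y, snd z)) (fst z) (axis i 1)" for z and i :: 'n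
  have E: "continuous_on D (\<lambda>z. E z i)" for i
    using slice_derivative_continuous[of "axis i 1"] by (simp add: E_def split_beta)
  define M :: "(real^'n) \<times> real \<Rightarrow> real^'n^'n" where "M z = (\<chi> k i. fst (E z i) $ k)" for z
  have M: "continuous_on D (\<lambda>z. M z $ k $ i)" for k i
    by (simp add: M_def) (intro continuous_intros E)
  have lin: "linear (\<lambda>v. fst (fderiv (\<lambda>y. Fl (y, t)) y v))" if "(y, t) \<in> D" for y t
    using has_derivative_linear[OF has_derivative_fst[OF slice_derivative[OF that]]] .
  have Mv: "M (y, t) *v c = fst (fderiv (\<lambda>y. Fl (y, t)) y c)" if D: "(y, t) \<in> D" for y t c
    using linear_axis_expansion[OF lin[OF D], of c]
    by (simp add: M_def E_def vec_eq_iff matrix_vector_mult_def mult.commute)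
  have dM: "det (M z) \<noteq> 0" if zD: "z \<in> D" for z
  proof -
    obtain y t where z: "z = (y, t)" "(y, t) \<in> D" using zD by (rule that[OF prod.collapse[symmetric], unfolded prod.collapse])
    have "inj ((*v) (M z))" using inj_slice[OF z(2)] Mv[OF z(2)] by (simp add: z(1) inj_on_def)
    then show ?thesis using det_nz_iff_inj[of "(*v) (M z)"] by simp
  qed
  have "continuous_on D (\<lambda>z. \<Sum>i\<in>UNIV. (matrix_inv (M z) *v v) $ i *\<^sub>R snd (E z i))"
    unfolding matrix_vector_mult_def
    by (simp, intro continuous_intros E continuous_on_matrix_inv M dM)
  moreover have "(\<Sum>i\<in>UNIV. (matrix_inv (M (y, t)) *v v) $ i *\<^sub>R snd (E (y, t) i)) = fderiv (a t) (\<phi> (y, t)) v"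
    if D: "(y, t) \<in> D" for y t
  proof -
    define c where "c = matrix_inv (M (y, t)) *v v"
    have c: "M (y, t) *v c = v"
      using matrix_inv_field[OF dM[OF D]] by (simp add: c_def matrix_vector_mul_assoc)
    have "linear (\<lambda>v. snd (fderiv (\<lambda>y. Fl (y, t)) y v))"
      using has_derivative_linear[OF has_derivative_snd[OF slice_derivative[OF D]]] .
    from linear_axis_expansion[OF this, of c]
    have "snd (fderiv (\<lambda>y. Fl (y, t)) y c) = (\<Sum>i\<in>UNIV. c $ i *\<^sub>R snd (E (y, t) i))"
      by (simp add: E_def)
    then show ?thesis using snd_slice[OF D, of c] c Mv[OF D, of c] by (simp add: c_def)
  qed
  ultimately show ?thesis by (elim continuous_on_eq) auto
qed

lemma continuous_fderiv_a:
  "(y, t) \<in> D \<Longrightarrow> continuous (at (\<phi> (y, t), t) within UNIV \<times> I) (\<lambda>(q, t). fderiv (a t) q v)"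
  by (rule continuous_base[OF _ fderiv_a_continuous_on])

text \<open>Freezing the base point: \<open>a \<tau> q = a \<tau> (\<phi> (y, \<tau>)) - (a \<tau> (\<phi> (y, \<tau>)) - a \<tau> q)\<close> with
  \<open>q = \<phi> (y, t)\<close>, where the first term is a component of the parametrisation and the second one is
  differentiated by the chain rule.\<close>

lemma time_derivative:
  assumes D: "(y, t) \<in> D" and H: "((\<lambda>\<tau>. Fl (y, \<tau>)) has_vector_derivative H) (at t within I)"
  shows "((\<lambda>\<tau>. a \<tau> (\<phi> (y, t))) has_vector_derivative snd H - fderiv (a t) (\<phi> (y, t)) (fst H)) (at t within I)"
proof -
  define q where "q = \<phi> (y, t)"
  have t: "t \<in> I" using D_time[OF D] .
  have q: "q \<in> U" using in_U[OF D] by (simp add: q_def)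
  obtain r where r: "r > 0" "ball q r \<subseteq> U" using open_U q openE by blast
  have bl: "bounded_linear (fderiv (a \<tau>) x)" if "\<tau> \<in> I" "x \<in> U" for \<tau> x
    using has_derivative_bounded_linear[OF has_derivative_a[OF that]] .
  have cont: "continuous (at (t, q) within I \<times> ball q r) (\<lambda>(\<tau>, x). Blinfun (fderiv (a \<tau>) x))"
  proof (rule continuous_blinfun_componentwiseI1)
    fix v :: "real^'n"
    have "continuous (at (t, q) within I \<times> UNIV) (\<lambda>(\<tau>, x). fderiv (a \<tau>) x v)"
      using continuous_fderiv_a[OF D, of v] unfolding q_def by (rule continuous_within_swap)
    then have "continuous (at (t, q) within I \<times> ball q r) (\<lambda>(\<tau>, x). fderiv (a \<tau>) x v)"
      by (rule continuous_within_subset) auto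
    moreover have "fderiv (a \<tau>) x v = blinfun_apply (Blinfun (fderiv (a \<tau>) x)) v" if "\<tau> \<in> I" "x \<in> ball q r" for \<tau> x
      using that r(2) bl[of \<tau> x] by (auto simp: bounded_linear_Blinfun_apply)
    ultimately show "continuous (at (t, q) within I \<times> ball q r)
        (\<lambda>x. blinfun_apply (case x of (\<tau>, x) \<Rightarrow> Blinfun (fderiv (a \<tau>) x)) v)"
      using t r(1) by (elim continuous_transform_within[OF _ zero_less_one]) auto
  qed
  \<comment> \<open>At \<open>x = q\<close> the function vanishes for every \<open>\<tau>\<close>,
    so its partial derivative in time there is 0; differentiability of \<open>a\<close> in time,
    which is the goal, is not presupposed.\<close>
  have K: "((\<lambda>(\<tau>, x). a \<tau> x - a \<tau> q) has_derivative (\<lambda>(s, u). 0 + blinfun_apply (Blinfun (fderiv (a t) q)) u)) (at (t, q) within I \<times> ball q r)"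
  proof (rule has_derivative_partialsI[OF _ _ cont])
    fix \<tau> x assume "\<tau> \<in> I" "x \<in> ball q r"
    then have "\<tau> \<in> I" "x \<in> U" using r(2) by auto
    then have "(a \<tau> has_derivative blinfun_apply (Blinfun (fderiv (a \<tau>) x))) (at x within ball q r)"
      using has_derivative_at_withinI[OF has_derivative_a] by (simp add: bounded_linear_Blinfun_apply[OF bl])
    from has_derivative_diff[OF this has_derivative_const]
    show "((\<lambda>x. a \<tau> x - a \<tau> q) has_derivative blinfun_apply (Blinfun (fderiv (a \<tau>) x))) (at x within ball q r)"
      by simp
  qed (use r in auto)
  have phi: "((\<lambda>\<tau>. \<phi> (y, \<tau>)) has_derivative (\<lambda>s. s *\<^sub>R fst H)) (at t within I)"
    using has_derivative_fst[OF H[unfolded has_vector_derivative_def]] by simp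
  have ev: "\<forall>\<^sub>F \<tau> in at t within I. \<phi> (y, \<tau>) \<in> ball q r"
    using has_derivative_continuous[OF phi] r(1)
    unfolding continuous_within tendsto_iff q_def[symmetric] by (simp add: dist_commute)
  then obtain d where d: "d > 0" "\<And>\<tau>. \<tau> \<in> I \<Longrightarrow> dist \<tau> t < d \<Longrightarrow> \<phi> (y, \<tau>) \<in> ball q r"
    unfolding eventually_at using r(1) q_def by (metis centre_in_ball)
  \<comment> \<open>Times are restricted to \<open>ball t d\<close>, so that the base point stays in
    the ball on which \<open>K\<close> holds.\<close>
  have "((\<lambda>\<tau>. (\<tau>, \<phi> (y, \<tau>))) has_derivative (\<lambda>s. (s, s *\<^sub>R fst H))) (at t within I \<inter> ball t d)"
    by (intro has_derivative_Pair has_derivative_ident has_derivative_subset[OF phi]) auto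
  moreover have "((\<lambda>(\<tau>, x). a \<tau> x - a \<tau> q) has_derivative (\<lambda>(s, u). fderiv (a t) q u))
      (at (t, \<phi> (y, t)) within (\<lambda>\<tau>. (\<tau>, \<phi> (y, \<tau>))) ` (I \<inter> ball t d))"
    unfolding q_def[symmetric]
    by (rule has_derivative_subset[OF K[unfolded bounded_linear_Blinfun_apply[OF bl[OF t q]] add_0_left]])
      (use d(2) in \<open>auto simp: dist_commute\<close>)
  ultimately have "((\<lambda>\<tau>. a \<tau> (\<phi> (y, \<tau>)) - a \<tau> q) has_derivative (\<lambda>s. fderiv (a t) q (s *\<^sub>R fst H))) (at t within I \<inter> ball t d)"
    by (auto dest: has_derivative_in_compose)
  then have 1: "((\<lambda>\<tau>. a \<tau> (\<phi> (y, \<tau>)) - a \<tau> q) has_derivative (\<lambda>s. fderiv (a t) q (s *\<^sub>R fst H))) (at t within I)"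
    using at_within_Int_nhd[of t "ball t d" I] d(1) by simp
  obtain e where e: "e > 0" "\<And>\<tau>. \<tau> \<in> I \<Longrightarrow> dist \<tau> t < e \<Longrightarrow> (y, \<tau>) \<in> D"
  proof -
    obtain e where "e > 0" "\<forall>x\<in>UNIV \<times> I. dist x (y, t) < e \<longrightarrow> x \<in> D"
      using open_D D unfolding openin_euclidean_subtopology_iff by blast
    then show ?thesis using that[of e] by (auto simp: dist_Pair_Pair)
  qed
  have "((\<lambda>\<tau>. snd (Fl (y, \<tau>))) has_derivative (\<lambda>s. s *\<^sub>R snd H)) (at t within I)"
    using has_derivative_snd[OF H[unfolded has_vector_derivative_def]] by simp
  then have "((\<lambda>\<tau>. snd (Fl (y, \<tau>)) - (a \<tau> (\<phi> (y, \<tau>)) - a \<tau> q)) has_derivative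
      (\<lambda>s. s *\<^sub>R snd H - fderiv (a t) q (s *\<^sub>R fst H))) (at t within I)"
    using 1 by (rule has_derivative_diff)
  then have "((\<lambda>\<tau>. a \<tau> q) has_derivative (\<lambda>s. s *\<^sub>R snd H - fderiv (a t) q (s *\<^sub>R fst H))) (at t within I)"
    by (rule has_derivative_transform_within[OF _ e(1) t]) (use e(2) graph in auto)
  then show ?thesis
    using linear_cmul[OF bounded_linear.linear[OF bl[OF t q]]]
    by (simp add: has_vector_derivative_def q_def scaleR_diff_right)
qed

text \<open>Uniqueness of the derivative forces \<open>b\<close> to be the expression found in
  \<open>time_derivative\<close>, whose terms are continuous on \<open>D\<close>. In the application
  \<open>b\<close> is the differential of the angle.\<close>

lemma continuous_time_derivative:
  assumes D: "(y, t) \<in> D"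
    and b: "\<And>q t. q \<in> U \<Longrightarrow> t \<in> I \<Longrightarrow> ((\<lambda>\<tau>. a \<tau> q) has_vector_derivative b q t) (at t within I)"
  shows "continuous (at (\<phi> (y, t), t) within UNIV \<times> I) (\<lambda>(q, t). b q t)"
proof (rule continuous_base[OF D])
  obtain E where E: "\<And>x. x \<in> D \<Longrightarrow> (Fl has_derivative E x) (at x within D)" "\<And>v. continuous_on D (\<lambda>x. E x v)"
    using smooth_Fl by (rule Cinf_on_derivativeE) (rule that)
  define H where "H z = E z (0, 1)" for z
  have H: "((\<lambda>\<tau>. Fl (y, \<tau>)) has_vector_derivative H (y, t)) (at t within I)" if D: "(y, t) \<in> D" for y t
  proof -
    obtain O' where O': "open O'" "D = (UNIV \<times> I) \<inter> O'" using open_D openin_open by metis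
    have J: "open ((\<lambda>\<tau>. (y, \<tau>)) -` O')" using O'(1) by (simp add: open_vimage continuous_on_Pair)
    have sub: "Pair y ` ((\<lambda>\<tau>. (y, \<tau>)) -` O' \<inter> I) \<subseteq> D" using O'(2) by auto
    have "((\<lambda>\<tau>. (y, \<tau>)) has_derivative (\<lambda>s. (0, s))) (at t within (\<lambda>\<tau>. (y, \<tau>)) -` O' \<inter> I)"
      by (auto intro!: derivative_eq_intros)
    from has_derivative_in_compose[OF this has_derivative_subset[OF E(1)[OF D] sub]]
    have "((\<lambda>\<tau>. Fl (y, \<tau>)) has_derivative (\<lambda>s. E (y, t) (0, s))) (at t within I)"
      using at_within_Int_nhd[OF _ J, of t I] D O'(2) by (simp add: Int_commute)
    moreover have "E (y, t) (0, s) = s *\<^sub>R H (y, t)" for s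
      using linear_cmul[OF has_derivative_linear[OF E(1)[OF D]], of s "(0, 1)"] by (simp add: H_def)
    ultimately show ?thesis by (simp add: has_vector_derivative_def)
  qed
  have "continuous_on D (\<lambda>z. snd (H z) - (\<Sum>i\<in>UNIV. fst (H z) $ i *\<^sub>R fderiv (a (snd z)) (\<phi> z) (axis i 1)))"
    using fderiv_a_continuous_on unfolding H_def split_beta prod.collapse by (intro continuous_intros E(2))
  moreover have "snd (H (y, t)) - (\<Sum>i\<in>UNIV. fst (H (y, t)) $ i *\<^sub>R fderiv (a t) (\<phi> (y, t)) (axis i 1)) = b (\<phi> (y, t)) t"
    if D: "(y, t) \<in> D" for y t
  proof -
    have "linear (fderiv (a t) (\<phi> (y, t)))"
      using has_derivative_linear[OF has_derivative_a[OF D_time[OF D] in_U[OF D]]] .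
    then have "snd (H (y, t)) - (\<Sum>i\<in>UNIV. fst (H (y, t)) $ i *\<^sub>R fderiv (a t) (\<phi> (y, t)) (axis i 1))
        = snd (H (y, t)) - fderiv (a t) (\<phi> (y, t)) (fst (H (y, t)))"
      by (simp add: linear_axis_expansion[of "fderiv (a t) (\<phi> (y, t))" "fst (H (y, t))"])
    also have "\<dots> = b (\<phi> (y, t)) t"
      by (rule vector_derivative_unique_within[OF time_interval_not_bot[OF D_time[OF D]]
          time_derivative[OF D H[OF D]] b[OF in_U[OF D] D_time[OF D]]])
    finally show ?thesis .
  qed
  ultimately show "continuous_on D (\<lambda>(y, t). b (\<phi> (y, t)) t)"
    by (elim continuous_on_eq) auto
qed

end

section \<open>Lifting the phase to an angle\<close>

lemma exp_ii_eq_imp: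
  assumes "exp (\<i> * complex_of_real a) = exp (\<i> * complex_of_real b)" "\<bar>a - b\<bar> < 2 * pi"
  shows "a = b"
proof -
  have "exp (\<i> * complex_of_real (a - b)) = 1"
    using assms(1) by (simp add: right_diff_distrib exp_diff)
  then obtain n :: int where n: "a - b = of_int (2 * n) * pi"
    unfolding exp_eq_1 by auto
  have "\<bar>of_int (2 * n) * pi\<bar> < 2 * pi" using assms(2) n by metis
  then have "\<bar>real_of_int n\<bar> < 1" by (simp add: abs_mult)
  then have "n = 0" by linarith
  then show ?thesis using n by simp
qed

lemma osc_bounds:
  assumes "osc f < ereal c"
  obtains l r where "\<And>x. l \<le> f x" "\<And>x. f x \<le> r" "r - l < c"
proof -
  have le: "(INF x. ereal (f x)) \<le> ereal (f x)" "ereal (f x) \<le> (SUP x. ereal (f x))" for x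
    by (auto intro: INF_lower SUP_upper)
  show ?thesis
  proof (cases "(SUP x. ereal (f x))"; cases "(INF x. ereal (f x))")
    fix r l assume rl: "(SUP x. ereal (f x)) = ereal r" "(INF x. ereal (f x)) = ereal l"
    show ?thesis
      by (rule that[of l r]) (use le assms rl in \<open>auto simp: osc_def\<close>)
  \<comment> \<open>An infinite supremum or infimum would make the oscillation infinite.\<close>
  qed (use le[of undefined] assms in \<open>auto simp: osc_def\<close>)
qed

text \<open>The values lie in a compact interval shorter than a full turn. There s |-> exp(i s) is
  injective, hence a homeomorphism onto its image, so the angle is a continuous function of the
  phase.\<close>

lemma continuous_angle_of_osc:
  fixes f :: "'a::topological_space \<Rightarrow> real"
  assumes "osc f < ereal (2 * pi)" and "continuous_on UNIV (\<lambda>x. exp (\<i> * complex_of_real (f x)))"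
  shows "continuous_on UNIV f"
proof -
  obtain l r where lr: "\<And>x. l \<le> f x" "\<And>x. f x \<le> r" "r - l < 2 * pi"
    using osc_bounds[OF assms(1)] by metis
  let ?e = "\<lambda>s. exp (\<i> * complex_of_real s)"
  have "inj_on ?e {l..r}"
    using lr(3) by (intro inj_onI exp_ii_eq_imp) (auto simp: abs_if)
  moreover have "continuous_on {l..r} ?e" by (intro continuous_intros)
  ultimately obtain h where h: "homeomorphism {l..r} (?e ` {l..r}) ?e h"
    using homeomorphism_compact[of "{l..r}" ?e] by blast
  have "continuous_on UNIV (\<lambda>x. h (?e (f x)))"
    using homeomorphism_cont2[OF h] assms(2)
    by (rule continuous_on_compose2) (use lr in auto)
  moreover have "h (?e (f x)) = f x" for x
    using homeomorphism_apply1[OF h, of "f x"] lr by auto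
  ultimately show ?thesis by simp
qed

lemma angle_path_lift:
  assumes "0 < T" and "continuous_on (time_interval T) p" "\<And>t. t \<in> time_interval T \<Longrightarrow> cmod (p t) = 1"
    and "exp (\<i> * complex_of_real a) = p 0"
  obtains f where "continuous_on (time_interval T) f" "f 0 = a"
    "\<And>t. t \<in> time_interval T \<Longrightarrow> exp (\<i> * complex_of_real (f t)) = p t"
proof -
  have "\<And>t. t \<in> time_interval T \<Longrightarrow> p t \<noteq> 0" using assms(3) by force
  then obtain g where g: "continuous_on (time_interval T) g" "\<And>t. t \<in> time_interval T \<Longrightarrow> p t = exp (g t)"
    using continuous_logarithm_on_contractible[OF assms(2) convex_imp_contractible[OF time_interval_convex]] by blast
  have eg: "exp (\<i> * complex_of_real (Im (g t))) = p t" if "t \<in> time_interval T" for t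
  proof -
    have "Re (g t) = 0" using assms(3)[OF that] g(2)[OF that] by simp
    then have "g t = \<i> * complex_of_real (Im (g t))" by (simp add: complex_eq_iff)
    then show ?thesis using g(2)[OF that] by simp
  qed
  have 0: "0 \<in> time_interval T" using assms(1) by (simp add: time_interval_def zero_ereal_def)
  show ?thesis
  \<comment> \<open>The shift \<open>a - Im (g 0)\<close> is a multiple of 2 pi, as both numbers are
    angles of \<open>p 0\<close>.\<close>
  proof (rule that[of "\<lambda>t. Im (g t) + (a - Im (g 0))"])
    show "continuous_on (time_interval T) (\<lambda>t. Im (g t) + (a - Im (g 0)))"
      by (intro continuous_intros g)
    show "exp (\<i> * complex_of_real (Im (g t) + (a - Im (g 0)))) = p t" if "t \<in> time_interval T" for t
      using eg[OF that] eg[OF 0] assms(3)[OF 0] assms(4)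
      by (simp add: distrib_left right_diff_distrib exp_add exp_diff) force
  qed simp
qed

text \<open>Near \<open>x0\<close> and up to a fixed time, the lifts along the paths at \<open>x\<close> and \<open>x0\<close> differ by the
  principal argument of the quotient of the two phases.\<close>

lemma angle_homotopy_lift:
  fixes p :: "'x::t2_space \<Rightarrow> real \<Rightarrow> complex"
  assumes T: "0 < T" and cont: "continuous_on (UNIV \<times> time_interval T) (\<lambda>(x, t). p x t)"
    and norm: "\<And>x t. t \<in> time_interval T \<Longrightarrow> cmod (p x t) = 1"
    and cont0: "continuous_on UNIV \<theta>0" and init: "\<And>x. exp (\<i> * complex_of_real (\<theta>0 x)) = p x 0"
  obtains \<theta> where "\<theta> 0 = \<theta>0" "continuous_on (UNIV \<times> time_interval T) (\<lambda>(x, t). \<theta> t x)"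
    "\<And>x t. t \<in> time_interval T \<Longrightarrow> exp (\<i> * complex_of_real (\<theta> t x)) = p x t"
proof -
  let ?I = "time_interval T"
  have zero: "0 \<in> ?I" using T by (simp add: time_interval_def zero_ereal_def)
  \<comment> \<open>One lift for each \<open>x\<close>; their joint continuity is what remains to be
    shown.\<close>
  have "\<exists>f. continuous_on ?I f \<and> f 0 = \<theta>0 x \<and> (\<forall>t\<in>?I. exp (\<i> * complex_of_real (f t)) = p x t)" for x
  proof -
    have "continuous_on ?I (\<lambda>t. case (x, t) of (x, t) \<Rightarrow> p x t)"
      by (rule continuous_on_compose2[OF cont]) (auto intro!: continuous_on_Pair continuous_on_const continuous_on_id)
    then have "continuous_on ?I (p x)" by simp
    from angle_path_lift[OF T this norm init] show ?thesis by metis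
  qed
  then obtain f where f: "\<And>x. continuous_on ?I (f x)" "\<And>x. f x 0 = \<theta>0 x"
    "\<And>x t. t \<in> ?I \<Longrightarrow> exp (\<i> * complex_of_real (f x t)) = p x t" by metis
  have local: "\<exists>W. open W \<and> (x0, t0) \<in> W \<and> continuous_on ((UNIV \<times> ?I) \<inter> W) (\<lambda>(x, t). f x t)"
    if t0: "t0 \<in> ?I" for x0 t0
  proof -
    obtain b where b: "b \<in> ?I" "t0 < b" using time_interval_later[OF t0] by blast
    have sub: "{0..b} \<subseteq> ?I" by (rule time_interval_Icc[OF b(1)])
    have "continuous_on (UNIV \<times> {0..b}) (\<lambda>(x, t). p x t)"
      using sub by (intro continuous_on_subset[OF cont]) auto
    \<comment> \<open>Unit phases within 1/2 of each other have a quotient with positive real part,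
      away from the cut of the logarithm.\<close>
    then obtain X where X: "x0 \<in> X" "open X" "\<forall>x\<in>X \<inter> UNIV. \<forall>t\<in>{0..b}. dist (p x t) (p x0 t) \<le> 1 / 2"
      by (rule continuous_on_prod_compactE[where ?x0.0=x0 and e="1 / 2"]) auto
    have "isCont \<theta>0 x0" using cont0 by (simp add: continuous_on_eq_continuous_at)
    then have "\<forall>\<^sub>F x in nhds x0. dist (\<theta>0 x) (\<theta>0 x0) < pi"
      unfolding isCont_def tendsto_iff eventually_at_filter
      by (auto elim!: allE[of _ pi] eventually_mono)
    then obtain Y where Y: "x0 \<in> Y" "open Y" "\<And>x. x \<in> Y \<Longrightarrow> dist (\<theta>0 x) (\<theta>0 x0) < pi"
      unfolding eventually_nhds by auto
    define Q where "Q x t = p x t / p x0 t" for x t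
    have Q: "cmod (Q x t) = 1" "Re (Q x t) > 0" if "x \<in> X" "t \<in> {0..b}" for x t
    proof -
      have n: "cmod (p x t) = 1" "cmod (p x0 t) = 1" using that sub norm by auto
      then show "cmod (Q x t) = 1" by (simp add: Q_def norm_divide)
      have nz: "p x0 t \<noteq> 0" using n by force
      have "cmod (1 - Q x t) = cmod ((p x0 t - p x t) / p x0 t)"
        using nz by (simp add: Q_def diff_divide_distrib)
      also have "\<dots> \<le> 1 / 2" using X(3) that n by (simp add: norm_divide dist_norm norm_minus_commute[of "p x0 t" "p x t"])
      finally show "Re (Q x t) > 0" using complex_Re_le_cmod[of "1 - Q x t"] by simp
    qed
    define A where "A x t = Im (Ln (Q x t))" for x t
    have A: "exp (\<i> * complex_of_real (A x t)) = Q x t" "\<bar>A x t\<bar> < pi / 2" if "x \<in> X" "t \<in> {0..b}" for x t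
    proof -
      have nz: "Q x t \<noteq> 0" using Q(1)[OF that] by force
      then have "Re (Ln (Q x t)) = 0" using Q(1)[OF that] by simp
      then have "Ln (Q x t) = \<i> * complex_of_real (A x t)" by (simp add: complex_eq_iff A_def)
      then show "exp (\<i> * complex_of_real (A x t)) = Q x t" using exp_Ln[OF nz] by simp
      show "\<bar>A x t\<bar> < pi / 2" using Re_Ln_pos_lt[OF nz] Q(2)[OF that] by (simp add: A_def)
    qed
    have contA: "continuous_on (X \<times> {0..b}) (\<lambda>(x, t). A x t)"
    proof -
      have "continuous_on (X \<times> {0..b}) (\<lambda>z. p (fst z) (snd z))"
        using sub cont by (intro continuous_on_subset[OF cont[unfolded split_beta]]) auto
      moreover have "continuous_on (X \<times> {0..b}) (\<lambda>z. p x0 (snd z))"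
        using sub by (intro continuous_on_compose2[OF cont[unfolded split_beta], where f="\<lambda>z. (x0, snd z)", simplified]
            continuous_intros) auto
      moreover have nz: "p x0 t \<noteq> 0" if "t \<in> {0..b}" for t
      proof -
        have "cmod (p x0 t) = 1" using that sub norm by auto
        then show ?thesis by force
      qed
      ultimately have "continuous_on (X \<times> {0..b}) (\<lambda>z. Q (fst z) (snd z))"
        unfolding Q_def using nz by (intro continuous_on_divide) auto
      then have "continuous_on (X \<times> {0..b}) (\<lambda>z. Ln (Q (fst z) (snd z)))"
        by (rule continuous_on_Ln') (use Q(2) in \<open>force simp: complex_nonpos_Reals_iff\<close>)
      then show ?thesis unfolding A_def split_beta by (rule continuous_on_Im)
    qed
    have eq: "f x t = f x0 t + A x t" if x: "x \<in> X \<inter> Y" and t: "t \<in> {0..b}" for x t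
    proof -
      define \<delta> where "\<delta> t = f x t - f x0 t - A x t" for t
      have e1: "exp (\<i> * complex_of_real (\<delta> t)) = 1" if "t \<in> {0..b}" for t
      proof -
        have "cmod (p x t) = 1" "cmod (p x0 t) = 1" using that sub norm by auto
        then have nz: "p x t \<noteq> 0" "p x0 t \<noteq> 0" by force+
        have "exp (\<i> * complex_of_real (\<delta> t)) = p x t / p x0 t / Q x t"
          using x that sub f(3)[of t] A(1)[of x t] by (auto simp: \<delta>_def right_diff_distrib exp_diff)
        then show ?thesis using nz by (simp add: Q_def)
      qed
      have "continuous_on {0..b} \<delta>"
        unfolding \<delta>_def using x
        by (intro continuous_on_diff continuous_on_subset[OF f(1) sub]
            continuous_on_compose2[OF contA[unfolded split_beta], where f="\<lambda>t. (x, t)", simplified] continuous_intros) auto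
      \<comment> \<open>The values of \<open>\<delta>\<close> are multiples of 2 pi, hence at least
        2 pi apart when different.\<close>
      then have "\<delta> constant_on {0..b}"
      proof (rule continuous_discrete_range_constant[OF connected_Icc])
        fix s assume s: "s \<in> {0..b}"
        have "2 * pi \<le> norm (\<delta> t - \<delta> s)" if "t \<in> {0..b}" "\<delta> t \<noteq> \<delta> s" for t
          using exp_ii_eq_imp[of "\<delta> t" "\<delta> s"] e1[OF s] e1[OF that(1)] that(2) by fastforce
        then show "\<exists>e>0. \<forall>t. t \<in> {0..b} \<and> \<delta> t \<noteq> \<delta> s \<longrightarrow> e \<le> norm (\<delta> t - \<delta> s)"
          using pi_gt_zero by (intro exI[of _ "2 * pi"]) auto
      qed
      then have "\<delta> t = \<delta> 0" using t unfolding constant_on_def by auto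
      also have "\<delta> 0 = 0"
      proof (rule exp_ii_eq_imp)
        have b0: "0 \<in> {0..b}" using t by auto
        show "exp (\<i> * complex_of_real (\<delta> 0)) = exp (\<i> * complex_of_real 0)" using e1[OF b0] by simp
        \<comment> \<open>The two bounds add up to less than 2 pi, which excludes every nonzero
          multiple.\<close>
        have "\<bar>A x 0\<bar> < pi / 2" "\<bar>\<theta>0 x - \<theta>0 x0\<bar> < pi"
          using A(2)[OF _ b0] Y(3) x by (auto simp: dist_real_def)
        then show "\<bar>\<delta> 0 - 0\<bar> < 2 * pi" unfolding \<delta>_def f(2) by linarith
      qed
      finally show ?thesis by (simp add: \<delta>_def)
    qed
    \<comment> \<open>The ray \<open>{..<b}\<close> is open and contains \<open>t0\<close>, and
      inside \<open>?I\<close> it lies in \<open>{0..b}\<close>; this covers \<open>t0 = 0\<close>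
      as well.\<close>
    let ?W = "(X \<inter> Y) \<times> {..<b}"
    have in_W: "(UNIV \<times> ?I) \<inter> ?W \<subseteq> X \<times> {0..b}" "(UNIV \<times> ?I) \<inter> ?W \<subseteq> UNIV \<times> ?I"
      by (auto simp: time_interval_def)
    have "continuous_on ((UNIV \<times> ?I) \<inter> ?W) (\<lambda>z. f x0 (snd z) + A (fst z) (snd z))"
      using in_W by (intro continuous_on_add continuous_on_compose2[OF f(1)] continuous_intros
          continuous_on_subset[OF contA[unfolded split_beta]]) auto
    then have "continuous_on ((UNIV \<times> ?I) \<inter> ?W) (\<lambda>(x, t). f x t)"
      by (rule continuous_on_eq) (auto simp: eq time_interval_def)
    moreover have "open ?W" using X(2) Y(2) by (intro open_Times open_Int) auto
    ultimately show ?thesis using X(1) Y(1) b(2) by (intro exI[of _ ?W]) auto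
  qed
  have "continuous_on (UNIV \<times> ?I) (\<lambda>(x, t). f x t)"
    unfolding continuous_on_eq_continuous_within
  proof
    fix z assume z: "z \<in> (UNIV :: 'x set) \<times> ?I"
    then obtain W where W: "open W" "z \<in> W" "continuous_on ((UNIV \<times> ?I) \<inter> W) (\<lambda>(x, t). f x t)"
      using local[of "snd z" "fst z"] by auto
    then have "continuous (at z within (UNIV \<times> ?I) \<inter> W) (\<lambda>(x, t). f x t)"
      using z by (simp add: continuous_on_eq_continuous_within)
    then show "continuous (at z within UNIV \<times> ?I) (\<lambda>(x, t). f x t)"
      by (simp only: at_within_Int_nhd[OF W(2,1)])
  qed
  then show ?thesis
    by (rule that[of "\<lambda>t x. f x t", rotated]) (use f in auto)
qed

section \<open>The flow of graphs\<close>

locale graph_flow =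
  fixes A :: "('x::{t2_space,second_countable_topology}, 'n::finite) chart set"
    and g :: "'x \<Rightarrow> ('x, 'n) chart \<Rightarrow> real^'n^'n"
    and S :: "('s::{t2_space,second_countable_topology}, 'n) chart set"
    and T :: ereal
    and F :: "'s \<Rightarrow> real \<Rightarrow> 'x \<times> ('x, 'n) covector"
    and \<alpha> :: "real \<Rightarrow> 'x \<Rightarrow> ('x, 'n) covector"
  assumes mfd: "smooth_manifold A" and metric: "riemannian_metric A g"
    and mfd_S: "smooth_manifold S" and T_pos: "0 < T"
    and flow: "gen_mean_curvature_flow A g S T F"
    and closed: "\<And>t. t \<in> time_interval T \<Longrightarrow> closed_one_form A (\<alpha> t)"
    and graph: "\<And>t. t \<in> time_interval T \<Longrightarrow> range (\<lambda>\<sigma>. F \<sigma> t) = graph_of (\<alpha> t)"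
begin

abbreviation "I \<equiv> time_interval T"

abbreviation form_in :: "('x, 'n) chart \<Rightarrow> real \<Rightarrow> real^'n \<Rightarrow> real^'n" where
  "form_in c t \<equiv> in_chart c (\<alpha> t)"

lemma chart:
  assumes "c \<in> A"
  shows "open (dom_chart c)" "open (im_chart c)" "continuous_on (im_chart c) (inv_chart c)"
    "continuous_on (dom_chart c) (snd c)"
    and "\<And>x. x \<in> dom_chart c \<Longrightarrow> inv_chart c (snd c x) = x"
    and "\<And>x. x \<in> dom_chart c \<Longrightarrow> snd c x \<in> im_chart c"
    and "\<And>q. q \<in> im_chart c \<Longrightarrow> snd c (inv_chart c q) = q"
    and "\<And>q. q \<in> im_chart c \<Longrightarrow> inv_chart c q \<in> dom_chart c"
  using mfd assms unfolding smooth_manifold_def homeomorphism_def by blast+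

lemma chart_S:
  assumes "s \<in> S"
  shows "open (im_chart s)" "continuous_on (im_chart s) (inv_chart s)"
    and "\<And>x. x \<in> dom_chart s \<Longrightarrow> inv_chart s (snd s x) = x"
    and "\<And>x. x \<in> dom_chart s \<Longrightarrow> snd s x \<in> im_chart s"
    and "\<And>q. q \<in> im_chart s \<Longrightarrow> snd s (inv_chart s q) = q"
    and "\<And>q. q \<in> im_chart s \<Longrightarrow> inv_chart s q \<in> dom_chart s"
  using mfd_S assms unfolding smooth_manifold_def homeomorphism_def by blast+

lemma chart_around: "\<exists>c\<in>A. x \<in> dom_chart c"
  using mfd unfolding smooth_manifold_def by blast

lemma chart_around_S: "\<exists>s\<in>S. \<sigma> \<in> dom_chart s"
  using mfd_S unfolding smooth_manifold_def by blast

lemma zero_time: "0 \<in> I"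
  using T_pos by (simp add: time_interval_def zero_ereal_def)

lemma closed_form_chart:
  assumes c: "c \<in> A" and t: "t \<in> I"
  shows "closed_form_chart (in_chart c g) (form_in c t) (im_chart c)"
proof
  show "open (im_chart c)" by (rule chart[OF c])
  show "Cinf_on (in_chart c g) (im_chart c)" using metric c by (simp add: riemannian_metric_def)
  show "Cinf_on (form_in c t) (im_chart c)"
    using closed[OF t] c by (simp add: closed_one_form_def one_form_def)
  show "transpose (in_chart c g q) = in_chart c g q" if "q \<in> im_chart c" for q
    using metric c chart(8)[OF c that] unfolding riemannian_metric_def in_chart_def by blast
  show "v \<bullet> (in_chart c g q *v v) > 0" if "q \<in> im_chart c" "v \<noteq> 0" for q v
    using metric c chart(8)[OF c that(1)] that(2) unfolding riemannian_metric_def in_chart_def by blast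
  show "partial i (\<lambda>q. form_in c t q $ j) q = partial j (\<lambda>q. form_in c t q $ i) q" if "q \<in> im_chart c" for q i j
    using closed[OF t] c that unfolding closed_one_form_def by blast
qed

lemma snd_flow:
  assumes t: "t \<in> I"
  shows "snd (F \<sigma> t) = \<alpha> t (fst (F \<sigma> t))"
proof -
  have "F \<sigma> t \<in> graph_of (\<alpha> t)" using graph[OF t] by blast
  then show ?thesis by (auto simp: graph_of_def)
qed

lemma flow_onto:
  assumes t: "t \<in> I"
  obtains \<sigma> where "fst (F \<sigma> t) = x"
proof -
  have "(x, \<alpha> t x) \<in> range (\<lambda>\<sigma>. F \<sigma> t)" using graph[OF t] by (auto simp: graph_of_def)
  then show ?thesis using that by (metis fst_conv imageE)
qed

section \<open>The flow in charts\<close>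

definition flow_dom :: "('s, 'n) chart \<Rightarrow> ('x, 'n) chart \<Rightarrow> ((real^'n) \<times> real) set" where
  "flow_dom s c = {(y, t). y \<in> im_chart s \<and> t \<in> I \<and> fst (F (inv_chart s y) t) \<in> dom_chart c}"

definition flow_map :: "('s, 'n) chart \<Rightarrow> ('x, 'n) chart \<Rightarrow> (real^'n) \<times> real \<Rightarrow> 'n phase" where
  "flow_map s c = (\<lambda>(y, t). local_map s c (\<lambda>\<sigma>. F \<sigma> t) y)"

lemma flow_map: "flow_map s c (y, t) = cotangent_coord c (F (inv_chart s y) t)"
  by (simp add: flow_map_def local_map_def)

lemma graph_family:
  assumes s: "s \<in> S" and c: "c \<in> A"
  shows "graph_family T (flow_dom s c) (flow_map s c) (im_chart c) (form_in c)"
proof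
  have fam: "smooth_family A S T F" using flow by (simp add: gen_mean_curvature_flow_def)
  show "openin (top_of_set (UNIV \<times> I)) (flow_dom s c)"
  proof -
    have cont: "continuous_on (UNIV \<times> I) (\<lambda>z. fst (F (fst z) (snd z)))"
      using fam by (simp add: smooth_family_def split_beta)
    have "continuous_on (im_chart s \<times> I) (\<lambda>z. (inv_chart s (fst z), snd z))"
      by (intro continuous_on_Pair continuous_on_compose2[OF chart_S(2)[OF s]] continuous_on_fst continuous_on_snd
          continuous_on_id) auto
    from continuous_on_compose2[OF cont this]
    have "continuous_on (im_chart s \<times> I) (\<lambda>z. fst (F (inv_chart s (fst z)) (snd z)))"
      by (auto simp: image_subset_iff)
    from continuous_openin_preimage_gen[OF this chart(1)[OF c]]
    have "openin (top_of_set (im_chart s \<times> I)) (flow_dom s c)"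
      by (rule back_subst) (auto simp: flow_dom_def)
    moreover have "openin (top_of_set (UNIV \<times> I)) (im_chart s \<times> I)"
      using chart_S(1)[OF s] unfolding openin_open
      by (intro exI[of _ "im_chart s \<times> UNIV"]) (auto simp: open_Times)
    ultimately show ?thesis by (rule openin_trans)
  qed
  show "Cinf_on (flow_map s c) (flow_dom s c)"
    using fam s c by (simp add: smooth_family_def flow_map_def flow_dom_def)
  show "open (im_chart c)" by (rule chart[OF c])
  show "Cinf_on (form_in c t) (im_chart c)" if "t \<in> I" for t
    using closed[OF that] c by (simp add: closed_one_form_def one_form_def)
  fix y t assume D: "(y, t) \<in> flow_dom s c"
  then have D': "y \<in> im_chart s" "t \<in> I" "fst (F (inv_chart s y) t) \<in> dom_chart c" by (auto simp: flow_dom_def)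
  show "fst (flow_map s c (y, t)) \<in> im_chart c"
    using D' chart(6)[OF c] by (simp add: flow_map cotangent_coord_def)
  show "snd (flow_map s c (y, t)) = form_in c t (fst (flow_map s c (y, t)))"
    using D' chart(5)[OF c] snd_flow by (simp add: flow_map cotangent_coord_def in_chart_def)
  show "inj (fderiv (\<lambda>y. flow_map s c (y, t)) y)"
  proof -
    have "inj (fderiv (local_map s c (\<lambda>\<sigma>. F \<sigma> t)) (snd s (inv_chart s y)))"
      using flow D' s c chart_S(6)[OF s D'(1)]
      unfolding gen_mean_curvature_flow_def lagrangian_immersion_def Let_def by blast
    then show ?thesis using chart_S(5)[OF s D'(1)] by (simp add: flow_map_def)
  qed
qed

text \<open>The range of the flow is the whole graph, so what is proved along the local
  parametrisations holds at every point of a chart and at every time.\<close>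

lemma flow_covers:
  assumes c: "c \<in> A" and q: "q \<in> im_chart c" and t: "t \<in> I"
  obtains s y where "s \<in> S" "(y, t) \<in> flow_dom s c" "fst (flow_map s c (y, t)) = q"
proof -
  obtain \<sigma> where \<sigma>: "fst (F \<sigma> t) = inv_chart c q" using flow_onto[OF t] by blast
  obtain s where s: "s \<in> S" "\<sigma> \<in> dom_chart s" using chart_around_S by blast
  show ?thesis
    by (rule that[of s "snd s \<sigma>"])
      (use s c q t \<sigma> chart_S(3,4)[OF s] chart(7,8)[OF c q] in \<open>auto simp: flow_dom_def flow_map cotangent_coord_def\<close>)
qed

section \<open>The evolution equation of the forms\<close>

abbreviation angle_det_in :: "('x, 'n) chart \<Rightarrow> real \<Rightarrow> real^'n \<Rightarrow> complex" where
  "angle_det_in c t \<equiv> closed_form_chart.angle_det (in_chart c g) (form_in c t)"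

text \<open>The coordinate gradient of the Lagrangian angle, as
  \<open>angle_space_derivative\<close> confirms. The logarithmic derivative makes it available
  before the phase has been lifted.\<close>

definition dangle :: "('x, 'n) chart \<Rightarrow> real^'n \<Rightarrow> real \<Rightarrow> real^'n" where
  "dangle c q t = (\<chi> i. Im (fderiv (angle_det_in c t) q (axis i 1) / angle_det_in c t q))"

lemma dangle_inner:
  assumes "c \<in> A" "t \<in> I" "q \<in> im_chart c"
  shows "dangle c q t \<bullet> v = Im (fderiv (angle_det_in c t) q v / angle_det_in c t q)"
proof -
  have lin: "linear (fderiv (angle_det_in c t) q)"
    by (rule linear_frechet_derivative[OF closed_form_chart.diff_angle_det[OF closed_form_chart[OF assms(1,2)] assms(3)]])
  have "linear (\<lambda>v. Im (fderiv (angle_det_in c t) q v / angle_det_in c t q))"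
    by (rule linearI) (simp_all add: linear_add[OF lin] linear_cmul[OF lin] divide_inverse algebra_simps)
  from linear_axis_expansion[OF this, of v] show ?thesis
    by (simp add: dangle_def inner_vec_def mult.commute)
qed

text \<open>Any preimage of \<open>(q, t)\<close> serves: the motion along the graph is subtracted
  from the velocity, and what remains depends on \<open>q\<close> and \<open>t\<close>
  alone.\<close>

lemma form_time_derivative:
  assumes c: "c \<in> A" and q: "q \<in> im_chart c" and t: "t \<in> I"
  shows "((\<lambda>\<tau>. form_in c \<tau> q) has_vector_derivative dangle c q t) (at t within I)"
proof -
  obtain s y where s: "s \<in> S" and y: "(y, t) \<in> flow_dom s c" and q': "fst (flow_map s c (y, t)) = q"
    using flow_covers[OF c q t] by blast
  interpret gf: graph_family T "flow_dom s c" "flow_map s c" "im_chart c" "form_in c"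
    by (rule graph_family[OF s c])
  interpret cf: closed_form_chart "in_chart c g" "form_in c t" "im_chart c"
    by (rule closed_form_chart[OF c t])
  have y': "y \<in> im_chart s" "fst (F (inv_chart s y) t) \<in> dom_chart c" using y by (auto simp: flow_dom_def)
  have "inv_chart s y \<in> dom_chart s" by (rule chart_S(6)[OF s y'(1)])
  then obtain H where H: "is_gen_mean_curvature (in_chart c g) (local_map s c (\<lambda>\<sigma>. F \<sigma> t)) (snd s (inv_chart s y)) H"
    "((\<lambda>\<tau>. cotangent_coord c (F (inv_chart s y) \<tau>)) has_vector_derivative H) (at t within I)"
    using flow s c t y'(2) unfolding gen_mean_curvature_flow_def by blast
  have "((\<lambda>\<tau>. flow_map s c (y, \<tau>)) has_vector_derivative H) (at t within I)"
    using H(2) by (simp add: flow_map)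
  from gf.time_derivative[OF y this]
  have der: "((\<lambda>\<tau>. form_in c \<tau> q) has_vector_derivative snd H - fderiv (form_in c t) q (fst H)) (at t within I)"
    by (simp add: q')
  have Hy: "is_gen_mean_curvature (in_chart c g) (local_map s c (\<lambda>\<sigma>. F \<sigma> t)) y H"
    using H(1) by (simp add: chart_S(5)[OF s y'(1)])
  have slice: "Cinf_on (\<lambda>y. fst (flow_map s c (y, t))) {y. (y, t) \<in> flow_dom s c}"
    by (rule Cinf_on_fst[OF Cinf_on_slice[OF gf.smooth_Fl]])
  have "(snd H - fderiv (form_in c t) q (fst H)) \<bullet> v = dangle c q t \<bullet> v" for v
  proof -
    have "(snd H - fderiv (form_in c t) (fst (flow_map s c (y, t))) (fst H)) \<bullet> v
        = Im (fderiv cf.angle_det (fst (flow_map s c (y, t))) v / cf.angle_det (fst (flow_map s c (y, t))))"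
    proof (rule cf.gen_mean_curvature_graph[OF gf.open_slice _ slice _ _ Hy])
      show "local_map s c (\<lambda>\<sigma>. F \<sigma> t) z = (fst (flow_map s c (z, t)), form_in c t (fst (flow_map s c (z, t))))"
        if "z \<in> {y. (y, t) \<in> flow_dom s c}" for z
        using gf.graph[of z t] that by (simp add: flow_map_def prod_eq_iff)
    qed (use y gf.in_U in auto)
    then show ?thesis by (simp add: q' dangle_inner[OF c t q])
  qed
  then have "snd H - fderiv (form_in c t) q (fst H) = dangle c q t"
    using vector_eq_rdot by blast
  then show ?thesis using der by simp
qed

lemma continuous_form:
  assumes c: "c \<in> A"
  shows "continuous_on (im_chart c \<times> I) (\<lambda>(q, t). form_in c t q)"
    and "continuous_on (im_chart c \<times> I) (\<lambda>(q, t). fderiv (form_in c t) q v)"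
    and "continuous_on (im_chart c \<times> I) (\<lambda>(q, t). dangle c q t)"
proof -
  have "continuous (at (q, t) within im_chart c \<times> I) (\<lambda>(q, t). form_in c t q) \<and>
      continuous (at (q, t) within im_chart c \<times> I) (\<lambda>(q, t). fderiv (form_in c t) q v) \<and>
      continuous (at (q, t) within im_chart c \<times> I) (\<lambda>(q, t). dangle c q t)"
    if qt: "q \<in> im_chart c" "t \<in> I" for q t
  proof -
    obtain s y where s: "s \<in> S" and y: "(y, t) \<in> flow_dom s c" and q': "fst (flow_map s c (y, t)) = q"
      using flow_covers[OF c qt] by blast
    interpret gf: graph_family T "flow_dom s c" "flow_map s c" "im_chart c" "form_in c"
      by (rule graph_family[OF s c])
    have sub: "im_chart c \<times> I \<subseteq> UNIV \<times> I" by auto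
    show ?thesis
      using continuous_within_subset[OF gf.continuous_a[OF y] sub]
        continuous_within_subset[OF gf.continuous_fderiv_a[OF y, of v] sub]
        continuous_within_subset[OF gf.continuous_time_derivative[OF y form_time_derivative[OF c]] sub]
      by (simp add: q')
  qed
  then show "continuous_on (im_chart c \<times> I) (\<lambda>(q, t). form_in c t q)"
    "continuous_on (im_chart c \<times> I) (\<lambda>(q, t). fderiv (form_in c t) q v)"
    "continuous_on (im_chart c \<times> I) (\<lambda>(q, t). dangle c q t)"
    by (auto simp: continuous_on_eq_continuous_within)
qed

lemma continuous_angle_det:
  assumes c: "c \<in> A"
  shows "continuous_on (im_chart c \<times> I) (\<lambda>(q, t). angle_det_in c t q)"
proof -
  note cf = closed_form_chart[OF c]
  have cont: "continuous_on (im_chart c \<times> I) (\<lambda>z. h (fst z))"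
    if "\<And>q. q \<in> im_chart c \<Longrightarrow> h differentiable (at q)" for h :: "real^'n \<Rightarrow> real"
  proof -
    have "continuous_on (im_chart c) h"
      using that by (intro differentiable_imp_continuous_on) (auto simp: differentiable_on_def differentiable_at_withinI)
    then show ?thesis by (rule continuous_on_compose2) (auto intro: continuous_intros)
  qed
  have hess: "continuous_on (im_chart c \<times> I) (\<lambda>z. closed_form_chart.hess (in_chart c g) (form_in c (snd z)) (fst z) $ i $ j)" for i j
  proof -
    have "continuous_on (im_chart c \<times> I) (\<lambda>z. fderiv (form_in c (snd z)) (fst z) (axis i 1) $ j
        - (\<Sum>k\<in>UNIV. christoffel (in_chart c g) (fst z) k i j * form_in c (snd z) (fst z) $ k))"
      using continuous_form(1)[OF c] continuous_form(2)[OF c, of "axis i 1"]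
      unfolding split_beta
      \<comment> \<open>The Christoffel symbols depend on the metric alone; the form at time 0
        merely instantiates the locale.\<close>
      by (intro continuous_intros cont closed_form_chart.diff_christoffel[OF cf[OF zero_time]])
    then show ?thesis
    proof (rule continuous_on_eq)
      fix z assume "z \<in> im_chart c \<times> I"
      then have z: "fst z \<in> im_chart c" "snd z \<in> I" by auto
      show "fderiv (form_in c (snd z)) (fst z) (axis i 1) $ j
        - (\<Sum>k\<in>UNIV. christoffel (in_chart c g) (fst z) k i j * form_in c (snd z) (fst z) $ k)
        = closed_form_chart.hess (in_chart c g) (form_in c (snd z)) (fst z) $ i $ j"
        by (simp add: closed_form_chart.hess_def[OF cf[OF z(2)]] cov_deriv_def partial_def
            fderiv_vec_nth[OF closed_form_chart.diff_a[OF cf[OF z(2)] z(1)]])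
    qed
  qed
  have "continuous_on (im_chart c \<times> I) (\<lambda>z. det (cmatrix (in_chart c g (fst z))
      (closed_form_chart.hess (in_chart c g) (form_in c (snd z)) (fst z))))"
    unfolding cmatrix_def
    by (intro continuous_on_det, simp, intro continuous_intros hess cont closed_form_chart.diff_g[OF cf[OF zero_time]])
  then show ?thesis
    by (rule continuous_on_eq) (auto simp: closed_form_chart.angle_det_def[OF cf])
qed

section \<open>The phase as a function on X and time\<close>

lemma phase_chart_independent:
  assumes c: "c \<in> A" and d: "d \<in> A" and x: "x \<in> dom_chart c" "x \<in> dom_chart d" and t: "t \<in> I"
  shows "angle_phase (in_chart c g) (form_in c t) (snd c x) = angle_phase (in_chart d g) (form_in d t) (snd d x)"
proof -
  define V where "V = snd c ` (dom_chart c \<inter> dom_chart d)"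
  define \<psi> where "\<psi> = snd d \<circ> inv_chart c"
  have V_eq: "V = im_chart c \<inter> inv_chart c -` dom_chart d"
    unfolding V_def using chart(5-8)[OF c] by force
  have "open V" unfolding V_eq
    by (rule continuous_open_preimage[OF chart(3)[OF c] chart(2)[OF c] chart(1)[OF d]])
  have "angle_phase (in_chart c g) (form_in c t) (snd c x) = angle_phase (in_chart d g) (form_in d t) (\<psi> (snd c x))"
  proof (rule angle_phase_transform[OF closed_form_chart[OF c t] closed_form_chart[OF d t] \<open>open V\<close>])
    show "V \<subseteq> im_chart c" by (simp add: V_eq)
    show "Cinf_on \<psi> V" unfolding \<psi>_def V_def using mfd c d by (simp add: smooth_manifold_def)
    show "\<psi> ` V \<subseteq> im_chart d" using chart(6)[OF d] by (auto simp: V_eq \<psi>_def)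
    show "snd c x \<in> V" using x by (simp add: V_def)
    fix q assume q: "q \<in> V"
    define z where "z = inv_chart c q"
    have z: "z \<in> dom_chart c" "z \<in> dom_chart d" "snd c z = q" "inv_chart d (\<psi> q) = z"
      using q chart(7,8)[OF c] chart(5)[OF d] by (auto simp: V_eq z_def \<psi>_def)
    have J: "jacobian c d z = matrix (fderiv \<psi> q)" by (simp add: jacobian_def \<psi>_def z(3))
    show "in_chart c g q = transpose (matrix (fderiv \<psi> q)) ** in_chart d g (\<psi> q) ** matrix (fderiv \<psi> q)"
    proof -
      have "g z c = transpose (jacobian c d z) ** g z d ** jacobian c d z"
        using metric c d z(1,2) unfolding riemannian_metric_def by blast
      then show ?thesis by (simp add: in_chart_def z(4) J flip: z_def)
    qed
    have "(z, \<alpha> t z) \<in> cotangent_bundle A"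
      using closed[OF t] by (simp add: closed_one_form_def one_form_def)
    then have "\<alpha> t z c = transpose (jacobian c d z) *v \<alpha> t z d"
      using c d z(1,2) unfolding cotangent_bundle_def by blast
    then show "form_in c t q = transpose (matrix (fderiv \<psi> q)) *v form_in d t (\<psi> q)"
      by (simp add: in_chart_def z(4) J flip: z_def)
  qed
  then show ?thesis by (simp add: \<psi>_def chart(5)[OF c x(1)])
qed

text \<open>The chosen chart is immaterial by \<open>phase_chart_independent\<close>.\<close>

definition phase :: "'x \<Rightarrow> real \<Rightarrow> complex" where
  "phase x t = (let c = SOME c. c \<in> A \<and> x \<in> dom_chart c in angle_phase (in_chart c g) (form_in c t) (snd c x))"

lemma phase_eq:
  assumes c: "c \<in> A" and x: "x \<in> dom_chart c" and t: "t \<in> I"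
  shows "phase x t = angle_phase (in_chart c g) (form_in c t) (snd c x)"
    and "phase x t = sgn (angle_det_in c t (snd c x))"
proof -
  have "(SOME c. c \<in> A \<and> x \<in> dom_chart c) \<in> A \<and> x \<in> dom_chart (SOME c. c \<in> A \<and> x \<in> dom_chart c)"
    by (rule someI[of "\<lambda>c. c \<in> A \<and> x \<in> dom_chart c" c]) (use c x in simp)
  then show 1: "phase x t = angle_phase (in_chart c g) (form_in c t) (snd c x)"
    unfolding phase_def Let_def using phase_chart_independent c x t by blast
  show "phase x t = sgn (angle_det_in c t (snd c x))"
    unfolding 1 by (rule closed_form_chart.angle_phase[OF closed_form_chart[OF c t] chart(6)[OF c x]])
qed

lemma norm_phase: "t \<in> I \<Longrightarrow> cmod (phase x t) = 1"
proof -
  assume t: "t \<in> I"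
  obtain c where c: "c \<in> A" "x \<in> dom_chart c" using chart_around by blast
  show ?thesis
    using closed_form_chart.angle_det_nz[OF closed_form_chart[OF c(1) t] chart(6)[OF c]]
    by (simp add: phase_eq(2)[OF c t] norm_sgn)
qed

lemma continuous_phase: "continuous_on (UNIV \<times> I) (\<lambda>(x, t). phase x t)"
  unfolding continuous_on_eq_continuous_within
proof
  fix z assume z: "z \<in> (UNIV :: 'x set) \<times> I"
  obtain c where c: "c \<in> A" "fst z \<in> dom_chart c" using chart_around by blast
  define W where "W = dom_chart c \<times> (UNIV :: real set)"
  have W: "open W" "z \<in> W" using chart(1)[OF c(1)] c(2) by (auto simp: W_def open_Times mem_Times_iff)
  have "continuous_on ((UNIV \<times> I) \<inter> W) (\<lambda>z. (snd c (fst z), snd z))"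
    by (intro continuous_on_Pair continuous_on_compose2[OF chart(4)[OF c(1)]] continuous_on_fst continuous_on_snd
        continuous_on_id) (auto simp: W_def)
  moreover have "(\<lambda>z. (snd c (fst z), snd z)) ` ((UNIV \<times> I) \<inter> W) \<subseteq> im_chart c \<times> I"
    using chart(6)[OF c(1)] by (auto simp: W_def)
  ultimately
  have "continuous_on ((UNIV \<times> I) \<inter> W) (\<lambda>z. angle_det_in c (snd z) (snd c (fst z)))"
    using continuous_on_compose2[OF continuous_angle_det[OF c(1), unfolded split_beta]] by fastforce
  then have "continuous_on ((UNIV \<times> I) \<inter> W) (\<lambda>z. sgn (angle_det_in c (snd z) (snd c (fst z))))"
    by (rule continuous_on_sgn)
      (use closed_form_chart.angle_det_nz[OF closed_form_chart[OF c(1)]] chart(6)[OF c(1)] in \<open>auto simp: W_def\<close>)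
  then have "continuous_on ((UNIV \<times> I) \<inter> W) (\<lambda>(x, t). phase x t)"
    by (rule continuous_on_eq) (auto simp: W_def phase_eq(2)[OF c(1)])
  then have "continuous (at z within (UNIV \<times> I) \<inter> W) (\<lambda>(x, t). phase x t)"
    using z W(2) by (simp add: continuous_on_eq_continuous_within)
  then show "continuous (at z within UNIV \<times> I) (\<lambda>(x, t). phase x t)"
    by (simp only: at_within_Int_nhd[OF W(2,1)])
qed

end

section \<open>The lifted angle and the potential\<close>

context graph_flow
begin

lemma phase_lift:
  assumes angle: "is_lagrangian_angle A g (\<alpha> 0) \<theta>0" and osc: "osc \<theta>0 < ereal (2 * pi)"
  shows "\<exists>\<theta>. \<theta> 0 = \<theta>0 \<and> continuous_on (UNIV \<times> I) (\<lambda>(x, t). \<theta> t x) \<and>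
    (\<forall>x. \<forall>t\<in>I. exp (\<i> * complex_of_real (\<theta> t x)) = phase x t)"
proof -
  have init: "exp (\<i> * complex_of_real (\<theta>0 x)) = phase x 0" for x
  proof -
    obtain c where c: "c \<in> A" "x \<in> dom_chart c" using chart_around by blast
    then show ?thesis using angle phase_eq(1)[OF c zero_time] by (simp add: is_lagrangian_angle_def)
  qed
  have "continuous_on UNIV (\<lambda>x. case (x, 0) of (x, t) \<Rightarrow> phase x t)"
    by (rule continuous_on_compose2[OF continuous_phase])
      (use zero_time in \<open>auto intro!: continuous_on_Pair continuous_on_const continuous_on_id\<close>)
  then have "continuous_on UNIV (\<lambda>x. exp (\<i> * complex_of_real (\<theta>0 x)))" by (simp add: init)
  then have cont0: "continuous_on UNIV \<theta>0" by (rule continuous_angle_of_osc[OF osc])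
  show ?thesis
  proof (rule angle_homotopy_lift[OF T_pos continuous_phase norm_phase cont0 init])
    fix \<theta> assume "\<theta> 0 = \<theta>0" "continuous_on (UNIV \<times> I) (\<lambda>(x, t). \<theta> t x)"
      "\<And>x t. t \<in> I \<Longrightarrow> exp (\<i> * complex_of_real (\<theta> t x)) = phase x t"
    then show ?thesis by (intro exI[of _ \<theta>] conjI allI ballI)
  qed
qed

context
  fixes \<theta> :: "real \<Rightarrow> 'x \<Rightarrow> real"
  assumes cont: "continuous_on (UNIV \<times> I) (\<lambda>(x, t). \<theta> t x)"
    and lift: "\<And>x t. t \<in> I \<Longrightarrow> exp (\<i> * complex_of_real (\<theta> t x)) = phase x t"
begin

definition potential :: "real \<Rightarrow> 'x \<Rightarrow> real" where
  "potential t x = integral {0..t} (\<lambda>\<tau>. \<theta> \<tau> x)"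

lemma continuous_time: "continuous_on I (\<lambda>t. \<theta> t x)"
proof -
  have "continuous_on I (\<lambda>t. case (x, t) of (x, t) \<Rightarrow> \<theta> t x)"
    by (rule continuous_on_compose2[OF cont]) (auto intro!: continuous_on_Pair continuous_on_const continuous_on_id)
  then show ?thesis by simp
qed

lemma potential_time_derivative:
  assumes t: "t \<in> I"
  shows "((\<lambda>\<tau>. potential \<tau> x) has_real_derivative \<theta> t x) (at t within I)"
proof -
  obtain b where b: "b \<in> I" "t < b" using time_interval_later[OF t] by blast
  have t0: "0 \<le> t" using t by (simp add: time_interval_def)
  have "((\<lambda>\<tau>. potential \<tau> x) has_real_derivative \<theta> t x) (at t within {0..b})"
    unfolding potential_def has_real_derivative_iff_has_vector_derivative
    by (rule integral_has_vector_derivative)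
      (use t0 b continuous_on_subset[OF continuous_time time_interval_Icc[OF b(1)]] in auto)
  \<comment> \<open>Near \<open>t\<close> the interval \<open>I\<close> coincides with
    \<open>{0..b}\<close>, on which the fundamental theorem of calculus is applied.\<close>
  moreover have "I \<inter> {..<b} = {0..b} \<inter> {..<b}"
    using time_interval_Icc[OF b(1)] by (auto simp: time_interval_def)
  then have "at t within I = at t within {0..b}"
    using at_within_Int_nhd[of t "{..<b}" I] at_within_Int_nhd[of t "{..<b}" "{0..b}"] b(2) by simp
  ultimately show ?thesis by simp
qed

lemma angle_space_derivative:
  assumes c: "c \<in> A" and q: "q \<in> im_chart c" and t: "t \<in> I"
  shows "((\<lambda>q. \<theta> t (inv_chart c q)) has_derivative (\<lambda>v. dangle c q t \<bullet> v)) (at q)"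
proof -
  interpret cf: closed_form_chart "in_chart c g" "form_in c t" "im_chart c"
    by (rule closed_form_chart[OF c t])
  have "((\<lambda>q. \<theta> t (inv_chart c q)) has_derivative (\<lambda>v. Im (fderiv cf.angle_det q v / cf.angle_det q))) (at q)"
  proof (rule angle_has_derivative[where D=cf.angle_det, OF _ cf.angle_det_nz[OF q] _ chart(2)[OF c] q])
    show "(cf.angle_det has_derivative fderiv cf.angle_det q) (at q)"
      using cf.diff_angle_det[OF q] by (simp add: frechet_derivative_works)
    have "continuous_on (im_chart c) (\<lambda>q. case (inv_chart c q, t) of (x, t) \<Rightarrow> \<theta> t x)"
      by (rule continuous_on_compose2[OF cont])
        (use t in \<open>auto intro!: continuous_on_Pair continuous_on_const chart(3)[OF c]\<close>)
    then show "isCont (\<lambda>q. \<theta> t (inv_chart c q)) q"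
      using q by (simp add: continuous_on_eq_continuous_at[OF chart(2)[OF c]])
    show "exp (\<i> * complex_of_real (\<theta> t (inv_chart c z))) = sgn (cf.angle_det z)" if "z \<in> im_chart c" for z
      using phase_eq(2)[OF c chart(8)[OF c that] t] chart(7)[OF c that] lift[OF t] by simp
  qed
  then show ?thesis by (simp add: dangle_inner[OF c t q])
qed

text \<open>Differentiation under the integral gives the integral of d\<theta>; by the flow equation
  the integrand is the time derivative of the form, so the difference of its end values
  remains.\<close>

lemma potential_space_derivative:
  assumes c: "c \<in> A" and q: "q \<in> im_chart c" and t: "t \<in> I"
  shows "((potential t \<circ> inv_chart c) has_derivative (\<lambda>v. (form_in c t q - form_in c 0 q) \<bullet> v)) (at q)"
proof -
  have t0: "0 \<le> t" using t by (simp add: time_interval_def)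
  have sub: "{0..t} \<subseteq> I" by (rule time_interval_Icc[OF t])
  \<comment> \<open>A ball supplies the convex set for \<open>leibniz_rule\<close>.\<close>
  obtain r where r: "r > 0" "ball q r \<subseteq> im_chart c" using chart(2)[OF c] q openE by blast
  have cont_d: "continuous_on (ball q r \<times> {0..t}) (\<lambda>(q, t). dangle c q t)"
    by (rule continuous_on_subset[OF continuous_form(3)[OF c]]) (use r sub in auto)
  have "((\<lambda>q. integral (cbox 0 t) (\<lambda>\<tau>. \<theta> \<tau> (inv_chart c q))) has_derivative
      integral (cbox 0 t) (\<lambda>\<tau>. blinfun_inner_right (dangle c q \<tau>))) (at q within ball q r)"
  proof (rule leibniz_rule)
    fix x \<tau> assume "x \<in> ball q r" "\<tau> \<in> cbox 0 t"
    then have "x \<in> im_chart c" "\<tau> \<in> I" using r(2) sub by auto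
    then show "((\<lambda>x. \<theta> \<tau> (inv_chart c x)) has_derivative blinfun_apply (blinfun_inner_right (dangle c x \<tau>))) (at x within ball q r)"
      using angle_space_derivative[OF c] by (simp add: has_derivative_at_withinI)
  next
    fix x
    show "(\<lambda>\<tau>. \<theta> \<tau> (inv_chart c x)) integrable_on cbox 0 t"
      using continuous_on_subset[OF continuous_time sub] by (auto intro: integrable_continuous_real)
  next
    show "continuous_on (ball q r \<times> cbox 0 t) (\<lambda>(x, \<tau>). blinfun_inner_right (dangle c x \<tau>))"
      using bounded_linear.continuous_on[OF bounded_linear_blinfun_inner_right cont_d] by (simp add: split_beta)
  qed (use r(1) in auto)
  moreover have "integral (cbox 0 t) (\<lambda>\<tau>. blinfun_inner_right (dangle c q \<tau>))
      = blinfun_inner_right (form_in c t q - form_in c 0 q)"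
  proof -
    have "((\<lambda>\<tau>. dangle c q \<tau>) has_integral (form_in c t q - form_in c 0 q)) {0..t}"
      using has_vector_derivative_within_subset[OF form_time_derivative[OF c q] sub] sub
      by (intro fundamental_theorem_of_calculus t0) auto
    then have "((\<lambda>\<tau>. blinfun_inner_right (dangle c q \<tau>)) has_integral
        blinfun_inner_right (form_in c t q - form_in c 0 q)) {0..t}"
      by (rule has_integral_linear[OF _ bounded_linear_blinfun_inner_right, unfolded o_def])
    then show ?thesis by (simp add: integral_unique)
  qed
  ultimately have "((\<lambda>q. potential t (inv_chart c q)) has_derivative (\<lambda>v. (form_in c t q - form_in c 0 q) \<bullet> v)) (at q within ball q r)"
    by (simp add: potential_def)
  then show ?thesis using r(1) at_within_open[of q "ball q r"] by (simp add: o_def)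
qed

text \<open>The derivative is the difference of two smooth forms, so all higher orders come from
  them.\<close>

lemma smooth_potential:
  assumes t: "t \<in> I"
  shows "smooth_function A (potential t)"
  unfolding smooth_function_def Cinf_on_def
proof (intro ballI allI)
  fix c k assume c: "c \<in> A"
  note der = potential_space_derivative[OF c _ t]
  show "Ck_on k (potential t \<circ> inv_chart c) (im_chart c)"
  proof (cases k)
    case 0
    have "continuous_on (im_chart c) (potential t \<circ> inv_chart c)"
      using has_derivative_continuous[OF der] by (simp add: continuous_at_imp_continuous_on del: comp_apply)
    then show ?thesis by (simp add: 0)
  next
    case (Suc m)
    have "Ck_on m (\<lambda>q. (form_in c t q - form_in c 0 q) \<bullet> v) (im_chart c)" for v
      using closed_form_chart.smooth_a[OF closed_form_chart[OF c t]]
        closed_form_chart.smooth_a[OF closed_form_chart[OF c zero_time]]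
      unfolding Cinf_on_def by (intro Ck_on_linear_compose[OF Ck_on_diff bounded_linear_inner_left]) auto
    then show ?thesis
      using has_derivative_at_withinI[OF der] unfolding Suc Ck_on.simps
      by (intro exI[of _ "\<lambda>q v. (form_in c t q - form_in c 0 q) \<bullet> v"]) auto
  qed
qed

lemma differential_potential:
  assumes t: "t \<in> I"
  shows "\<alpha> t x c = \<alpha> 0 x c + differential A (potential t) x c"
proof (cases "c \<in> A \<and> x \<in> dom_chart c")
  case True
  then have c: "c \<in> A" and x: "x \<in> dom_chart c" by auto
  have "partial i (potential t \<circ> inv_chart c) (snd c x) = \<alpha> t x c $ i - \<alpha> 0 x c $ i" for i
    using fderiv_eq[OF potential_space_derivative[OF c chart(6)[OF c x] t]]
    by (simp add: partial_def inner_axis in_chart_def chart(5)[OF c x])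
  then show ?thesis using True by (simp add: differential_def vec_eq_iff)
next
  case False
  \<comment> \<open>Outside the charts around \<open>x\<close> all three covectors have the default
    value 0.\<close>
  have "(x, \<alpha> s x) \<in> cotangent_bundle A" if "s \<in> I" for s
    using closed[OF that] by (simp add: closed_one_form_def one_form_def)
  then have "\<alpha> s x c = 0" if "s \<in> I" for s
    using that False unfolding cotangent_bundle_def by blast
  then show ?thesis using False t zero_time by (auto simp: differential_def)
qed

lemma lagrangian_angle_lift: "t \<in> I \<Longrightarrow> is_lagrangian_angle A g (\<alpha> t) (\<theta> t)"
  unfolding is_lagrangian_angle_def using lift phase_eq(1) by simp

end

end

theorem theorem2p16:
  fixes A :: "('x::{t2_space,second_countable_topology}, 'n::finite) chart set"
    and g :: "'x \<Rightarrow> ('x, 'n) chart \<Rightarrow> real^'n^'n"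
    and S :: "('s::{t2_space,second_countable_topology}, 'n) chart set"
    and T :: ereal
    and F :: "'s \<Rightarrow> real \<Rightarrow> 'x \<times> ('x, 'n) covector"
    and \<alpha> :: "real \<Rightarrow> 'x \<Rightarrow> ('x, 'n) covector"
    and \<theta>\<^sub>0 :: "'x \<Rightarrow> real"
  assumes "smooth_manifold A" and "riemannian_metric A g"
    and "smooth_manifold S" and "0 < T"
    and "gen_mean_curvature_flow A g S T F"
    and "\<forall>t\<in>time_interval T. closed_one_form A (\<alpha> t)"
    and "\<forall>t\<in>time_interval T. range (\<lambda>\<sigma>. F \<sigma> t) = graph_of (\<alpha> t)"
    and "is_lagrangian_angle A g (\<alpha> 0) \<theta>\<^sub>0"
    and "osc \<theta>\<^sub>0 < ereal (2 * pi)"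
  shows "\<exists>(u :: real \<Rightarrow> 'x \<Rightarrow> real) (\<theta> :: real \<Rightarrow> 'x \<Rightarrow> real).
      (\<forall>t\<in>time_interval T. smooth_function A (u t) \<and>
         (\<forall>x c. \<alpha> t x c = \<alpha> 0 x c + differential A (u t) x c)) \<and>
      \<theta> 0 = \<theta>\<^sub>0 \<and>
      continuous_on (UNIV \<times> time_interval T) (\<lambda>(x, t). \<theta> t x) \<and>
      (\<forall>t\<in>time_interval T. is_lagrangian_angle A g (\<alpha> t) (\<theta> t)) \<and>
      (\<forall>t\<in>time_interval T. \<forall>x.
         ((\<lambda>\<tau>. u \<tau> x) has_real_derivative \<theta> t x) (at t within time_interval T))"
proof -
  interpret graph_flow A g S T F \<alpha>
    by unfold_locales (use assms in auto)
  obtain \<theta> where \<theta>: "\<theta> 0 = \<theta>\<^sub>0" "continuous_on (UNIV \<times> time_interval T) (\<lambda>(x, t). \<theta> t x)"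
    "\<And>x t. t \<in> time_interval T \<Longrightarrow> exp (\<i> * complex_of_real (\<theta> t x)) = phase x t"
    using phase_lift[OF assms(8,9)] by blast
  show ?thesis
    by (intro exI[of _ "potential \<theta>"] exI[of _ \<theta>] conjI ballI allI \<theta>(1,2)
        smooth_potential[OF \<theta>(2,3)] differential_potential[OF \<theta>(2,3)]
        lagrangian_angle_lift[OF \<theta>(2,3)] potential_time_derivative[OF \<theta>(2,3)])
qed

end
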